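(* Let $d\ge 2$ and consider Bernoulli bond percolation on $\mathbb{Z}^d$ with one-arm exponent $\eta_1$ as defined in the context. Then \[ \eta_1 \le \begin{cases} 1/3 & d=2,\\ d/3 & d\ge 3.\end{cases}\]
   Context: Let $\mathbb{Z}^d=(\mathcal V,\mathcal E)$ be the hypercubic lattice with nearest-neighbour edges. For $p\in[0,1]$, $\mathbb{P}_p$ denotes the law of Bernoulli bond percolation: each edge is open independently with probability $p$. For $A,B\subseteq\mathcal V$, $\{A\longleftrightarrow B\}$ is the event that there is a path of open edges intersecting both $A$ and $B$ (the empty path is allowed, so the event occurs if $A\cap B\neq\emptyset$). Let $\Lambda_R=[-R,R]^d\cap\mathbb{Z}^d$ with boundary $\partial\Lambda_R$ (vertices of $\Lambda_R$ of sup-norm $R$). Let $\theta(p)=\lim_{R\to\infty}\mathbb{P}_p[0\longleftrightarrow\partial\Lambda_R]$ and let $p_c\in(0,1)$ be the critical parameter, so that $\theta(p)=0$ for $p<p_c$ and $\theta(p)>0$ for $p>p_c$. The one-arm exponent is \[\eta_1:=\liminf_{R\to\infty}\frac{-\log\mathbb{P}_{p_c}[0\longleftrightarrow\partial\Lambda_R]}{\log R}.\] *)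

theory Defs
  imports "HOL-Probability.Probability"
begin

text \<open>Vertices of the hypercubic lattice Z^d are integer vectors indexed by a finite type 'd
  with d = CARD('d).\<close>

definition lattice_adj :: "int ^ ('d::finite) \<Rightarrow> int ^ 'd \<Rightarrow> bool" where
  "lattice_adj x y \<longleftrightarrow> (\<Sum>i\<in>UNIV. \<bar>x $ i - y $ i\<bar>) = 1"

definition lattice_edges :: "(int ^ ('d::finite)) set set" where
  "lattice_edges = {{x, y} | x y. lattice_adj x y}"

definition perc_measure :: "real \<Rightarrow> ((int ^ ('d::finite)) set \<Rightarrow> bool) measure" where
  "perc_measure p = PiM (lattice_edges :: (int ^ 'd) set set) (\<lambda>_. measure_pmf (bernoulli_pmf p))"

definition connects :: "((int ^ ('d::finite)) set \<Rightarrow> bool) \<Rightarrow> (int ^ 'd) set \<Rightarrow> (int ^ 'd) set \<Rightarrow> bool" where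
  "connects \<omega> A B \<longleftrightarrow> (\<exists>xs. xs \<noteq> [] \<and>
      (\<forall>i. Suc i < length xs \<longrightarrow>
          {xs ! i, xs ! Suc i} \<in> lattice_edges \<and> \<omega> {xs ! i, xs ! Suc i}) \<and>
      set xs \<inter> A \<noteq> {} \<and> set xs \<inter> B \<noteq> {})"

definition perc_prob :: "real \<Rightarrow> (int ^ ('d::finite)) set \<Rightarrow> (int ^ 'd) set \<Rightarrow> real" where
  "perc_prob p A B = measure (perc_measure p)
      {\<omega> \<in> space (perc_measure p :: ((int ^ 'd) set \<Rightarrow> bool) measure). connects \<omega> A B}"

definition box_boundary :: "nat \<Rightarrow> (int ^ ('d::finite)) set" where
  "box_boundary R = {x. (\<forall>i. \<bar>x $ i\<bar> \<le> int R) \<and> (\<exists>i. \<bar>x $ i\<bar> = int R)}"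

definition perc_theta :: "('d::finite) itself \<Rightarrow> real \<Rightarrow> real" where
  "perc_theta _ p = lim (\<lambda>R. perc_prob p {0 :: int ^ 'd} (box_boundary R))"

definition perc_pc :: "('d::finite) itself \<Rightarrow> real" where
  "perc_pc D = Sup {p \<in> {0..1}. perc_theta D p = 0}"

definition one_arm_exponent :: "('d::finite) itself \<Rightarrow> ereal" where
  "one_arm_exponent D = liminf (\<lambda>R::nat.
      ereal (- ln (perc_prob (perc_pc D) {0 :: int ^ 'd} (box_boundary R)) / ln (real R)))"

end

theory Submission
  imports Defs "HOL-Real_Asymp.Real_Asymp"
begin

text \<open>
  Write \<open>\<pi>(R)\<close> for the one-arm probability at \<open>p\<^sub>c\<close> and suppose that \<open>\<pi>(R)\<close> is at most of order \<open>R\<close> to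
  the power \<open>-\<eta>\<close>.

  In any dimension, the finite-volume criterion of Duminil-Copin and Tassion shows that at \<open>p\<^sub>c\<close> the
  covariance of the one-arm event with the sum of all edge variables is bounded below by \<open>1 - \<pi>(R)\<close>.
  In this covariance only the edges revealed by exploring the cluster \<open>\<C>\<close> of the origin matter; the
  revealed edge variables form a martingale, so Cauchy--Schwarz gives \<open>(1 - \<pi>)\<^sup>2 \<le> \<pi> K E|\<C>|\<close>
  with a constant \<open>K\<close>. Since two points
  at distance \<open>2m\<close> are connected with probability at most \<open>\<pi>(m)\<^sup>2\<close>, this forces \<open>\<eta> \<le> d/3\<close>.

  In the plane, \<open>p\<^sub>c \<ge> 1/2\<close> (Harris), so self-dual rectangles are crossed with probability at least \<open>1/2\<close>.
  A vertex of the lowest crossing on the middle column has two disjoint open arms (BK inequality) and a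
  closed dual arm (Harris inequality), which at \<open>p\<^sub>c \<ge> 1/2\<close> is no likelier than an open one. Summing over
  the column gives \<open>\<eta> \<le> 1/3\<close>. Harris' theorem is obtained from Zhang's four-arm construction together with
  the Aizenman--Kesten--Newman bound on the number of edges between distinct large clusters.
\<close>

subsection \<open>Finite Bernoulli product measures\<close>

text \<open>The exponent is a lower limit, so if it exceeded the claimed bound, a power bound with
  some larger \<open>\<eta>\<close> would hold at every scale, and one inequality that fails for
  large \<open>R\<close> suffices. For \<open>2 * \<eta> < d\<close> the two-point bound gives an
  expected cluster size of order \<open>R\<close> to the power \<open>d - 2 * \<eta>\<close>, so the
  right side of the Cauchy--Schwarz bound has order \<open>R\<close> to the power
  \<open>d - 3 * \<eta>\<close>, while the left side tends to 1. In the plane two open arms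
  contribute \<open>- 2 * \<eta>\<close>, and the closed arms, of all lengths up to the height of
  the column, contribute \<open>1 - \<eta>\<close>. That the critical parameter is less than 1 is
  deduced from the assumed decay itself. The delicate input is that it is at least 1/2 in the plane:
  the customary proof uses uniqueness of the infinite cluster. Here a quantitative estimate in
  finite boxes replaces it, so each event is decided by finitely many edges. A configuration is the
  set of its open edges, expectations are finite sums, and many proofs go by induction on the edge
  set.\<close>

definition bexp :: "real \<Rightarrow> 'e set \<Rightarrow> ('e set \<Rightarrow> real) \<Rightarrow> real" where
  "bexp p E f = (\<Sum>A\<in>Pow E. p ^ card A * (1 - p) ^ card (E - A) * f A)"

abbreviation bprob :: "real \<Rightarrow> 'e set \<Rightarrow> ('e set \<Rightarrow> bool) \<Rightarrow> real" where
  "bprob p E P \<equiv> bexp p E (\<lambda>A. of_bool (P A))"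

lemma bexp_cong: "(\<And>A. A \<subseteq> E \<Longrightarrow> f A = g A) \<Longrightarrow> bexp p E f = bexp p E g"
  unfolding bexp_def by (intro sum.cong) auto

lemma bexp_empty [simp]: "bexp p {} f = f {}"
  by (simp add: bexp_def)

text \<open>Conditioning on the state of one edge; this is the step of the inductions on the edge
  set below.\<close>

lemma bexp_insert:
  assumes "finite E" "e \<notin> E"
  shows "bexp p (insert e E) f = p * bexp p E (\<lambda>A. f (insert e A)) + (1 - p) * bexp p E f"
proof -
  let ?w = "\<lambda>A. p ^ card A * (1 - p) ^ card (insert e E - A) * f A"
  have inj: "inj_on (insert e) (Pow E)"
    using assms(2) by (auto simp: inj_on_def)
  have "bexp p (insert e E) f = sum ?w (Pow E) + sum ?w (insert e ` Pow E)"
    unfolding bexp_def Pow_insert using assms by (intro sum.union_disjoint) auto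
  also have "sum ?w (Pow E) = (1 - p) * bexp p E f"
    unfolding bexp_def sum_distrib_left
  proof (intro sum.cong refl)
    fix A assume "A \<in> Pow E"
    then have "insert e E - A = insert e (E - A)" "e \<notin> E - A" "finite (E - A)"
      using assms by auto
    then show "?w A = (1 - p) * (p ^ card A * (1 - p) ^ card (E - A) * f A)" by simp
  qed
  also have "sum ?w (insert e ` Pow E) = p * bexp p E (\<lambda>A. f (insert e A))"
    unfolding bexp_def sum_distrib_left sum.reindex[OF inj]
  proof (intro sum.cong refl)
    fix A assume "A \<in> Pow E"
    then have "insert e E - insert e A = E - A" "e \<notin> A" "finite A"
      using assms by (auto dest: finite_subset)
    then show "(?w \<circ> insert e) A = p * (p ^ card A * (1 - p) ^ card (E - A) * f (insert e A))"
      by simp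
  qed
  finally show ?thesis by simp
qed

lemma bexp_add: "bexp p E (\<lambda>A. f A + g A) = bexp p E f + bexp p E g"
  by (simp add: bexp_def algebra_simps sum.distrib)

lemma bexp_diff: "bexp p E (\<lambda>A. f A - g A) = bexp p E f - bexp p E g"
  by (simp add: bexp_def algebra_simps sum_subtractf)

lemma bexp_cmult: "bexp p E (\<lambda>A. c * f A) = c * bexp p E f"
  by (simp add: bexp_def sum_distrib_left mult.left_commute)

lemma bexp_cmult_right: "bexp p E (\<lambda>A. f A * c) = bexp p E f * c"
  by (simp add: bexp_def sum_distrib_right mult.assoc)

lemma bexp_sum: "bexp p E (\<lambda>A. \<Sum>i\<in>I. f i A) = (\<Sum>i\<in>I. bexp p E (f i))"
  unfolding bexp_def sum_distrib_left by (rule sum.swap)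

lemma bexp_const [simp]: "finite E \<Longrightarrow> bexp p E (\<lambda>_. c) = c"
  by (induction E rule: finite_induct) (simp_all add: bexp_insert algebra_simps)

lemma bexp_mono:
  assumes "0 \<le> p" "p \<le> 1" "\<And>A. A \<subseteq> E \<Longrightarrow> f A \<le> g A"
  shows "bexp p E f \<le> bexp p E g"
  unfolding bexp_def using assms by (intro sum_mono mult_left_mono) auto

lemma bexp_nonneg:
  assumes "0 \<le> p" "p \<le> 1" "\<And>A. A \<subseteq> E \<Longrightarrow> 0 \<le> f A"
  shows "0 \<le> bexp p E f"
  unfolding bexp_def using assms by (intro sum_nonneg mult_nonneg_nonneg) auto

lemma bprob_le_1:
  assumes "0 \<le> p" "p \<le> 1" "finite E"
  shows "bprob p E P \<le> 1"
  using bexp_mono[of p E "\<lambda>A. of_bool (P A)" "\<lambda>_. 1"] assms by simp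

lemma bprob_nonneg: "0 \<le> p \<Longrightarrow> p \<le> 1 \<Longrightarrow> 0 \<le> bprob p E P"
  by (rule bexp_nonneg) auto

lemma bprob_mono:
  assumes "0 \<le> p" "p \<le> 1" "\<And>A. A \<subseteq> E \<Longrightarrow> P A \<Longrightarrow> Q A"
  shows "bprob p E P \<le> bprob p E Q"
  using assms by (intro bexp_mono) auto

lemma bprob_not: "finite E \<Longrightarrow> bprob p E (\<lambda>A. \<not> P A) = 1 - bprob p E P"
  using bexp_diff[of p E "\<lambda>_. 1" "\<lambda>A. of_bool (P A)"]
  by (simp add: of_bool_not_iff)

lemma bprob_Ex_le:
  assumes "0 \<le> p" "p \<le> 1" "finite I" "\<And>A. A \<subseteq> E \<Longrightarrow> P A \<Longrightarrow> \<exists>i\<in>I. Q i A"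
  shows "bprob p E P \<le> (\<Sum>i\<in>I. bprob p E (Q i))"
  unfolding bexp_sum[symmetric]
proof (rule bexp_mono[OF assms(1,2)])
  fix A assume A: "A \<subseteq> E"
  show "of_bool (P A) \<le> (\<Sum>i\<in>I. of_bool (Q i A) :: real)"
  proof (cases "P A")
    case True
    then obtain i where i: "i \<in> I" "Q i A" using assms(4) A by blast
    have "(of_bool (Q i A) :: real) \<le> (\<Sum>i\<in>I. of_bool (Q i A))"
      by (rule member_le_sum) (use i assms(3) in auto)
    then show ?thesis using i by auto
  qed (simp add: sum_nonneg)
qed

lemma bexp_Un:
  assumes "finite E" "finite F" "E \<inter> F = {}"
  shows "bexp p (E \<union> F) f = bexp p E (\<lambda>A. bexp p F (\<lambda>B. f (A \<union> B)))"
  using assms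
proof (induction E arbitrary: f rule: finite_induct)
  case (insert e E)
  then show ?case by (simp add: bexp_insert)
qed simp

lemma bexp_indep:
  assumes "finite E" "F \<subseteq> E" "H \<subseteq> E" "F \<inter> H = {}"
  shows "bexp p E (\<lambda>A. f (A \<inter> F) * g (A \<inter> H)) = bexp p F f * bexp p H g"
proof -
  have fin: "finite F" "finite H" "finite (E - F - H)"
    using assms finite_subset by auto
  have E: "E = F \<union> (H \<union> (E - F - H))" using assms by auto
  have "bexp p E (\<lambda>A. f (A \<inter> F) * g (A \<inter> H)) =
      bexp p (F \<union> (H \<union> (E - F - H))) (\<lambda>A. f (A \<inter> F) * g (A \<inter> H))"
    using E by simp
  also have "\<dots> = bexp p F (\<lambda>A. bexp p H (\<lambda>B. bexp p (E - F - H) (\<lambda>C.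
      f ((A \<union> (B \<union> C)) \<inter> F) * g ((A \<union> (B \<union> C)) \<inter> H))))"
    using fin assms(4) by (subst bexp_Un; (subst bexp_Un)?) (auto intro!: bexp_cong)
  also have "\<dots> = bexp p F (\<lambda>A. bexp p H (\<lambda>B. bexp p (E - F - H) (\<lambda>C. f A * g B)))"
  proof (intro bexp_cong)
    fix A B C assume *: "A \<subseteq> F" "B \<subseteq> H" "C \<subseteq> E - F - H"
    have "(A \<union> (B \<union> C)) \<inter> F = A" "(A \<union> (B \<union> C)) \<inter> H = B" using * assms(4) by auto
    then show "f ((A \<union> (B \<union> C)) \<inter> F) * g ((A \<union> (B \<union> C)) \<inter> H) = f A * g B" by simp
  qed
  also have "\<dots> = bexp p F f * bexp p H g"
    using fin by (simp add: bexp_cmult bexp_cmult_right)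
  finally show ?thesis .
qed

lemma bexp_marginal:
  assumes "finite E" "F \<subseteq> E"
  shows "bexp p E (\<lambda>A. f (A \<inter> F)) = bexp p F f"
  using bexp_indep[of E F "{}" p f "\<lambda>_. 1"] assms by simp

lemma bprob_indep:
  assumes "finite E" "F \<subseteq> E" "H \<subseteq> E" "F \<inter> H = {}"
  shows "bprob p E (\<lambda>A. P (A \<inter> F) \<and> Q (A \<inter> H)) = bprob p F P * bprob p H Q"
  using bexp_indep[OF assms, of p "\<lambda>A. of_bool (P A)" "\<lambda>A. of_bool (Q A)"]
  by (simp add: of_bool_conj)

lemma bexp_image:
  assumes "inj_on h E"
  shows "bexp p (h ` E) f = bexp p E (\<lambda>A. f (h ` A))"
proof -
  have "bexp p (h ` E) f = (\<Sum>A\<in>(`) h ` Pow E. p ^ card A * (1 - p) ^ card (h ` E - A) * f A)"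
    unfolding bexp_def by (simp add: image_Pow_surj)
  also have "\<dots> = (\<Sum>A\<in>Pow E. p ^ card (h ` A) * (1 - p) ^ card (h ` E - h ` A) * f (h ` A))"
    by (subst sum.reindex) (use assms in \<open>auto simp: inj_on_image_Pow\<close>)
  also have "\<dots> = bexp p E (\<lambda>A. f (h ` A))"
    unfolding bexp_def
  proof (intro sum.cong refl)
    fix A assume A: "A \<in> Pow E"
    then have "card (h ` A) = card A" "h ` E - h ` A = h ` (E - A)" "card (h ` (E - A)) = card (E - A)"
      using assms by (auto intro!: card_image simp: inj_on_image_set_diff[symmetric] intro: inj_on_subset)
    then show "p ^ card (h ` A) * (1 - p) ^ card (h ` E - h ` A) * f (h ` A) =
        p ^ card A * (1 - p) ^ card (E - A) * f (h ` A)" by simp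
  qed
  finally show ?thesis .
qed

text \<open>The closed edges at parameter \<open>p\<close> are distributed like the open edges at
  \<open>1 - p\<close>. This is how planar duality enters the probabilities.\<close>

lemma bexp_compl:
  "bexp p E (\<lambda>A. f (E - A)) = bexp (1 - p) E f"
  unfolding bexp_def
  by (rule sum.reindex_bij_witness[of _ "\<lambda>A. E - A" "\<lambda>A. E - A"])
     (auto simp: double_diff mult_ac)

text \<open>Given the other edges, opening one more can only increase \<open>f\<close>, so the
  mixture of the two conditional means has nonnegative slope in its weight; the means themselves
  grow by induction.\<close>

lemma bexp_mono_param:
  assumes "finite E" "0 \<le> p" "p \<le> q" "q \<le> 1"
    and "\<And>A B. A \<subseteq> B \<Longrightarrow> B \<subseteq> E \<Longrightarrow> f A \<le> f B"
  shows "bexp p E f \<le> bexp q E f"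
  using assms(1,5)
proof (induction E arbitrary: f rule: finite_induct)
  case (insert e E)
  let ?X = "\<lambda>p. bexp p E (\<lambda>A. f (insert e A))" and ?Y = "\<lambda>p. bexp p E f"
  have 1: "?X p \<le> ?X q" by (rule insert.IH) (auto intro!: insert.prems)
  have 2: "?Y p \<le> ?Y q" by (rule insert.IH) (auto intro!: insert.prems)
  have 3: "?Y p \<le> ?X p" using assms by (intro bexp_mono) (auto intro!: insert.prems)
  have "p * ?X p + (1 - p) * ?Y p = ?Y p + p * (?X p - ?Y p)" by algebra
  also have "\<dots> \<le> ?Y p + q * (?X p - ?Y p)" using 3 assms by (simp add: mult_right_mono)
  also have "\<dots> = q * ?X p + (1 - q) * ?Y p" by algebra
  also have "\<dots> \<le> q * ?X q + (1 - q) * ?Y q"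
    using 1 2 assms by (intro add_mono mult_left_mono) auto
  finally show ?case using insert.hyps by (simp add: bexp_insert)
qed simp

lemma continuous_on_bexp: "continuous_on S (\<lambda>p. bexp p E f)"
  unfolding bexp_def by (intro continuous_intros)

lemma bexp_Cauchy_Schwarz:
  assumes "0 \<le> p" "p \<le> 1"
  shows "(bexp p E (\<lambda>A. f A * g A))\<^sup>2 \<le> bexp p E (\<lambda>A. (f A)\<^sup>2) * bexp p E (\<lambda>A. (g A)\<^sup>2)"
proof -
  let ?w = "\<lambda>A. p ^ card A * (1 - p) ^ card (E - A)"
  let ?r = "\<lambda>A. sqrt (?w A)"
  have w: "?r A * ?r A = ?w A" for A
    using assms by (simp add: real_sqrt_mult_self)
  have 1: "bexp p E (\<lambda>A. f A * g A) = (\<Sum>A\<in>Pow E. (?r A * f A) * (?r A * g A))"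
    unfolding bexp_def by (intro sum.cong refl) (use w in \<open>metis mult.assoc mult.left_commute\<close>)
  have 2: "bexp p E (\<lambda>A. (h A)\<^sup>2) = (\<Sum>A\<in>Pow E. (?r A * h A)\<^sup>2)" for h
    unfolding bexp_def power2_eq_square
    by (intro sum.cong refl) (use w in \<open>metis mult.assoc mult.left_commute\<close>)
  show ?thesis unfolding 1 2 by (rule Cauchy_Schwarz_ineq_sum)
qed

section \<open>Positive association of monotone functions\<close>

lemma Harris_inequality:
  assumes "finite E" "0 \<le> p" "p \<le> 1"
    and "\<And>A B. A \<subseteq> B \<Longrightarrow> B \<subseteq> E \<Longrightarrow> f A \<le> f B"
    and "\<And>A B. A \<subseteq> B \<Longrightarrow> B \<subseteq> E \<Longrightarrow> g A \<le> g B"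
  shows "bexp p E f * bexp p E g \<le> bexp p E (\<lambda>A. f A * g A)"
  using assms(1,4,5)
proof (induction E arbitrary: f g rule: finite_induct)
  case (insert e E)
  let ?f1 = "bexp p E (\<lambda>A. f (insert e A))" and ?f0 = "bexp p E f"
  let ?g1 = "bexp p E (\<lambda>A. g (insert e A))" and ?g0 = "bexp p E g"
  have 1: "?f1 * ?g1 \<le> bexp p E (\<lambda>A. f (insert e A) * g (insert e A))"
    by (rule insert.IH) (auto intro!: insert.prems)
  have 0: "?f0 * ?g0 \<le> bexp p E (\<lambda>A. f A * g A)"
    by (rule insert.IH) (auto intro!: insert.prems)
  have f: "?f0 \<le> ?f1" using assms(2,3) by (intro bexp_mono) (auto intro!: insert.prems)
  have g: "?g0 \<le> ?g1" using assms(2,3) by (intro bexp_mono) (auto intro!: insert.prems)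
  \<comment> \<open>For a single Bernoulli edge the covariance of the two conditional means is
    exactly this product, and both increments are nonnegative.\<close>
  have "0 \<le> p * (1 - p) * ((?f1 - ?f0) * (?g1 - ?g0))"
    using f g assms(2,3) by (intro mult_nonneg_nonneg) auto
  then have "(p * ?f1 + (1 - p) * ?f0) * (p * ?g1 + (1 - p) * ?g0)
      \<le> p * (?f1 * ?g1) + (1 - p) * (?f0 * ?g0)"
    by (simp add: algebra_simps)
  also have "\<dots> \<le> p * bexp p E (\<lambda>A. f (insert e A) * g (insert e A)) + (1 - p) * bexp p E (\<lambda>A. f A * g A)"
    using 1 0 assms(2,3) by (intro add_mono mult_left_mono) auto
  finally show ?case using insert.hyps by (simp add: bexp_insert)
qed simp

lemma Harris_decreasing:
  assumes "finite E" "0 \<le> p" "p \<le> 1"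
    and "\<And>A B. A \<subseteq> B \<Longrightarrow> B \<subseteq> E \<Longrightarrow> P B \<Longrightarrow> P A"
    and "\<And>A B. A \<subseteq> B \<Longrightarrow> B \<subseteq> E \<Longrightarrow> Q B \<Longrightarrow> Q A"
  shows "bprob p E P * bprob p E Q \<le> bprob p E (\<lambda>A. P A \<and> Q A)"
proof -
  \<comment> \<open>Negated indicators of decreasing events are increasing, and the two signs cancel
    in the products.\<close>
  have "bexp p E (\<lambda>A. - of_bool (P A)) * bexp p E (\<lambda>A. - of_bool (Q A))
      \<le> bexp p E (\<lambda>A. (- of_bool (P A)) * (- of_bool (Q A)))"
    by (rule Harris_inequality) (use assms in \<open>auto simp: of_bool_def\<close>)
  moreover have "bexp p E (\<lambda>A. - f A) = - bexp p E f" for f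
    using bexp_cmult[of p E "-1" f] by simp
  ultimately show ?thesis by (simp add: of_bool_conj)
qed

lemma Harris_opposite:
  assumes "finite E" "0 \<le> p" "p \<le> 1"
    and "\<And>A B. A \<subseteq> B \<Longrightarrow> B \<subseteq> E \<Longrightarrow> P A \<Longrightarrow> P B"
    and "\<And>A B. A \<subseteq> B \<Longrightarrow> B \<subseteq> E \<Longrightarrow> Q B \<Longrightarrow> Q A"
  shows "bprob p E (\<lambda>A. P A \<and> Q A) \<le> bprob p E P * bprob p E Q"
proof -
  have "bexp p E (\<lambda>A. of_bool (P A)) * bexp p E (\<lambda>A. - of_bool (Q A))
      \<le> bexp p E (\<lambda>A. of_bool (P A) * (- of_bool (Q A)))"
    by (rule Harris_inequality) (use assms in \<open>auto simp: of_bool_def\<close>)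
  moreover have "bexp p E (\<lambda>A. - f A) = - bexp p E f" for f
    using bexp_cmult[of p E "-1" f] by simp
  ultimately show ?thesis by (simp add: of_bool_conj)
qed

section \<open>The van den Berg--Kesten inequality\<close>

text \<open>On the edges of \<open>K\<close> the two witnesses look at independent copies \<open>A\<close> and \<open>B\<close>, so they may
  overlap there; duplicating one more edge only increases the probability.\<close>

definition disj_occ :: "'e set set \<Rightarrow> 'e set set \<Rightarrow> 'e set \<Rightarrow> 'e set \<Rightarrow> 'e set \<Rightarrow> bool" where
  "disj_occ F G K A B \<longleftrightarrow> (\<exists>I\<in>F. \<exists>J\<in>G. I \<subseteq> A \<and> J - K \<subseteq> A \<and> J \<inter> K \<subseteq> B \<and> I \<inter> J \<subseteq> K)"

text \<open>Fix the states of all other edges. If the event needs \<open>e\<close>, then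
  \<open>e\<close> lies in only one of the two witnesses, because
  \<open>I \<inter> J \<subseteq> K\<close> and \<open>e \<notin> K\<close>. After duplication that
  witness looks at a single copy of \<open>e\<close>, so the event keeps probability at least
  \<open>p\<close>.\<close>

lemma disj_occ_step:
  fixes F G :: "'e set set"
  assumes "e \<notin> A" "e \<notin> B" "e \<notin> K" "0 \<le> p" "p \<le> 1"
  defines "D \<equiv> \<lambda>K A B. of_bool (disj_occ F G K A B) :: real"
  defines "K' \<equiv> insert e K"
  shows "p * D K (insert e A) B + (1 - p) * D K A B \<le>
    p * (p * D K' (insert e A) (insert e B) + (1 - p) * D K' (insert e A) B) +
    (1 - p) * (p * D K' A (insert e B) + (1 - p) * D K' A B)"
proof -
  have a: "disj_occ F G K' A B" "disj_occ F G K' (insert e A) B"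
      "disj_occ F G K' A (insert e B)" "disj_occ F G K' (insert e A) (insert e B)"
      "disj_occ F G K (insert e A) B"
    if h: "disj_occ F G K A B"
  proof -
    obtain I J where IJ: "I \<in> F" "J \<in> G" "I \<subseteq> A" "J - K \<subseteq> A" "J \<inter> K \<subseteq> B" "I \<inter> J \<subseteq> K"
      using h unfolding disj_occ_def by blast
    then have "e \<notin> I" "e \<notin> J" using assms by auto
    then have "J \<inter> K' \<subseteq> B" "J - K' \<subseteq> A" "I \<inter> J \<subseteq> K'" using IJ unfolding K'_def by auto
    then show "disj_occ F G K' A B" "disj_occ F G K' (insert e A) B"
      "disj_occ F G K' A (insert e B)" "disj_occ F G K' (insert e A) (insert e B)"
      "disj_occ F G K (insert e A) B"
      using IJ unfolding disj_occ_def by (meson subset_insertI2)+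
  qed
  have b: "disj_occ F G K' (insert e A) (insert e B) \<and>
      (disj_occ F G K' (insert e A) B \<or> disj_occ F G K' A (insert e B))"
    if h: "disj_occ F G K (insert e A) B"
  proof -
    obtain I J where IJ: "I \<in> F" "J \<in> G" "I \<subseteq> insert e A" "J - K \<subseteq> insert e A" "J \<inter> K \<subseteq> B" "I \<inter> J \<subseteq> K"
      using h unfolding disj_occ_def by blast
    have "J - K' \<subseteq> A" "J \<inter> K' \<subseteq> insert e B" "I \<inter> J \<subseteq> K'" "J - K' \<subseteq> insert e A"
      using IJ unfolding K'_def by auto
    moreover have "J \<inter> K' \<subseteq> B \<or> I \<subseteq> A"
      using IJ assms(3) unfolding K'_def by blast
    ultimately show ?thesis using IJ unfolding disj_occ_def by metis
  qed
  have p: "0 \<le> p * p" "0 \<le> p * (1 - p)" "0 \<le> (1 - p) * (1 - p)" using assms by auto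
  show ?thesis
  proof (cases "disj_occ F G K A B")
    case True
    then show ?thesis using a unfolding D_def by (simp add: algebra_simps)
  next
    case False
    show ?thesis
    proof (cases "disj_occ F G K (insert e A) B")
      case True
      \<comment> \<open>Both copies open, together with one good mixed state, already weigh
        \<open>p * p + p * (1 - p) = p\<close>.\<close>
      have "p * 1 \<le> p * (p * 1 + (1 - p) * of_bool x) + (1 - p) * (p * of_bool y + (1 - p) * of_bool z)"
        if "x \<or> y" for x y z :: bool
        using that p by (cases x; cases y; cases z) (auto simp: algebra_simps)
      then show ?thesis using b[OF True] True False unfolding D_def by simp
    next
      case False': False
      show ?thesis using False False' assms unfolding D_def by simp
    qed
  qed
qed

text \<open>Edges are duplicated one at a time. For \<open>K = {}\<close> the event is genuine
  disjoint occurrence; for \<open>K = E\<close> the witness from \<open>F\<close> sees only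
  \<open>A\<close>, the one from \<open>G\<close> only the independent copy \<open>B\<close>, and
  disjointness no longer restricts them. Increasing events enter through their families of
  witnesses.\<close>

theorem BK_inequality:
  assumes "finite E" "0 \<le> p" "p \<le> 1"
  shows "bprob p E (\<lambda>A. \<exists>I\<in>F. \<exists>J\<in>G. I \<subseteq> A \<and> J \<subseteq> A \<and> I \<inter> J = {})
    \<le> bprob p E (\<lambda>A. \<exists>I\<in>F. I \<subseteq> A) * bprob p E (\<lambda>A. \<exists>J\<in>G. J \<subseteq> A)"
proof -
  let ?D = "\<lambda>K A B. of_bool (disj_occ F G K A B) :: real"
  have *: "bexp p E (\<lambda>A. ?D {} A {}) \<le> bexp p E (\<lambda>A. bexp p K (\<lambda>B. ?D K A B))"
    if "finite K" "K \<subseteq> E" for K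
    using that
  proof (induction K rule: finite_induct)
    case (insert e K)
    define E' where "E' = E - {e}"
    have E': "E = insert e E'" "e \<notin> E'" "finite E'"
      using insert.prems assms(1) by (auto simp: E'_def)
    have "bexp p E (\<lambda>A. bexp p K (\<lambda>B. ?D K A B)) =
        bexp p E' (\<lambda>A. bexp p K (\<lambda>B. p * ?D K (insert e A) B + (1 - p) * ?D K A B))"
      unfolding E'(1) using E'(2,3) by (simp add: bexp_insert bexp_add bexp_cmult)
    also have "\<dots> \<le> bexp p E' (\<lambda>A. bexp p K (\<lambda>B.
        p * (p * ?D (insert e K) (insert e A) (insert e B) + (1 - p) * ?D (insert e K) (insert e A) B) +
        (1 - p) * (p * ?D (insert e K) A (insert e B) + (1 - p) * ?D (insert e K) A B)))"
      using assms insert.hyps E' by (intro bexp_mono disj_occ_step) auto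
    also have "\<dots> = bexp p E (\<lambda>A. bexp p (insert e K) (\<lambda>B. ?D (insert e K) A B))"
      unfolding E'(1) using E'(2,3) insert.hyps
      by (simp add: bexp_insert bexp_add bexp_cmult) algebra
    finally show ?case using insert by simp
  qed simp
  have "bprob p E (\<lambda>A. \<exists>I\<in>F. \<exists>J\<in>G. I \<subseteq> A \<and> J \<subseteq> A \<and> I \<inter> J = {}) = bexp p E (\<lambda>A. ?D {} A {})"
    by (intro bexp_cong) (auto simp: disj_occ_def)
  also have "\<dots> \<le> bexp p E (\<lambda>A. bexp p E (\<lambda>B. ?D E A B))"
    using * assms by auto
  also have "\<dots> \<le> bexp p E (\<lambda>A. bexp p E (\<lambda>B. of_bool (\<exists>I\<in>F. I \<subseteq> A) * of_bool (\<exists>J\<in>G. J \<subseteq> B)))"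
    using assms
  proof (intro bexp_mono)
    fix A B assume AB: "A \<subseteq> E" "B \<subseteq> E"
    have "J \<subseteq> B" if "J - E \<subseteq> A" "J \<inter> E \<subseteq> B" for J using that AB by blast
    then show "?D E A B \<le> of_bool (\<exists>I\<in>F. I \<subseteq> A) * of_bool (\<exists>J\<in>G. J \<subseteq> B)"
      unfolding disj_occ_def of_bool_conj[symmetric] of_bool_def by (auto; meson)
  qed auto
  also have "\<dots> = bprob p E (\<lambda>A. \<exists>I\<in>F. I \<subseteq> A) * bprob p E (\<lambda>A. \<exists>J\<in>G. J \<subseteq> A)"
    by (simp add: bexp_cmult bexp_cmult_right)
  finally show ?thesis .
qed

subsection \<open>Connectivity and cluster exploration\<close>

definition conn :: "'a set set \<Rightarrow> 'a \<Rightarrow> 'a \<Rightarrow> bool" where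
  "conn A x y \<longleftrightarrow> (x, y) \<in> {(u, v). {u, v} \<in> A}\<^sup>*"

lemma conn_refl [simp]: "conn A x x"
  by (simp add: conn_def)

lemma conn_trans: "conn A x y \<Longrightarrow> conn A y z \<Longrightarrow> conn A x z"
  unfolding conn_def by (rule rtrancl_trans)

lemma conn_edge: "{x, y} \<in> A \<Longrightarrow> conn A x y"
  unfolding conn_def by auto

lemma conn_step: "conn A x y \<Longrightarrow> {y, z} \<in> A \<Longrightarrow> conn A x z"
  by (rule conn_trans[OF _ conn_edge])

lemma conn_step_left: "{x, y} \<in> A \<Longrightarrow> conn A y z \<Longrightarrow> conn A x z"
  by (rule conn_trans[OF conn_edge])

lemma conn_mono: "A \<subseteq> B \<Longrightarrow> conn A x y \<Longrightarrow> conn B x y"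
  unfolding conn_def by (erule rtrancl_mono[THEN subsetD, rotated]) auto

lemma conn_induct [consumes 1, case_names refl step]:
  assumes "conn A x y" "P x"
    and "\<And>y z. conn A x y \<Longrightarrow> {y, z} \<in> A \<Longrightarrow> P y \<Longrightarrow> P z"
  shows "P y"
  using assms(1) unfolding conn_def
proof (induction rule: rtrancl_induct)
  case (step y z)
  then show ?case using assms(3)[of y z] by (auto simp: conn_def)
qed (rule assms(2))

lemma conn_converse_induct [consumes 1, case_names refl step]:
  assumes "conn A x y" "P y"
    and "\<And>x z. {x, z} \<in> A \<Longrightarrow> conn A z y \<Longrightarrow> P z \<Longrightarrow> P x"
  shows "P x"
  using assms(1) unfolding conn_def
proof (induction rule: converse_rtrancl_induct)
  case (step x z)
  then show ?case using assms(3)[of x z] by (auto simp: conn_def)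
qed (rule assms(2))

lemma conn_sym: "conn A x y \<Longrightarrow> conn A y x"
proof (induction rule: conn_induct)
  case (step y z)
  then show ?case using conn_step_left[of z y A x] by (simp add: insert_commute)
qed simp

lemma conn_closed:
  assumes "conn A x y" "x \<in> S" "\<And>u v. {u, v} \<in> A \<Longrightarrow> u \<in> S \<Longrightarrow> v \<in> S"
  shows "y \<in> S"
  using assms(1)
proof (induction rule: conn_induct)
  case (step y z)
  then show ?case using assms(3) by blast
qed (rule assms(2))

lemma conn_image: "conn A x y \<Longrightarrow> conn ((`) h ` A) (h x) (h y)"
proof (induction rule: conn_induct)
  case (step y z)
  then show ?case by (intro conn_step[OF step(3)]) (auto intro: image_eqI[of _ _ "{y, z}"])
qed simp

lemma conn_image_iff:
  assumes "inj h"
  shows "conn ((`) h ` A) (h x) (h y) \<longleftrightarrow> conn A x y"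
proof
  assume "conn ((`) h ` A) (h x) (h y)"
  then have "conn ((`) (inv h) ` (`) h ` A) (inv h (h x)) (inv h (h y))" by (rule conn_image)
  moreover have "(`) (inv h) ` (`) h ` A = A" 
  proof -
    have "(`) (inv h) ((`) h e) = e" for e using assms by (simp add: image_inv_f_f)
    then show ?thesis by (simp add: image_image)
  qed
  ultimately show "conn A x y" using assms by simp
qed (rule conn_image)

lemma conn_in_edge:
  assumes "conn A x y" "x \<noteq> y"
  obtains e where "e \<in> A" "y \<in> e"
  using assms by (induction rule: conn_induct) auto

lemma conn_insert:
  assumes "conn (insert {a, b} A) u w"
  shows "conn A u w \<or> conn A u a \<and> conn A b w \<or> conn A u b \<and> conn A a w"
  using assms
proof (induction rule: conn_induct)
  case (step y z)
  then consider "{y, z} \<in> A" | "y = a" "z = b" | "y = b" "z = a"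
    by (auto simp: doubleton_eq_iff)
  then show ?case
  proof cases
    case 1
    then show ?thesis
      using step(3) conn_step[of A u y z] conn_step[of A a y z] conn_step[of A b y z] by blast
  next
    case 2
    then show ?thesis using step(3) by auto
  next
    case 3
    then show ?thesis using step(3) by auto
  qed
qed simp

definition inside :: "'a set \<Rightarrow> 'a set set \<Rightarrow> 'a set set" where
  "inside S A = {e \<in> A. e \<subseteq> S}"

lemma inside_subset: "inside S A \<subseteq> A"
  by (auto simp: inside_def)

lemma conn_inside_mem: "conn (inside S A) x y \<Longrightarrow> x \<in> S \<Longrightarrow> y \<in> S"
  by (erule conn_closed) (auto simp: inside_def)

text \<open>The first path runs inside the cluster of \<open>u\<close> in \<open>S\<close>; after its last visit to that cluster
  the connection to \<open>w\<close> uses only edges not touching it, so the two pieces are disjoint.\<close>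

lemma conn_split:
  assumes "conn A u w" "u \<in> S" "w \<notin> S"
  obtains x y I J where "x \<in> S" "y \<notin> S" "{x, y} \<in> I" "I \<subseteq> A" "J \<subseteq> A" "I \<inter> J = {}"
    "I \<subseteq> insert {x, y} (inside S A)" "conn (inside S I) u x" "conn J y w"
proof -
  define C where "C = {v. conn (inside S A) u v}"
  \<comment> \<open>The empty set would also belong to \<open>inside C A\<close>, so it is excluded
    here for the sake of \<open>I \<inter> J = {}\<close>.\<close>
  define J where "J = {e \<in> A. e \<noteq> {} \<and> e \<inter> C = {}}"
  have CS: "C \<subseteq> S" using conn_inside_mem[OF _ assms(2)] by (auto simp: C_def)
  have "w \<notin> C" using CS assms(3) by auto
  have "(v \<notin> C \<and> conn J v w) \<or> (\<exists>x\<in>C. \<exists>y. y \<notin> C \<and> {x, y} \<in> A \<and> conn J y w)" if "conn A v w" for v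
    using that
  proof (induction rule: conn_converse_induct)
    case (step v z)
    then consider "z \<notin> C" "conn J z w" | "\<exists>x\<in>C. \<exists>y. y \<notin> C \<and> {x, y} \<in> A \<and> conn J y w" by blast
    then show ?case
    proof cases
      case 1
      show ?thesis
      proof (cases "v \<in> C")
        case False
        then have "{v, z} \<in> J" using 1 step by (auto simp: J_def)
        then show ?thesis using 1 False conn_step_left[of v z J w] by simp
      qed (use 1 step in blast)
    qed blast
  qed (use \<open>w \<notin> C\<close> in simp)
  moreover have "u \<in> C" by (simp add: C_def)
  ultimately obtain x y where xy: "x \<in> C" "y \<notin> C" "{x, y} \<in> A" "conn J y w"
    using assms(1) by blast
  have "y \<notin> S"
  proof
    assume "y \<in> S"
    then have "{x, y} \<in> inside S A" using xy CS by (auto simp: inside_def)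
    then show False using xy(1,2) conn_step[of "inside S A" u x y] by (simp add: C_def)
  qed
  define I where "I = insert {x, y} (inside C A)"
  have "conn (inside C A) u v \<and> v \<in> C" if "conn (inside S A) u v" for v
    using that
  proof (induction rule: conn_induct)
    case (step y z)
    then have "conn (inside S A) u z" using conn_step[of _ u y z] by simp
    then have "z \<in> C" by (simp add: C_def)
    then have "{y, z} \<in> inside C A" using step by (auto simp: inside_def)
    then show ?case using \<open>z \<in> C\<close> step conn_step[of _ u y z] by simp
  qed (use \<open>u \<in> C\<close> in simp)
  then have "conn (inside C A) u x" using xy(1) by (simp add: C_def)
  moreover have "inside C A \<subseteq> inside S I"
    using CS by (auto simp: I_def inside_def)
  ultimately have "conn (inside S I) u x" by (rule conn_mono[rotated])
  moreover have "I \<subseteq> A" "J \<subseteq> A" "I \<subseteq> insert {x, y} (inside S A)"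
    using xy CS by (auto simp: I_def J_def inside_def)
  moreover have "I \<inter> J = {}"
    using xy by (auto simp: I_def J_def inside_def)
  ultimately show ?thesis
    using that[of x y I J] xy CS \<open>y \<notin> S\<close> by (auto simp: I_def)
qed

section \<open>Exploration of a cluster edge by edge\<close>

definition touched :: "'a set set \<Rightarrow> 'a set \<Rightarrow> 'a set set \<Rightarrow> 'a set set" where
  "touched E Z A = {e \<in> E. \<exists>z\<in>Z. \<exists>v\<in>e. conn A z v}"

lemma touched_subset: "touched E Z A \<subseteq> E"
  by (auto simp: touched_def)

lemma touched_mono: "A \<subseteq> B \<Longrightarrow> touched E Z A \<subseteq> touched E Z B"
  using conn_mono[of A B] by (fastforce simp: touched_def)

text \<open>Every edge that could extend the cluster of \<open>Z\<close> is itself touched, so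
  opening untouched edges adds nothing to the cluster. The touched set is therefore a stopping
  set.\<close>

lemma conn_untouched:
  assumes "conn (A \<union> U) z v" "z \<in> Z" "U \<subseteq> E" "U \<inter> touched E Z A = {}"
  shows "conn A z v"
  using assms(1)
proof (induction rule: conn_induct)
  case (step y w)
  have "{y, w} \<notin> U"
    using step(3) assms(2,3,4) by (auto simp: touched_def)
  then have "{y, w} \<in> A" using step(2) by simp
  then show ?case using step(3) conn_step by metis
qed simp

lemma touched_untouched:
  assumes "U \<subseteq> E" "U \<inter> touched E Z A = {}"
  shows "touched E Z (A \<union> U) = touched E Z A"
proof
  show "touched E Z (A \<union> U) \<subseteq> touched E Z A"
    using conn_untouched[OF _ _ assms] by (auto simp: touched_def)
qed (simp add: touched_mono)

text \<open>Revealing the edges touched by the cluster of \<open>Z\<close> one at a time, a function of the revealed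
  set \<open>S\<close> and its open part \<open>W\<close> that decreases in mean at each step also decreases over the whole
  exploration.\<close>

lemma exploration_supermartingale:
  fixes E :: "'a set set" and g :: "'a set set \<Rightarrow> 'a set set \<Rightarrow> real"
  assumes "finite E" "0 \<le> p" "p \<le> 1"
    and g: "\<And>S W e. W \<subseteq> S \<Longrightarrow> S \<subseteq> E \<Longrightarrow> e \<in> E \<Longrightarrow> e \<notin> S \<Longrightarrow>
      p * g (insert e S) (insert e W) + (1 - p) * g (insert e S) W \<le> g S W"
  shows "bexp p E (\<lambda>A. g (touched E Z A) (A \<inter> touched E Z A)) \<le> g {} {}"
proof -
  let ?T = "touched E Z"
  \<comment> \<open>The claim is generalised to a partial exploration with revealed set
    \<open>S\<close> and open part \<open>W\<close>. The invariant \<open>S \<subseteq> ?T W\<close>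
    says that \<open>S\<close> gets revealed whatever the remaining edges are, by monotonicity of
    \<open>touched\<close>.\<close>
  have "bexp p (E - S) (\<lambda>A. g (?T (A \<union> W)) ((A \<union> W) \<inter> ?T (A \<union> W))) \<le> g S W"
    if "W \<subseteq> S" "S \<subseteq> ?T W" for S W
    using that
  proof (induction "card (E - S)" arbitrary: S W rule: less_induct)
    case less
    have fin: "finite (E - S)" using assms by auto
    have SE: "S \<subseteq> E" using less.prems touched_subset by blast
    show ?case
    proof (cases "?T W = S")
      case True
      have "bexp p (E - S) (\<lambda>A. g (?T (A \<union> W)) ((A \<union> W) \<inter> ?T (A \<union> W))) = bexp p (E - S) (\<lambda>A. g S W)"
      proof (rule bexp_cong)
        fix A assume A: "A \<subseteq> E - S"
        have "?T (A \<union> W) = S"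
          using touched_untouched[of A E Z W] A True by (auto simp: Un_commute)
        moreover have "(A \<union> W) \<inter> S = W" using A less.prems by auto
        ultimately show "g (?T (A \<union> W)) ((A \<union> W) \<inter> ?T (A \<union> W)) = g S W" by simp
      qed
      then show ?thesis using fin by simp
    next
      case False
      then obtain e where e: "e \<in> ?T W" "e \<notin> S" using less.prems by blast
      then have eE: "e \<in> E" using touched_subset by blast
      have eq: "E - S = insert e (E - insert e S)" using e eE by auto
      have lt: "card (E - insert e S) < card (E - S)"
        using e eE assms(1) by (intro psubset_card_mono) auto
      have fin': "finite (E - insert e S)" using assms(1) by auto
      let ?F = "\<lambda>W A. g (?T (A \<union> W)) ((A \<union> W) \<inter> ?T (A \<union> W))"
      have "bexp p (E - S) (?F W) =
          p * bexp p (E - insert e S) (?F (insert e W)) + (1 - p) * bexp p (E - insert e S) (?F W)"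
        unfolding eq using bexp_insert[OF fin', of e p "?F W"] by simp
      also have "\<dots> \<le> p * g (insert e S) (insert e W) + (1 - p) * g (insert e S) W"
      proof -
        have "insert e S \<subseteq> ?T W" using e less.prems by auto
        moreover have "?T W \<subseteq> ?T (insert e W)" by (rule touched_mono) auto
        ultimately have "bexp p (E - insert e S) (?F (insert e W)) \<le> g (insert e S) (insert e W)"
          "bexp p (E - insert e S) (?F W) \<le> g (insert e S) W"
          using less.prems by (intro less.hyps lt; blast)+
        then show ?thesis using assms(2,3) by (intro add_mono mult_left_mono) auto
      qed
      also have "\<dots> \<le> g S W" using g[of W S e] less.prems SE eE e by auto
      finally show ?thesis .
    qed
  qed
  from this[of "{}" "{}"] show ?thesis by simp
qed

text \<open>The sum over \<open>S\<close> of the centred edge variables when \<open>W\<close> is the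
  open part of \<open>S\<close>, see \<open>bal_eq_sum\<close>. Along an exploration it is a
  martingale.\<close>

definition bal :: "real \<Rightarrow> 'e set \<Rightarrow> 'e set \<Rightarrow> real" where
  "bal p S W = real (card W) - p * real (card S)"

lemma bal_insert:
  assumes "finite S" "W \<subseteq> S" "e \<notin> S"
  shows "bal p (insert e S) (insert e W) = bal p S W + (1 - p)"
    and "bal p (insert e S) W = bal p S W - p"
proof -
  have "finite W" "e \<notin> W" using assms finite_subset by auto
  then show "bal p (insert e S) (insert e W) = bal p S W + (1 - p)"
    "bal p (insert e S) W = bal p S W - p"
    using assms by (auto simp: bal_def algebra_simps)
qed

context
  fixes E :: "'a set set" and p :: real
  assumes fin: "finite E" and p: "0 \<le> p" "p \<le> 1"
begin

lemma exploration_mean: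
  "bexp p E (\<lambda>A. bal p (touched E Z A) (A \<inter> touched E Z A)) = 0"
proof -
  \<comment> \<open>The free factor \<open>c\<close> gives the supermartingale bound for both signs,
    hence equality.\<close>
  have "bexp p E (\<lambda>A. c * bal p (touched E Z A) (A \<inter> touched E Z A)) \<le> c * bal p ({} :: 'a set set) {}" for c
  proof (rule exploration_supermartingale[OF fin p, where g = "\<lambda>S W. c * bal p S W" and Z = Z])
    fix S W e assume *: "W \<subseteq> S" "S \<subseteq> E" "e \<in> E" "e \<notin> S"
    have "finite S" using * fin finite_subset by auto
    then show "p * (c * bal p (insert e S) (insert e W)) + (1 - p) * (c * bal p (insert e S) W) \<le> c * bal p S W"
      using * by (simp add: bal_insert algebra_simps)
  qed
  from this[of 1] this[of "-1"] show ?thesis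
    by (simp only: bexp_cmult) (simp add: bal_def)
qed

text \<open>Each revealed edge adds the variance \<open>p * (1 - p) \<le> 1\<close> to the mean
  square, so the square minus the number of revealed edges is a supermartingale.\<close>

lemma exploration_variance:
  "bexp p E (\<lambda>A. (bal p (touched E Z A) (A \<inter> touched E Z A))\<^sup>2)
    \<le> bexp p E (\<lambda>A. real (card (touched E Z A)))"
proof -
  let ?g = "\<lambda>(S :: 'a set set) W. (bal p S W)\<^sup>2 - real (card S)"
  have "bexp p E (\<lambda>A. ?g (touched E Z A) (A \<inter> touched E Z A)) \<le> ?g {} {}"
  proof (rule exploration_supermartingale[OF fin p, where g = ?g and Z = Z])
    fix S W e assume *: "W \<subseteq> S" "S \<subseteq> E" "e \<in> E" "e \<notin> S"
    have "finite S" using * fin finite_subset by auto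
    define m where "m = bal p S W"
    define s where "s = real (card S)"
    have "p * (1 - p) \<le> 1" using p by (simp add: mult_le_one)
    then have "p * ((m + (1 - p))\<^sup>2 - (1 + s)) + (1 - p) * ((m - p)\<^sup>2 - (1 + s)) \<le> m\<^sup>2 - s"
      by (simp add: power2_eq_square algebra_simps)
    moreover have "bal p (insert e S) (insert e W) = m + (1 - p)" "bal p (insert e S) W = m - p"
      using bal_insert[of S W e p] * \<open>finite S\<close> by (auto simp: m_def)
    moreover have "real (card (insert e S)) = 1 + s"
      using * \<open>finite S\<close> by (simp add: s_def)
    ultimately show "p * ?g (insert e S) (insert e W) + (1 - p) * ?g (insert e S) W \<le> ?g S W"
      by (simp only: m_def[symmetric] s_def[symmetric])
  qed
  then show ?thesis by (simp add: bexp_diff bal_def)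
qed

text \<open>The number of revealed edges is random, so it has to be divided out inside the
  expectation. Passing from \<open>s\<close> to \<open>s + 1\<close> revealed edges then costs at
  most \<open>1 / (1 + s)\<close>, and these costs add up to a harmonic number.\<close>

lemma exploration_normalized_variance:
  "bexp p E (\<lambda>A. (bal p (touched E Z A) (A \<inter> touched E Z A))\<^sup>2 / real (card (touched E Z A)))
    \<le> harm (card E)"
proof -
  let ?g = "\<lambda>(S :: 'a set set) W. (bal p S W)\<^sup>2 / real (card S) - harm (card S)"
  have "bexp p E (\<lambda>A. ?g (touched E Z A) (A \<inter> touched E Z A)) \<le> ?g {} {}"
  proof (rule exploration_supermartingale[OF fin p, where g = ?g and Z = Z])
    fix S W e assume *: "W \<subseteq> S" "S \<subseteq> E" "e \<in> E" "e \<notin> S"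
    have fS: "finite S" using * fin finite_subset by auto
    define m where "m = bal p S W"
    define s where "s = real (card S)"
    \<comment> \<open>At the start the quotient \<open>m\<^sup>2 / s\<close> is 0 by the convention
      for division, which agrees with \<open>m = 0\<close>.\<close>
    have s: "s = 0 \<Longrightarrow> m = 0" "s \<ge> 0"
      using fS * by (auto simp: m_def s_def bal_def)
    have pp: "p * (1 - p) \<le> 1" using p by (simp add: mult_le_one)
    have "p * ((m + (1 - p))\<^sup>2 / (1 + s)) + (1 - p) * ((m - p)\<^sup>2 / (1 + s)) = (m\<^sup>2 + p * (1 - p)) / (1 + s)"
    proof -
      have "p * ((m + (1 - p))\<^sup>2 / (1 + s)) + (1 - p) * ((m - p)\<^sup>2 / (1 + s)) =
          (p * (m + (1 - p))\<^sup>2 + (1 - p) * (m - p)\<^sup>2) / (1 + s)"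
        by (simp add: add_divide_distrib)
      also have "p * (m + (1 - p))\<^sup>2 + (1 - p) * (m - p)\<^sup>2 = m\<^sup>2 + p * (1 - p)"
        by algebra
      finally show ?thesis .
    qed
    also have "\<dots> \<le> m\<^sup>2 / s + 1 / (1 + s)"
    proof (cases "s = 0")
      case False
      then have "m\<^sup>2 / (1 + s) \<le> m\<^sup>2 / s" using s by (intro divide_left_mono) auto
      moreover have "p * (1 - p) / (1 + s) \<le> 1 / (1 + s)" using pp s by (intro divide_right_mono) auto
      ultimately show ?thesis by (simp add: add_divide_distrib)
    qed (use s pp in simp)
    finally have "p * ((m + (1 - p))\<^sup>2 / (1 + s)) + (1 - p) * ((m - p)\<^sup>2 / (1 + s)) \<le> m\<^sup>2 / s + 1 / (1 + s)" .
    moreover have "bal p (insert e S) (insert e W) = m + (1 - p)" "bal p (insert e S) W = m - p"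
      using bal_insert[of S W e p] * fS by (auto simp: m_def)
    moreover have "real (card (insert e S)) = 1 + s" "harm (card (insert e S)) = harm (card S) + 1 / (1 + s)"
      using * fS by (simp_all add: s_def harm_Suc inverse_eq_divide)
    moreover have "p * (a - (h + r)) + (1 - p) * (b - (h + r)) = p * a + (1 - p) * b - h - r" for a b h r :: real
      by algebra
    ultimately show "p * ?g (insert e S) (insert e W) + (1 - p) * ?g (insert e S) W \<le> ?g S W"
      by (simp only: m_def[symmetric] s_def[symmetric])
  qed
  then have "bexp p E (\<lambda>A. (bal p (touched E Z A) (A \<inter> touched E Z A))\<^sup>2 / real (card (touched E Z A)))
      \<le> bexp p E (\<lambda>A. harm (card (touched E Z A)))"
    by (simp add: bexp_diff bal_def harm_def)
  also have "\<dots> \<le> bexp p E (\<lambda>A. harm (card E))"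
    using p fin touched_subset by (intro bexp_mono harm_mono card_mono) auto
  finally show ?thesis using fin by simp
qed

end

subsection \<open>Edges between large clusters\<close>

lemma bal_eq_sum:
  assumes "finite S"
  shows "bal p S (A \<inter> S) = (\<Sum>e\<in>S. of_bool (e \<in> A) - p)"
  using assms by (simp add: bal_def sum_subtractf Int_commute)

definition separates :: "'a set set \<Rightarrow> 'a set \<Rightarrow> 'a set \<Rightarrow> bool" where
  "separates A Z e \<longleftrightarrow> (\<exists>a b. e = {a, b} \<and> \<not> conn A a b \<and> (\<exists>z\<in>Z. conn A z a) \<and> (\<exists>z\<in>Z. conn A z b))"

lemma separates_not_mem: "separates A Z e \<Longrightarrow> e \<notin> A"
  using conn_edge by (fastforce simp: separates_def)

definition cluster :: "'a set set \<Rightarrow> 'a \<Rightarrow> 'a set" where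
  "cluster A x = {v. conn A x v}"

lemma cluster_eq:
  assumes "conn A z a"
  shows "cluster A z = cluster A a"
  using conn_trans[OF assms] conn_trans[OF conn_sym[OF assms]] by (auto simp: cluster_def)

text \<open>Each of the two endpoints lies in at most one of the clusters, so an edge meets at most
  two of them, and two exactly when it separates.\<close>

lemma card_clusters_meeting_edge:
  assumes "e = {a, b}" "e \<in> E" "A \<subseteq> E"
  shows "card {C \<in> cluster A ` Z. e \<inter> C \<noteq> {}} =
    of_bool (e \<in> touched E Z A) + of_bool (separates A Z e)"
proof -
  let ?r = "\<lambda>v. \<exists>z\<in>Z. conn A z v"
  have *: "{C \<in> cluster A ` Z. v \<in> C} = (if ?r v then {cluster A v} else {})" for v
  proof (cases "?r v")
    case True
    then obtain z where "z \<in> Z" "conn A z v" by blast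
    then have "cluster A v \<in> cluster A ` Z" using imageI[of z Z "cluster A"] cluster_eq[of A z v] by simp
    moreover have "C = cluster A v" if h: "C \<in> cluster A ` Z" "v \<in> C" for C
    proof -
      obtain z where z: "C = cluster A z" using h(1) by blast
      moreover have "conn A z v" using h(2) z by (simp add: cluster_def)
      ultimately show ?thesis using cluster_eq[of A z v] by simp
    qed
    moreover have "v \<in> cluster A v" by (simp add: cluster_def)
    ultimately have "{C \<in> cluster A ` Z. v \<in> C} = {cluster A v}" by blast
    then show ?thesis using True by simp
  next
    case False
    then show ?thesis by (auto simp: cluster_def)
  qed
  have "{C \<in> cluster A ` Z. e \<inter> C \<noteq> {}} =
      {C \<in> cluster A ` Z. a \<in> C} \<union> {C \<in> cluster A ` Z. b \<in> C}"
    using assms(1) by auto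
  also have "\<dots> = (if ?r a then {cluster A a} else {}) \<union> (if ?r b then {cluster A b} else {})"
    unfolding * by (rule refl)
  finally have eq: "{C \<in> cluster A ` Z. e \<inter> C \<noteq> {}} =
    (if ?r a then {cluster A a} else {}) \<union> (if ?r b then {cluster A b} else {})" .
  have t: "e \<in> touched E Z A \<longleftrightarrow> ?r a \<or> ?r b"
    using assms by (auto simp: touched_def)
  have "b \<in> cluster A b" "b \<in> cluster A a \<longleftrightarrow> conn A a b" by (simp_all add: cluster_def)
  then have "cluster A a = cluster A b \<longleftrightarrow> conn A a b"
    using cluster_eq[of A a b] by (cases "conn A a b") auto
  moreover have "separates A Z e \<longleftrightarrow> \<not> conn A a b \<and> ?r a \<and> ?r b"
  proof
    assume "separates A Z e"
    then obtain c d where cd: "e = {c, d}" "\<not> conn A c d" "?r c" "?r d"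
      by (auto simp: separates_def)
    then consider "c = a" "d = b" | "c = b" "d = a" using assms(1) by (auto simp: doubleton_eq_iff)
    then show "\<not> conn A a b \<and> ?r a \<and> ?r b"
      using cd conn_sym[of A a b] by cases blast+
  next
    assume "\<not> conn A a b \<and> ?r a \<and> ?r b"
    then show "separates A Z e" unfolding separates_def using assms(1) by blast
  qed
  ultimately show ?thesis
    unfolding eq t by (cases "?r a"; cases "?r b"; cases "conn A a b") simp_all
qed

text \<open>Summing the balances of all clusters counts separating edges twice and the other touched
  edges once, while the balance of their union has mean zero.\<close>

theorem separating_edges_bound:
  fixes E :: "'a set set"
  assumes fin: "finite E" "finite Z" and p: "0 \<le> p" "p \<le> 1" and l: "l > 0"
    and edge: "\<And>e. e \<in> E \<Longrightarrow> \<exists>a b. e = {a, b}"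
  shows "p * bexp p E (\<lambda>A. \<Sum>e\<in>E. of_bool (separates A Z e))
    \<le> l / 2 * (real (card Z) * harm (card E)) + real (card E) / l"
proof -
  define T where "T = (\<lambda>C. {e \<in> E. e \<inter> C \<noteq> {}})"
  define M where "M = (\<lambda>A C. bal p (T C) (A \<inter> T C))"
  define N where "N = (\<lambda>C. real (card (T C)))"
  define n where "n = (\<lambda>A e. card {C \<in> cluster A ` Z. e \<inter> C \<noteq> {}})"
  have finT: "finite (T C)" for C using fin by (simp add: T_def)
  have Tz: "T (cluster A z) = touched E {z} A" for A z
    by (auto simp: T_def touched_def cluster_def)
  have n: "real (n A e) = of_bool (e \<in> touched E Z A) + of_bool (separates A Z e)"
    if "e \<in> E" "A \<subseteq> E" for A e
    using edge[OF that(1)] card_clusters_meeting_edge[OF _ that] unfolding n_def by force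
  have dbl: "(\<Sum>C\<in>cluster A ` Z. \<Sum>e\<in>T C. h e) = (\<Sum>e\<in>E. h e * real (n A e))" for h :: "'a set \<Rightarrow> real" and A
  proof -
    have "(\<Sum>C\<in>cluster A ` Z. \<Sum>e\<in>T C. h e) = (\<Sum>C\<in>cluster A ` Z. \<Sum>e\<in>E. h e * of_bool (e \<inter> C \<noteq> {}))"
      unfolding T_def using fin by (intro sum.cong refl sum.mono_neutral_cong_left) auto
    also have "\<dots> = (\<Sum>e\<in>E. \<Sum>C\<in>cluster A ` Z. h e * of_bool (e \<inter> C \<noteq> {}))"
      by (rule sum.swap)
    also have "\<dots> = (\<Sum>e\<in>E. h e * real (n A e))"
      unfolding n_def using fin
      by (intro sum.cong refl) (simp add: sum_distrib_left[symmetric] Collect_conj_eq)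
    finally show ?thesis .
  qed
  have main: "p * (\<Sum>e\<in>E. of_bool (separates A Z e))
      \<le> bal p (touched E Z A) (A \<inter> touched E Z A)
        + (l / 2 * (\<Sum>z\<in>Z. (bal p (touched E {z} A) (A \<inter> touched E {z} A))\<^sup>2 / real (card (touched E {z} A)))
        + real (card E) / l)" if A: "A \<subseteq> E" for A
  proof -
    have "(\<Sum>C\<in>cluster A ` Z. M A C) = (\<Sum>e\<in>E. (of_bool (e \<in> A) - p) * real (n A e))"
      using finT by (simp add: M_def bal_eq_sum dbl)
    \<comment> \<open>The second count of a separating edge has weight \<open>- p\<close>, since
      such an edge is closed.\<close>
    also have "\<dots> = (\<Sum>e\<in>E. (of_bool (e \<in> A) - p) * of_bool (e \<in> touched E Z A) - p * of_bool (separates A Z e))"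
      using A separates_not_mem by (intro sum.cong refl) (fastforce simp: n algebra_simps)
    also have "\<dots> = (\<Sum>e\<in>E. (of_bool (e \<in> A) - p) * of_bool (e \<in> touched E Z A))
        - p * (\<Sum>e\<in>E. of_bool (separates A Z e))"
      by (simp add: sum_subtractf sum_distrib_left)
    also have "(\<Sum>e\<in>E. (of_bool (e \<in> A) - p) * of_bool (e \<in> touched E Z A)) =
        (\<Sum>e\<in>touched E Z A. of_bool (e \<in> A) - p)"
      using fin touched_subset[of E Z A] by (intro sum.mono_neutral_cong_right) auto
    also have "\<dots> = bal p (touched E Z A) (A \<inter> touched E Z A)"
      using fin touched_subset[of E Z A] by (simp add: bal_eq_sum finite_subset)
    finally have "p * (\<Sum>e\<in>E. of_bool (separates A Z e)) =
        bal p (touched E Z A) (A \<inter> touched E Z A) + (\<Sum>C\<in>cluster A ` Z. - M A C)"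
      by (simp add: sum_negf)
    \<comment> \<open>Young's inequality applied to \<open>(M / sqrt N) * sqrt N\<close>. The free
      parameter \<open>l\<close> will balance the number of clusters against the number of
      edges.\<close>
    also have "(\<Sum>C\<in>cluster A ` Z. - M A C) \<le> (\<Sum>C\<in>cluster A ` Z. l / 2 * ((M A C)\<^sup>2 / N C) + N C / (2 * l))"
    proof (rule sum_mono)
      fix C
      show "- M A C \<le> l / 2 * ((M A C)\<^sup>2 / N C) + N C / (2 * l)"
      proof (cases "N C = 0")
        case True
        then have "T C = {}" using finT by (simp add: N_def)
        then show ?thesis using True by (simp add: M_def bal_def)
      next
        case False
        then have N: "N C > 0" by (simp add: N_def)
        have "0 \<le> (l * M A C + N C)\<^sup>2 / (2 * l * N C)" using l N by simp
        also have "\<dots> = l / 2 * ((M A C)\<^sup>2 / N C) + N C / (2 * l) + M A C"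
          using l N by (simp add: power2_eq_square field_simps)
        finally show ?thesis by simp
      qed
    qed
    also have "\<dots> = l / 2 * (\<Sum>C\<in>cluster A ` Z. (M A C)\<^sup>2 / N C) + (\<Sum>C\<in>cluster A ` Z. N C) / (2 * l)"
      by (simp add: sum.distrib sum_distrib_left sum_divide_distrib)
    \<comment> \<open>The set of clusters is random. Summing over starting points, possibly
      repeating clusters, gives a fixed index set that commutes with the expectation.\<close>
    also have "(\<Sum>C\<in>cluster A ` Z. (M A C)\<^sup>2 / N C) \<le> (\<Sum>z\<in>Z. (M A (cluster A z))\<^sup>2 / N (cluster A z))"
      using fin sum_image_le[of Z "\<lambda>C. (M A C)\<^sup>2 / N C" "cluster A"] by (simp add: N_def o_def)
    also have "(\<Sum>C\<in>cluster A ` Z. N C) = (\<Sum>e\<in>E. real (n A e))"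
      using dbl[of "\<lambda>_. 1"] by (simp add: N_def)
    also have "\<dots> \<le> (\<Sum>e\<in>E. 2)"
      using A by (intro sum_mono) (simp add: n)
    finally show ?thesis using l by (simp add: M_def N_def Tz field_simps)
  qed
  have "p * bexp p E (\<lambda>A. \<Sum>e\<in>E. of_bool (separates A Z e)) \<le>
      bexp p E (\<lambda>A. bal p (touched E Z A) (A \<inter> touched E Z A)
        + (l / 2 * (\<Sum>z\<in>Z. (bal p (touched E {z} A) (A \<inter> touched E {z} A))\<^sup>2 / real (card (touched E {z} A)))
        + real (card E) / l))"
    unfolding bexp_cmult[symmetric] by (intro bexp_mono p main)
  also have "\<dots> = l / 2 * (\<Sum>z\<in>Z. bexp p E (\<lambda>A. (bal p (touched E {z} A) (A \<inter> touched E {z} A))\<^sup>2 / real (card (touched E {z} A))))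
      + real (card E) / l"
    using exploration_mean[OF fin(1) p, of Z] fin by (simp only: bexp_add bexp_cmult bexp_sum bexp_const)
  also have "\<dots> \<le> l / 2 * (\<Sum>z\<in>Z. harm (card E)) + real (card E) / l"
    using l by (intro add_mono mult_left_mono sum_mono exploration_normalized_variance fin p) auto
  finally show ?thesis by simp
qed

definition exits :: "'a set \<Rightarrow> 'a set set \<Rightarrow> 'a \<Rightarrow> bool" where
  "exits S A x \<longleftrightarrow> (\<exists>v. v \<notin> S \<and> conn A x v)"

lemma exits_mono: "A \<subseteq> B \<Longrightarrow> exits S A x \<Longrightarrow> exits S B x"
  using conn_mono[of A B] by (auto simp: exits_def)

lemma exits_antimono: "S \<subseteq> S' \<Longrightarrow> exits S' A x \<Longrightarrow> exits S A x"
  unfolding exits_def by blast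

lemma exits_trans: "conn A x y \<Longrightarrow> exits S A y \<Longrightarrow> exits S A x"
  using conn_trans[of A x y] by (auto simp: exits_def)

text \<open>Instantiated twice: by the square lattice on pairs of integers, where duality has simple
  coordinates, and by the lattice of integer vectors that the statement is about.\<close>

locale translation_graph =
  fixes G :: "'a :: ab_group_add set set"
  assumes edge: "e \<in> G \<Longrightarrow> \<exists>a b. a \<noteq> b \<and> e = {a, b}"
    and finite_star0: "finite {e \<in> G. 0 \<in> e}"
    and translate: "e \<in> G \<Longrightarrow> (+) t ` e \<in> G"
begin

definition edges_at :: "'a set \<Rightarrow> 'a set set" where
  "edges_at S = {e \<in> G. e \<inter> S \<noteq> {}}"

text \<open>For a box \<open>S\<close> centred at \<open>x\<close> this is a one-arm probability. If
  \<open>S\<close> is finite and does not contain \<open>x\<close>, it equals 1 by the trivial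
  path.\<close>

definition xit :: "real \<Rightarrow> 'a set \<Rightarrow> 'a \<Rightarrow> real" where
  "xit p S x = bprob p (edges_at S) (\<lambda>A. exits S A x)"

definition deg :: nat where
  "deg = card {e \<in> G. 0 \<in> e}"

lemma empty_not_edge [simp]: "{} \<notin> G"
  using edge[of "{}"] by auto

lemma translate_image: "(`) ((+) t) ` G = G"
proof
  show "(`) ((+) t) ` G \<subseteq> G" using translate by auto
  show "G \<subseteq> (`) ((+) t) ` G"
  proof
    fix e assume "e \<in> G"
    then have "(+) (- t) ` e \<in> G" by (rule translate)
    moreover have "e = (+) t ` (+) (- t) ` e" by (simp add: image_image)
    ultimately show "e \<in> (`) ((+) t) ` G" by (rule rev_image_eqI)
  qed
qed

lemma star_eq: "{e \<in> G. x \<in> e} = (`) ((+) x) ` {e \<in> G. 0 \<in> e}"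
proof
  show "(`) ((+) x) ` {e \<in> G. 0 \<in> e} \<subseteq> {e \<in> G. x \<in> e}"
  proof
    fix e assume "e \<in> (`) ((+) x) ` {e \<in> G. 0 \<in> e}"
    then obtain e' where e': "e' \<in> G" "0 \<in> e'" "e = (+) x ` e'" by auto
    then have "x + 0 \<in> e" by blast
    then show "e \<in> {e \<in> G. x \<in> e}" using e' translate by simp
  qed
  show "{e \<in> G. x \<in> e} \<subseteq> (`) ((+) x) ` {e \<in> G. 0 \<in> e}"
  proof
    fix e assume e: "e \<in> {e \<in> G. x \<in> e}"
    then have "- x + x \<in> (+) (- x) ` e" by blast
    then have "(+) (- x) ` e \<in> {e \<in> G. 0 \<in> e}"
      using translate[of e "- x"] e by simp
    moreover have "e = (+) x ` (+) (- x) ` e" by (simp add: image_image)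
    ultimately show "e \<in> (`) ((+) x) ` {e \<in> G. 0 \<in> e}" by (rule rev_image_eqI)
  qed
qed

lemma finite_star: "finite {e \<in> G. x \<in> e}"
  using finite_star0 by (subst star_eq) (rule finite_imageI)

lemma card_star: "card {e \<in> G. x \<in> e} \<le> deg"
  unfolding deg_def by (subst star_eq) (rule card_image_le[OF finite_star0])

lemma finite_edges_at: "finite S \<Longrightarrow> finite (edges_at S)"
proof -
  assume "finite S"
  moreover have "edges_at S = (\<Union>x\<in>S. {e \<in> G. x \<in> e})" by (auto simp: edges_at_def)
  ultimately show ?thesis using finite_star by simp
qed

lemma edges_at_mono: "S \<subseteq> S' \<Longrightarrow> edges_at S \<subseteq> edges_at S'"
  by (auto simp: edges_at_def)

lemma edges_at_subset: "edges_at S \<subseteq> G"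
  by (auto simp: edges_at_def)

lemma inside_subset_edges_at: "inside S G \<subseteq> edges_at S"
proof
  fix e assume e: "e \<in> inside S G"
  then have "e \<noteq> {}" using empty_not_edge by (auto simp: inside_def)
  then show "e \<in> edges_at S" using e by (auto simp: inside_def edges_at_def)
qed

text \<open>A path out of \<open>S\<close> may be stopped at its first vertex outside
  \<open>S\<close>, and until then it uses only edges meeting \<open>S\<close>. Exit events are thus
  local to \<open>edges_at S\<close>.\<close>

lemma exits_first:
  assumes "exits S A x" "A \<subseteq> G"
  shows "exits S (A \<inter> edges_at S) x"
proof (cases "x \<in> S")
  case True
  obtain w where w: "w \<notin> S" "conn A x w" using assms by (auto simp: exits_def)
  obtain a b I J where *: "a \<in> S" "b \<notin> S" "{a, b} \<in> I" "I \<subseteq> A" "J \<subseteq> A" "I \<inter> J = {}"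
    "I \<subseteq> insert {a, b} (inside S A)" "conn (inside S I) x a" "conn J b w"
    by (rule conn_split[OF w(2) True w(1)])
  have "inside S I \<subseteq> A" "inside S I \<subseteq> inside S G"
    using * assms(2) by (auto simp: inside_def)
  then have "inside S I \<subseteq> A \<inter> edges_at S"
    using inside_subset_edges_at by blast
  moreover have "{a, b} \<in> A \<inter> edges_at S" using * assms(2) by (auto simp: edges_at_def)
  ultimately have "conn (A \<inter> edges_at S) x b"
    using conn_step[OF conn_mono[OF _ *(8)]] by metis
  then show ?thesis using * by (auto simp: exits_def)
next
  case False
  then show ?thesis by (metis conn_refl exits_def)
qed

lemma xit_eq_marginal:
  assumes "finite F" "edges_at S \<subseteq> F"
  shows "xit p S x = bprob p F (\<lambda>A. exits S (A \<inter> edges_at S) x)"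
  unfolding xit_def using bexp_marginal[OF assms, of p "\<lambda>A. of_bool (exits S A x)"] by simp

lemma xit_mono:
  assumes "S \<subseteq> S'" "finite S'" "0 \<le> p" "p \<le> 1"
  shows "xit p S' x \<le> xit p S x"
proof -
  have "xit p S x = bprob p (edges_at S') (\<lambda>A. exits S (A \<inter> edges_at S) x)"
    using assms by (intro xit_eq_marginal finite_edges_at edges_at_mono)
  moreover have "xit p S' x \<le> bprob p (edges_at S') (\<lambda>A. exits S (A \<inter> edges_at S) x)"
    unfolding xit_def using assms edges_at_subset
    by (intro bprob_mono exits_first exits_antimono[OF assms(1)]) auto
  ultimately show ?thesis by simp
qed

lemma xit_mono_param:
  assumes "finite S" "0 \<le> p" "p \<le> q" "q \<le> 1"
  shows "xit p S x \<le> xit q S x"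
  unfolding xit_def
proof (rule bexp_mono_param[OF finite_edges_at[OF assms(1)] assms(2-4)])
  fix A B :: "'a set set" assume "A \<subseteq> B"
  then show "(of_bool (exits S A x) :: real) \<le> of_bool (exits S B x)"
    using exits_mono[of A B S x] by simp
qed

lemma xit_nonneg: "0 \<le> p \<Longrightarrow> p \<le> 1 \<Longrightarrow> 0 \<le> xit p S x"
  unfolding xit_def by (rule bprob_nonneg)

lemma xit_le_1: "finite S \<Longrightarrow> 0 \<le> p \<Longrightarrow> p \<le> 1 \<Longrightarrow> xit p S x \<le> 1"
  unfolding xit_def by (intro bprob_le_1 finite_edges_at)

lemma edges_at_translate: "edges_at ((+) t ` S) = (`) ((+) t) ` edges_at S"
proof -
  have "edges_at ((+) t ` S) = {e \<in> (`) ((+) t) ` G. e \<inter> (+) t ` S \<noteq> {}}"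
    by (simp add: edges_at_def translate_image)
  also have "\<dots> = (`) ((+) t) ` edges_at S"
    by (auto simp: edges_at_def image_Int[symmetric] intro!: imageI)
  finally show ?thesis .
qed

lemma inj_translate: "inj ((+) (t :: 'a))" "inj_on ((`) ((+) t)) X"
  by (simp, rule inj_on_image) simp

lemma exits_translate:
  fixes S :: "'a set"
  shows "exits ((+) t ` S) ((`) ((+) t) ` A) (t + x) \<longleftrightarrow> exits S A x"
proof -
  have shift: "(\<exists>v. P v) \<longleftrightarrow> (\<exists>v. P (t + v))" for P :: "'a \<Rightarrow> bool"
  proof
    assume "\<exists>v. P v"
    then obtain v where "P v" by blast
    then have "P (t + (- t + v))" by simp
    then show "\<exists>v. P (t + v)" by blast
  qed blast
  have "exits ((+) t ` S) ((`) ((+) t) ` A) (t + x) \<longleftrightarrow>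
      (\<exists>v. t + v \<notin> (+) t ` S \<and> conn ((`) ((+) t) ` A) (t + x) (t + v))"
    unfolding exits_def by (rule shift)
  also have "\<dots> \<longleftrightarrow> exits S A x"
  proof -
    have "t + v \<in> (+) t ` S \<longleftrightarrow> v \<in> S" for v by auto
    then show ?thesis by (simp add: exits_def conn_image_iff[OF inj_translate(1)])
  qed
  finally show ?thesis .
qed

lemma xit_translate: "xit p ((+) t ` S) (t + x) = xit p S x"
proof -
  have "inj_on ((`) ((+) t)) (edges_at S)" by (rule inj_translate)
  then show ?thesis
    unfolding xit_def edges_at_translate by (simp add: bexp_image exits_translate)
qed

end

subsection \<open>The Duminil-Copin--Tassion criterion\<close>

context translation_graph
begin

text \<open>The finite-volume counterpart of an edge between two distinct infinite clusters. That it
  is unlikely, as shown below for the square lattice, stands in for uniqueness of the infinite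
  cluster.\<close>

definition joins_exits :: "'a set \<Rightarrow> 'a set set \<Rightarrow> 'a set \<Rightarrow> bool" where
  "joins_exits S A e \<longleftrightarrow> (\<exists>a b. e = {a, b} \<and> \<not> conn A a b \<and> exits S A a \<and> exits S A b)"

definition outer :: "'a set \<Rightarrow> 'a set" where
  "outer S = \<Union>(edges_at S) - S"

lemma finite_outer: "finite S \<Longrightarrow> finite (outer S)"
proof -
  assume "finite S"
  moreover have "finite e" if "e \<in> G" for e using edge[OF that] by auto
  ultimately show ?thesis
    using finite_edges_at[of S] edges_at_subset[of S] by (auto simp: outer_def)
qed

lemma exits_outer:
  assumes "exits S A a" "A \<subseteq> edges_at S" "a \<in> e" "e \<in> edges_at S"
  shows "\<exists>z\<in>outer S. conn A z a"
proof -
  obtain v where v: "v \<notin> S" "conn A a v" using assms(1) by (auto simp: exits_def)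
  have "v \<in> \<Union>(edges_at S)"
  proof (cases "a = v")
    case False
    then obtain e' where "e' \<in> A" "v \<in> e'" using conn_in_edge[OF v(2)] by blast
    then show ?thesis using assms(2) by blast
  qed (use assms in auto)
  then show ?thesis using v conn_sym[OF v(2)] by (auto simp: outer_def)
qed

lemma joins_exits_separates:
  assumes "joins_exits S A e" "A \<subseteq> edges_at S" "e \<in> edges_at S"
  shows "separates A (outer S) e"
proof -
  obtain a b where ab: "e = {a, b}" "\<not> conn A a b" "exits S A a" "exits S A b"
    using assms(1) by (auto simp: joins_exits_def)
  have "\<exists>z\<in>outer S. conn A z a" "\<exists>z\<in>outer S. conn A z b"
    using exits_outer[OF ab(3) assms(2) _ assms(3)] exits_outer[OF ab(4) assms(2) _ assms(3)] ab(1) by auto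
  then show ?thesis using ab unfolding separates_def by blast
qed

lemma joins_exits_mono_set:
  assumes "S \<subseteq> S'" "finite S'" "0 \<le> p" "p \<le> 1"
  shows "bprob p (edges_at S') (\<lambda>A. joins_exits S' A e) \<le> bprob p (edges_at S) (\<lambda>A. joins_exits S A e)"
proof -
  have "bprob p (edges_at S') (\<lambda>A. joins_exits S' A e) \<le>
      bprob p (edges_at S') (\<lambda>A. joins_exits S (A \<inter> edges_at S) e)"
  proof (intro bprob_mono assms)
    fix A assume A: "A \<subseteq> edges_at S'" "joins_exits S' A e"
    obtain a b where ab: "e = {a, b}" "\<not> conn A a b" "exits S' A a" "exits S' A b"
      using A(2) by (auto simp: joins_exits_def)
    have "A \<subseteq> G" using A(1) edges_at_subset by blast
    then have "exits S (A \<inter> edges_at S) a" "exits S (A \<inter> edges_at S) b"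
      using exits_first exits_antimono[OF assms(1)] ab(3,4) by auto
    moreover have "\<not> conn (A \<inter> edges_at S) a b"
      using ab(2) conn_mono[of "A \<inter> edges_at S" A a b] by auto
    ultimately show "joins_exits S (A \<inter> edges_at S) e"
      using ab(1) unfolding joins_exits_def by blast
  qed
  also have "\<dots> = bprob p (edges_at S) (\<lambda>A. joins_exits S A e)"
    by (rule bexp_marginal[OF finite_edges_at[OF assms(2)] edges_at_mono[OF assms(1)]])
  finally show ?thesis .
qed

lemma joins_exits_translate:
  "bprob p (edges_at ((+) t ` S)) (\<lambda>A. joins_exits ((+) t ` S) A ((+) t ` e)) =
    bprob p (edges_at S) (\<lambda>A. joins_exits S A e)"
proof -
  have "joins_exits ((+) t ` S) ((`) ((+) t) ` A) ((+) t ` e) \<longleftrightarrow> joins_exits S A e" for A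
  proof
    assume "joins_exits ((+) t ` S) ((`) ((+) t) ` A) ((+) t ` e)"
    then obtain a b where ab: "(+) t ` e = {a, b}" "\<not> conn ((`) ((+) t) ` A) a b"
      "exits ((+) t ` S) ((`) ((+) t) ` A) a" "exits ((+) t ` S) ((`) ((+) t) ` A) b"
      by (auto simp: joins_exits_def)
    define a' b' where "a' = - t + a" and "b' = - t + b"
    have a: "a = t + a'" "b = t + b'" by (simp_all add: a'_def b'_def)
    have "(+) t ` e = (+) t ` {a', b'}" using ab(1) a by simp
    then have "e = {a', b'}" by (rule inj_image_eq_iff[OF inj_translate(1), THEN iffD1])
    then show "joins_exits S A e"
      using ab(2-) unfolding a joins_exits_def exits_translate conn_image_iff[OF inj_translate(1)] by blast
  next
    assume "joins_exits S A e"
    then obtain a b where ab: "e = {a, b}" "\<not> conn A a b" "exits S A a" "exits S A b"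
      by (auto simp: joins_exits_def)
    then have "(+) t ` e = {t + a, t + b}" "\<not> conn ((`) ((+) t) ` A) (t + a) (t + b)"
      "exits ((+) t ` S) ((`) ((+) t) ` A) (t + a)" "exits ((+) t ` S) ((`) ((+) t) ` A) (t + b)"
      by (simp_all add: exits_translate conn_image_iff[OF inj_translate(1)])
    then show "joins_exits ((+) t ` S) ((`) ((+) t) ` A) ((+) t ` e)"
      unfolding joins_exits_def by blast
  qed
  moreover have "inj_on ((`) ((+) t)) (edges_at S)" by (rule inj_translate)
  ultimately show ?thesis
    unfolding edges_at_translate by (simp add: bexp_image)
qed

text \<open>The clusters at the endpoints of such an edge meet \<open>outer S\<close>, so all of
  them can be explored from there. For boxes this is a set of surface order, against a number of
  edges of volume order.\<close>

lemma sum_joins_exits_le: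
  assumes fin: "finite S" and p: "0 \<le> p" "p \<le> 1" and l: "l > 0"
  shows "p * (\<Sum>e\<in>edges_at S. bprob p (edges_at S) (\<lambda>A. joins_exits S A e))
    \<le> l / 2 * (real (card (outer S)) * harm (card (edges_at S))) + real (card (edges_at S)) / l"
proof -
  let ?E = "edges_at S"
  have "(\<Sum>e\<in>?E. bprob p ?E (\<lambda>A. joins_exits S A e)) \<le> (\<Sum>e\<in>?E. bprob p ?E (\<lambda>A. separates A (outer S) e))"
    by (intro sum_mono bprob_mono p joins_exits_separates) auto
  then have "p * (\<Sum>e\<in>?E. bprob p ?E (\<lambda>A. joins_exits S A e)) \<le>
      p * bexp p ?E (\<lambda>A. \<Sum>e\<in>?E. of_bool (separates A (outer S) e))"
    unfolding bexp_sum using p by (intro mult_left_mono) auto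
  also have "\<dots> \<le> l / 2 * (real (card (outer S)) * harm (card ?E)) + real (card ?E) / l"
    using edge edges_at_subset[of S]
    by (intro separating_edges_bound finite_edges_at finite_outer fin p l) blast
  finally show ?thesis .
qed

lemma card_edges_at_le: "finite S \<Longrightarrow> card (edges_at S) \<le> deg * card S"
proof -
  assume S: "finite S"
  have "edges_at S = (\<Union>x\<in>S. {e \<in> G. x \<in> e})" by (auto simp: edges_at_def)
  then have "card (edges_at S) \<le> (\<Sum>x\<in>S. card {e \<in> G. x \<in> e})" using S by (simp add: card_UN_le)
  also have "\<dots> \<le> (\<Sum>x\<in>S. deg)" by (intro sum_mono card_star)
  finally show ?thesis by (simp add: mult.commute)
qed

text \<open>Edges missing from \<open>E\<close> count as closed, which only makes it harder to leave
  \<open>S\<close>. This serves for arms in a rectangle that does not contain the whole box around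
  their starting point.\<close>

lemma bprob_exits_le_xit:
  assumes "finite E" "E \<subseteq> G" "finite S" "0 \<le> p" "p \<le> 1"
  shows "bprob p E (\<lambda>A. exits S A x) \<le> xit p S x"
proof -
  let ?F = "E \<union> edges_at S"
  have finF: "finite ?F" using assms finite_edges_at by auto
  have "bprob p E (\<lambda>A. exits S A x) = bprob p ?F (\<lambda>A. exits S (A \<inter> E) x)"
    by (rule bexp_marginal[OF finF, symmetric]) auto
  also have "\<dots> \<le> bprob p ?F (\<lambda>A. exits S (A \<inter> edges_at S) x)"
  proof (intro bprob_mono assms)
    fix A assume A: "A \<subseteq> ?F" "exits S (A \<inter> E) x"
    have "exits S A x" by (rule exits_mono[OF _ A(2)]) auto
    then show "exits S (A \<inter> edges_at S) x"
      using A(1) assms(2) edges_at_subset[of S] by (intro exits_first) auto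
  qed
  also have "\<dots> = xit p S x" using finF by (intro xit_eq_marginal[symmetric]) auto
  finally show ?thesis .
qed

definition bdry :: "'a set \<Rightarrow> ('a \<times> 'a) set" where
  "bdry S = {(x, y). x \<in> S \<and> y \<notin> S \<and> {x, y} \<in> G}"

text \<open>The quantity \<open>\<phi>\<^sub>p(S)\<close> of Duminil-Copin and Tassion.\<close>

definition phi :: "real \<Rightarrow> 'a set \<Rightarrow> real" where
  "phi p S = (\<Sum>(x, y)\<in>bdry S. p * bprob p (inside S G) (\<lambda>A. conn A 0 x))"

lemma inj_on_bdry: "inj_on (\<lambda>(x, y). {x, y}) (bdry S)"
  by (auto simp: inj_on_def bdry_def doubleton_eq_iff)

lemma finite_bdry:
  assumes "finite S"
  shows "finite (bdry S)"
proof (rule finite_imageD[OF _ inj_on_bdry])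
  have "(\<lambda>(x, y). {x, y}) ` bdry S \<subseteq> edges_at S"
    by (auto simp: bdry_def edges_at_def)
  then show "finite ((\<lambda>(x, y). {x, y}) ` bdry S)"
    using finite_edges_at[OF assms] finite_subset by blast
qed

lemma finite_inside: "finite S \<Longrightarrow> finite (inside S G)"
  using finite_edges_at inside_subset_edges_at finite_subset by metis

lemma bprob_single_edge: "bprob p {e} (\<lambda>A. e \<in> A) = p"
  using bexp_insert[of "{}" e p "\<lambda>A. of_bool (e \<in> A)"] by simp

text \<open>A Simon--Lieb inequality. An exit path from 0 yields a path inside \<open>S\<close> to
  some \<open>x\<close>, a boundary edge \<open>{x, y}\<close>, and an exit path from
  \<open>y\<close> disjoint from both. BK separates the last piece from the others, and the boundary
  edge is independent of the edges inside \<open>S\<close>, whence the factor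
  \<open>p\<close>.\<close>

lemma phi_recursion:
  assumes "finite \<Lambda>" "S \<subseteq> \<Lambda>" "0 \<in> S" "0 \<le> p" "p \<le> 1"
    and bd: "\<And>x y. (x, y) \<in> bdry S \<Longrightarrow> xit p \<Lambda> y \<le> c"
  shows "xit p \<Lambda> 0 \<le> phi p S * c"
proof -
  let ?E = "edges_at \<Lambda>"
  have finE: "finite ?E" and finS: "finite S"
    using assms finite_edges_at finite_subset by auto
  let ?F = "\<lambda>(x, y). {I. conn (inside S I) 0 x \<and> {x, y} \<in> I}"
  let ?H = "\<lambda>(x, y). {J. exits \<Lambda> J y}"
  define L where "L = (\<lambda>b. bprob p ?E (\<lambda>A. \<exists>I\<in>?F b. \<exists>J\<in>?H b. I \<subseteq> A \<and> J \<subseteq> A \<and> I \<inter> J = {}))"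
  have "xit p \<Lambda> 0 \<le> (\<Sum>b\<in>bdry S. L b)"
    unfolding xit_def L_def
  proof (rule bprob_Ex_le[OF assms(4,5) finite_bdry[OF finS]])
    fix A assume A: "A \<subseteq> ?E" "exits \<Lambda> A 0"
    then obtain w where w: "w \<notin> \<Lambda>" "conn A 0 w" by (auto simp: exits_def)
    have "w \<notin> S" using w assms(2) by auto
    obtain x y I J where *: "x \<in> S" "y \<notin> S" "{x, y} \<in> I" "I \<subseteq> A" "J \<subseteq> A" "I \<inter> J = {}"
      "I \<subseteq> insert {x, y} (inside S A)" "conn (inside S I) 0 x" "conn J y w"
      by (rule conn_split[OF w(2) assms(3) \<open>w \<notin> S\<close>])
    have "(x, y) \<in> bdry S" using * A edges_at_subset[of \<Lambda>] by (auto simp: bdry_def)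
    moreover have "I \<in> ?F (x, y)" "J \<in> ?H (x, y)" using * w by (auto simp: exits_def)
    ultimately show "\<exists>b\<in>bdry S. \<exists>I\<in>?F b. \<exists>J\<in>?H b. I \<subseteq> A \<and> J \<subseteq> A \<and> I \<inter> J = {}"
      using *(4-6) by (intro bexI[of _ "(x, y)"] bexI[of _ I] bexI[of _ J]) auto
  qed
  also have "\<dots> \<le> (\<Sum>(x, y)\<in>bdry S. p * bprob p (inside S G) (\<lambda>A. conn A 0 x) * c)"
  proof (rule sum_mono)
    fix b assume "b \<in> bdry S"
    then obtain x y where bxy: "b = (x, y)" and b: "(x, y) \<in> bdry S" by (cases b) auto
    let ?e = "{x, y}"
    have e: "?e \<in> ?E" "?e \<notin> inside S G" "inside S G \<subseteq> ?E"
      using b assms(2) inside_subset_edges_at[of S] edges_at_mono[OF assms(2)]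
      by (auto simp: bdry_def inside_def edges_at_def)
    let ?b1 = "bprob p ?E (\<lambda>A. \<exists>I\<in>?F (x, y). I \<subseteq> A)"
    let ?b2 = "bprob p ?E (\<lambda>A. \<exists>J\<in>?H (x, y). J \<subseteq> A)"
    have "?b2 \<le> xit p \<Lambda> y"
      unfolding xit_def by (intro bprob_mono assms) (auto intro: exits_mono)
    also have "\<dots> \<le> c" by (rule bd[OF b])
    finally have b2: "?b2 \<le> c" .
    have "?b1 \<le> bprob p ?E (\<lambda>A. conn (A \<inter> inside S G) 0 x \<and> ?e \<in> A \<inter> {?e})"
    proof (intro bprob_mono assms)
      fix A assume A: "A \<subseteq> ?E" "\<exists>I\<in>?F (x, y). I \<subseteq> A"
      then obtain I where I: "I \<subseteq> A" "conn (inside S I) 0 x" "?e \<in> I" by auto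
      have "inside S I \<subseteq> A \<inter> inside S G"
        using I A edges_at_subset[of \<Lambda>] by (auto simp: inside_def)
      then have "conn (A \<inter> inside S G) 0 x" using I(2) by (rule conn_mono)
      then show "conn (A \<inter> inside S G) 0 x \<and> ?e \<in> A \<inter> {?e}" using I by auto
    qed
    also have "\<dots> = bprob p (inside S G) (\<lambda>A. conn A 0 x) * bprob p {?e} (\<lambda>A. ?e \<in> A)"
      using e by (intro bprob_indep finE) auto
    finally have b1: "?b1 \<le> p * bprob p (inside S G) (\<lambda>A. conn A 0 x)"
      by (simp add: bprob_single_edge mult.commute)
    have "bprob p ?E (\<lambda>A. \<exists>I\<in>?F (x, y). \<exists>J\<in>?H (x, y). I \<subseteq> A \<and> J \<subseteq> A \<and> I \<inter> J = {}) \<le> ?b1 * ?b2"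
      by (rule BK_inequality[OF finE assms(4,5)])
    also have "\<dots> \<le> (p * bprob p (inside S G) (\<lambda>A. conn A 0 x)) * c"
      using b1 b2 assms(4,5) by (intro mult_mono mult_nonneg_nonneg bprob_nonneg) auto
    finally show "L b \<le> (case b of (x, y) \<Rightarrow> p * bprob p (inside S G) (\<lambda>A. conn A 0 x) * c)"
      unfolding L_def bxy by simp
  qed
  also have "\<dots> = phi p S * c"
    unfolding phi_def by (simp add: sum_distrib_right case_prod_unfold)
  finally show ?thesis .
qed

text \<open>One term of Russo's formula. Whether \<open>e\<close> is pivotal does not depend on the
  state of \<open>e\<close>, so both sides are \<open>p * (1 - p)\<close> times the probability that
  it is.\<close>

lemma bexp_covariance:
  assumes "finite E" "e \<in> E"
    and mono: "\<And>A. A \<subseteq> E \<Longrightarrow> P A \<Longrightarrow> P (insert e A)"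
  shows "bexp p E (\<lambda>A. of_bool (P A) * (of_bool (e \<in> A) - p)) =
    p * bprob p E (\<lambda>A. e \<notin> A \<and> \<not> P A \<and> P (insert e A))"
proof -
  define E' where "E' = E - {e}"
  have E': "E = insert e E'" "e \<notin> E'" "finite E'" using assms by (auto simp: E'_def)
  have "bexp p E (\<lambda>A. of_bool (P A) * (of_bool (e \<in> A) - p)) =
     p * bexp p E' (\<lambda>A. of_bool (P (insert e A)) * (1 - p)) + (1 - p) * bexp p E' (\<lambda>A. of_bool (P A) * (- p))"
    unfolding E'(1) using E'(2,3)
    by (subst bexp_insert) (auto intro!: arg_cong2[of _ _ _ _ "(+)"] arg_cong2[of _ _ _ _ "(*)"] bexp_cong)
  also have "\<dots> = p * (1 - p) * (bexp p E' (\<lambda>A. of_bool (P (insert e A))) - bexp p E' (\<lambda>A. of_bool (P A)))"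
    unfolding bexp_cmult_right by algebra
  also have "bexp p E' (\<lambda>A. of_bool (P (insert e A))) - bexp p E' (\<lambda>A. of_bool (P A)) =
      bexp p E' (\<lambda>A. of_bool (e \<notin> A \<and> \<not> P A \<and> P (insert e A)))"
    unfolding bexp_diff[symmetric]
  proof (rule bexp_cong)
    fix A assume "A \<subseteq> E'"
    then have "e \<notin> A" "A \<subseteq> E" using E' by auto
    then show "of_bool (P (insert e A)) - of_bool (P A) =
        (of_bool (e \<notin> A \<and> \<not> P A \<and> P (insert e A)) :: real)"
      using mono[of A] by auto
  qed
  also have "p * (1 - p) * \<dots> = p * bprob p E (\<lambda>A. e \<notin> A \<and> \<not> P A \<and> P (insert e A))"
    unfolding E'(1) using E'(2,3) by (subst bexp_insert) simp_all
  finally show ?thesis .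
qed

text \<open>The Duminil-Copin--Tassion argument: condition on the set \<open>S\<close> of vertices that are not
  connected to the outside of \<open>\<Lambda>\<close>, an event independent of the edges inside \<open>S\<close>.\<close>

lemma pivotal_lower_bound:
  assumes fin: "finite \<Lambda>" and p: "0 \<le> p" "p \<le> 1" and "0 \<in> \<Lambda>"
    and phi: "\<And>S. S \<subseteq> \<Lambda> \<Longrightarrow> 0 \<in> S \<Longrightarrow> 1 \<le> phi p S"
  shows "1 - xit p \<Lambda> 0 \<le> bexp p (edges_at \<Lambda>) (\<lambda>A. of_bool (exits \<Lambda> A 0) * bal p (edges_at \<Lambda>) A)"
proof -
  let ?E = "edges_at \<Lambda>" and ?P = "\<lambda>A. exits \<Lambda> A 0"
  have finE: "finite ?E" using fin by (rule finite_edges_at)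
  define U where "U = (\<lambda>A. {x \<in> \<Lambda>. \<not> exits \<Lambda> A x})"
  define \<S> where "\<S> = {S. S \<subseteq> \<Lambda> \<and> 0 \<in> S}"
  have finS: "finite \<S>" using fin by (simp add: \<S>_def)
  have U_edge: "{x, y} \<notin> A" if "x \<in> U A" "y \<notin> U A" for A x y
    using that exits_trans[OF conn_edge, of x y A \<Lambda>] conn_edge[of x y A]
    by (auto simp: U_def exits_def)
  \<comment> \<open>The edges from \<open>S\<close> to the other vertices are closed. Open paths
    that start outside \<open>S\<close> and leave \<open>\<Lambda>\<close> therefore avoid
    \<open>S\<close>, and the edges inside \<open>S\<close> have no influence on the event.\<close>
  have U_iff: "U (A \<inter> (?E - inside S G)) = S \<longleftrightarrow> U A = S" if A: "A \<subseteq> ?E" for A S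
  proof
    let ?B = "A \<inter> (?E - inside S G)"
    assume S: "U A = S"
    have "conn A x v \<Longrightarrow> v \<notin> \<Lambda> \<Longrightarrow> conn ?B x v" for x v
    proof (induction rule: conn_converse_induct)
      case (step x z)
      have "x \<notin> S" using step S by (auto simp: U_def exits_def intro: conn_step_left)
      then have "{x, z} \<in> ?B" using step A by (auto simp: inside_def)
      then show ?case using step by (intro conn_step_left[of x z]) auto
    qed simp
    then have "exits \<Lambda> A x \<Longrightarrow> exits \<Lambda> ?B x" for x by (auto simp: exits_def)
    moreover have "exits \<Lambda> ?B x \<Longrightarrow> exits \<Lambda> A x" for x by (rule exits_mono[of ?B A]) auto
    ultimately show "U ?B = S" using S unfolding U_def by blast
  next
    let ?B = "A \<inter> (?E - inside S G)"
    assume S: "U ?B = S"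
    have "x \<in> S" if "x \<in> U A" for x
      using that exits_mono[of ?B A \<Lambda> x] S by (auto simp: U_def)
    moreover have "x \<notin> S" if ex: "exits \<Lambda> A x" for x
    proof
      assume "x \<in> S"
      obtain v where v: "v \<notin> \<Lambda>" "conn A x v" using ex by (auto simp: exits_def)
      have "v \<in> S" using v(2) \<open>x \<in> S\<close>
      proof (rule conn_closed)
        fix a b assume ab: "{a, b} \<in> A" "a \<in> S"
        show "b \<in> S"
        proof (rule ccontr)
          assume "b \<notin> S"
          then have "{a, b} \<in> ?B" using ab A by (auto simp: inside_def)
          then show False using U_edge[of a ?B b] ab \<open>b \<notin> S\<close> S by auto
        qed
      qed
      then show False using v S by (auto simp: U_def)
    qed
    moreover have "S \<subseteq> \<Lambda>" using S by (auto simp: U_def)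
    ultimately show "U A = S" by (auto simp: U_def)
  qed
  \<comment> \<open>All edges from \<open>S = U A\<close> to its complement are closed. If 0 is
    connected to \<open>x\<close> inside \<open>S\<close>, opening \<open>{x, y}\<close> lets 0 exit
    through \<open>y\<close>, so this edge is closed and pivotal.\<close>
  have piv: "(\<Sum>S\<in>\<S>. of_bool (U A = S) * (\<Sum>(x, y)\<in>bdry S. of_bool (conn (A \<inter> inside S G) 0 x)))
      \<le> (\<Sum>e\<in>?E. of_bool (e \<notin> A \<and> \<not> ?P A \<and> ?P (insert e A)) :: real)" if A: "A \<subseteq> ?E" for A
  proof (cases "U A \<in> \<S>")
    case True
    let ?S = "U A"
    have nP: "\<not> ?P A" using True by (auto simp: \<S>_def U_def)
    have "(\<Sum>S\<in>\<S>. of_bool (U A = S) * (\<Sum>(x, y)\<in>bdry S. of_bool (conn (A \<inter> inside S G) 0 x)))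
        = (\<Sum>S\<in>\<S>. if S = ?S then (\<Sum>(x, y)\<in>bdry S. of_bool (conn (A \<inter> inside S G) 0 x)) else 0 :: real)"
      by (intro sum.cong) auto
    also have "\<dots> = (\<Sum>(x, y)\<in>bdry ?S. of_bool (conn (A \<inter> inside ?S G) 0 x))"
      using True finS by simp
    also have "\<dots> \<le> (\<Sum>(x, y)\<in>bdry ?S. of_bool ({x, y} \<notin> A \<and> \<not> ?P A \<and> ?P (insert {x, y} A)))"
    proof (rule sum_mono, clarify)
      fix x y assume b: "(x, y) \<in> bdry ?S"
      have "{x, y} \<notin> A" using b U_edge by (auto simp: bdry_def)
      moreover have "?P (insert {x, y} A)" if "conn (A \<inter> inside ?S G) 0 x"
      proof -
        have "conn (insert {x, y} A) 0 x" using that by (rule conn_mono[rotated]) auto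
        then have "conn (insert {x, y} A) 0 y" by (rule conn_step) simp
        moreover have "exits \<Lambda> (insert {x, y} A) y"
        proof (cases "y \<in> \<Lambda>")
          case True
          then have "exits \<Lambda> A y" using b by (auto simp: bdry_def U_def)
          then show ?thesis by (rule exits_mono[rotated]) auto
        next
          case False
          then show ?thesis by (auto simp: exits_def intro!: exI[of _ y])
        qed
        ultimately show ?thesis by (rule exits_trans)
      qed
      ultimately show "of_bool (conn (A \<inter> inside ?S G) 0 x) \<le>
          (of_bool ({x, y} \<notin> A \<and> \<not> ?P A \<and> ?P (insert {x, y} A)) :: real)"
        using nP by auto
    qed
    also have "\<dots> = (\<Sum>e\<in>(\<lambda>(x, y). {x, y}) ` bdry ?S. of_bool (e \<notin> A \<and> \<not> ?P A \<and> ?P (insert e A)))"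
      by (subst sum.reindex[OF inj_on_bdry]) (auto intro!: sum.cong)
    also have "\<dots> \<le> (\<Sum>e\<in>?E. of_bool (e \<notin> A \<and> \<not> ?P A \<and> ?P (insert e A)))"
      using finE by (intro sum_mono2) (auto simp: bdry_def edges_at_def U_def)
    finally show ?thesis .
  next
    case False
    then have "(\<Sum>S\<in>\<S>. of_bool (U A = S) * (\<Sum>(x, y)\<in>bdry S. of_bool (conn (A \<inter> inside S G) 0 x))) = (0 :: real)"
      by (intro sum.neutral) auto
    then show ?thesis by (simp add: sum_nonneg)
  qed
  have "1 - xit p \<Lambda> 0 = bprob p ?E (\<lambda>A. \<not> ?P A)"
    using finE by (simp add: bprob_not xit_def)
  also have "\<dots> \<le> (\<Sum>S\<in>\<S>. bprob p ?E (\<lambda>A. U A = S))"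
  proof (rule bprob_Ex_le[OF p finS])
    fix A assume "\<not> ?P A"
    then show "\<exists>S\<in>\<S>. U A = S" using \<open>0 \<in> \<Lambda>\<close> by (auto simp: U_def \<S>_def)
  qed
  also have "\<dots> \<le> (\<Sum>S\<in>\<S>. bprob p ?E (\<lambda>A. U A = S) * phi p S)"
  proof (rule sum_mono)
    fix S assume "S \<in> \<S>"
    then have "1 \<le> phi p S" using phi by (auto simp: \<S>_def)
    then show "bprob p ?E (\<lambda>A. U A = S) \<le> bprob p ?E (\<lambda>A. U A = S) * phi p S"
      using mult_left_mono[of 1 "phi p S" "bprob p ?E (\<lambda>A. U A = S)"]
        bprob_nonneg[OF p, of ?E "\<lambda>A. U A = S"] by simp
  qed
  also have "\<dots> = (\<Sum>S\<in>\<S>. p * bexp p ?E (\<lambda>A. of_bool (U A = S) * (\<Sum>(x, y)\<in>bdry S. of_bool (conn (A \<inter> inside S G) 0 x))))"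
  proof (intro sum.cong refl)
    fix S assume "S \<in> \<S>"
    then have S: "S \<subseteq> \<Lambda>" by (simp add: \<S>_def)
    have sub: "inside S G \<subseteq> ?E" using inside_subset_edges_at edges_at_mono[OF S] by blast
    have "bexp p ?E (\<lambda>A. of_bool (U A = S) * (\<Sum>(x, y)\<in>bdry S. of_bool (conn (A \<inter> inside S G) 0 x))) =
        bexp p ?E (\<lambda>A. of_bool (U (A \<inter> (?E - inside S G)) = S) * (\<Sum>(x, y)\<in>bdry S. of_bool (conn (A \<inter> inside S G) 0 x)))"
      by (intro bexp_cong) (simp add: U_iff)
    also have "\<dots> = bprob p (?E - inside S G) (\<lambda>A. U A = S) *
        bexp p (inside S G) (\<lambda>A. \<Sum>(x, y)\<in>bdry S. of_bool (conn A 0 x))"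
      using sub by (intro bexp_indep[OF finE, where f = "\<lambda>A. of_bool (U A = S)"]) auto
    also have "bprob p (?E - inside S G) (\<lambda>A. U A = S) = bprob p ?E (\<lambda>A. U (A \<inter> (?E - inside S G)) = S)"
      using bexp_marginal[OF finE, of "?E - inside S G" p "\<lambda>A. of_bool (U A = S)"] by simp
    also have "\<dots> = bprob p ?E (\<lambda>A. U A = S)"
      by (intro bexp_cong) (simp add: U_iff)
    finally show "bprob p ?E (\<lambda>A. U A = S) * phi p S =
        p * bexp p ?E (\<lambda>A. of_bool (U A = S) * (\<Sum>(x, y)\<in>bdry S. of_bool (conn (A \<inter> inside S G) 0 x)))"
      by (simp add: phi_def case_prod_unfold bexp_sum sum_distrib_left mult_ac)
  qed
  also have "\<dots> = p * bexp p ?E (\<lambda>A. \<Sum>S\<in>\<S>. of_bool (U A = S) * (\<Sum>(x, y)\<in>bdry S. of_bool (conn (A \<inter> inside S G) 0 x)))"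
    by (simp add: bexp_sum sum_distrib_left)
  also have "\<dots> \<le> p * bexp p ?E (\<lambda>A. \<Sum>e\<in>?E. of_bool (e \<notin> A \<and> \<not> ?P A \<and> ?P (insert e A)))"
    using p by (intro mult_left_mono bexp_mono piv) auto
  also have "\<dots> = (\<Sum>e\<in>?E. bexp p ?E (\<lambda>A. of_bool (?P A) * (of_bool (e \<in> A) - p)))"
    unfolding bexp_sum sum_distrib_left
    using finE exits_mono[OF subset_insertI]
    by (intro sum.cong refl bexp_covariance[symmetric]) auto
  also have "\<dots> = bexp p ?E (\<lambda>A. of_bool (?P A) * bal p ?E A)"
    unfolding bexp_sum[symmetric] sum_distrib_left[symmetric]
  proof (rule bexp_cong)
    fix A assume "A \<subseteq> ?E"
    then have "A \<inter> ?E = A" by auto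
    then show "of_bool (?P A) * (\<Sum>e\<in>?E. of_bool (e \<in> A) - p) = of_bool (?P A) * bal p ?E A"
      using bal_eq_sum[OF finE, of p A] by simp
  qed
  finally show ?thesis .
qed

text \<open>An edge not touched by the cluster of 0 can be switched without changing that cluster,
  so its centred variable has mean zero on the event that 0 exits and the edge stays
  unrevealed.\<close>

lemma exits_balance_touched:
  assumes fin: "finite \<Lambda>"
  shows "bexp p (edges_at \<Lambda>) (\<lambda>A. of_bool (exits \<Lambda> A 0) * bal p (edges_at \<Lambda>) A) =
    bexp p (edges_at \<Lambda>) (\<lambda>A. of_bool (exits \<Lambda> A 0) *
      bal p (touched (edges_at \<Lambda>) {0} A) (A \<inter> touched (edges_at \<Lambda>) {0} A))"
proof -
  let ?E = "edges_at \<Lambda>" and ?P = "\<lambda>A. exits \<Lambda> A 0"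
  let ?T = "\<lambda>A. touched ?E {0} A"
  have finE: "finite ?E" using fin by (rule finite_edges_at)
  have zero: "bexp p ?E (\<lambda>A. (of_bool (?P A) * of_bool (e \<notin> ?T A)) * (of_bool (e \<in> A) - p)) = 0" if e: "e \<in> ?E" for e
  proof -
    define E' where "E' = ?E - {e}"
    have E': "?E = insert e E'" "e \<notin> E'" "finite E'" using finE e by (auto simp: E'_def)
    let ?f = "\<lambda>A. of_bool (?P A) * of_bool (e \<notin> ?T A) :: real"
    have f: "?f (insert e A) = ?f A" for A
    proof (cases "e \<in> ?T A")
      case True
      then have "e \<in> ?T (insert e A)" using touched_mono[of A "insert e A"] by blast
      then show ?thesis using True by simp
    next
      case False
      have 1: "{e} \<subseteq> ?E" "{e} \<inter> ?T A = {}" using e False by auto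
      have "?T (insert e A) = ?T A" using touched_untouched[OF 1] by simp
      moreover have "conn (insert e A) 0 v \<Longrightarrow> conn A 0 v" for v
        using conn_untouched[OF _ _ 1, of 0 v] by simp
      then have "?P (insert e A) \<longleftrightarrow> ?P A"
        using exits_mono[of A "insert e A" \<Lambda> 0] by (auto simp: exits_def)
      ultimately show ?thesis by simp
    qed
    have "bexp p (insert e E') (\<lambda>A. ?f A * (of_bool (e \<in> A) - p)) =
        p * bexp p E' (\<lambda>A. ?f A * (1 - p)) + (1 - p) * bexp p E' (\<lambda>A. ?f A * (- p))"
      using E'(2,3)
      by (subst bexp_insert)
         (auto simp del: mult_minus_right intro!: arg_cong2[of _ _ _ _ "(+)"] arg_cong2[of _ _ _ _ "(*)"] bexp_cong simp: f)
    also have "\<dots> = 0" unfolding bexp_cmult_right by algebra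
    finally show ?thesis using E'(1) by simp
  qed
  have "of_bool (?P A) * bal p ?E A - of_bool (?P A) * bal p (?T A) (A \<inter> ?T A) =
      (\<Sum>e\<in>?E. (of_bool (?P A) * of_bool (e \<notin> ?T A)) * (of_bool (e \<in> A) - p))" if A: "A \<subseteq> ?E" for A
  proof -
    have finT: "finite (?T A)" using finE touched_subset finite_subset by metis
    have "bal p ?E A = (\<Sum>e\<in>?E. of_bool (e \<in> A) - p)"
      using bal_eq_sum[OF finE, of p A] A by (simp add: Int_absorb2)
    moreover have "bal p (?T A) (A \<inter> ?T A) = (\<Sum>e\<in>?E. of_bool (e \<in> ?T A) * (of_bool (e \<in> A) - p))"
      unfolding bal_eq_sum[OF finT] using finE touched_subset[of ?E "{0}" A]
      by (intro sum.mono_neutral_cong_left) auto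
    moreover have "(\<Sum>e\<in>?E. of_bool (e \<in> A) - p) - (\<Sum>e\<in>?E. of_bool (e \<in> ?T A) * (of_bool (e \<in> A) - p)) =
        (\<Sum>e\<in>?E. of_bool (e \<notin> ?T A) * (of_bool (e \<in> A) - p))"
      unfolding sum_subtractf[symmetric] by (intro sum.cong refl) (auto simp: of_bool_def)
    ultimately show ?thesis by (simp add: sum_distrib_left mult.assoc right_diff_distrib[symmetric])
  qed
  then have "bexp p ?E (\<lambda>A. of_bool (?P A) * bal p ?E A) - bexp p ?E (\<lambda>A. of_bool (?P A) * bal p (?T A) (A \<inter> ?T A)) =
      bexp p ?E (\<lambda>A. \<Sum>e\<in>?E. (of_bool (?P A) * of_bool (e \<notin> ?T A)) * (of_bool (e \<in> A) - p))"
    unfolding bexp_diff[symmetric] by (intro bexp_cong) simp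
  also have "\<dots> = 0" by (simp add: bexp_sum zero)
  finally show ?thesis by simp
qed

text \<open>Cauchy--Schwarz brings in the second moment of the balance, which is at most the mean
  number of revealed edges. Each of these has an endpoint in the cluster of 0, whence the factor
  \<open>deg\<close>.\<close>

theorem exits_cluster_size:
  assumes fin: "finite \<Lambda>" "finite V" "\<And>e. e \<in> edges_at \<Lambda> \<Longrightarrow> e \<subseteq> V"
    and p: "0 \<le> p" "p \<le> 1" and "0 \<in> \<Lambda>"
    and phi: "\<And>S. S \<subseteq> \<Lambda> \<Longrightarrow> 0 \<in> S \<Longrightarrow> 1 \<le> phi p S"
  shows "(1 - xit p \<Lambda> 0)\<^sup>2 \<le> xit p \<Lambda> 0 * (real deg * (\<Sum>x\<in>V. bprob p (edges_at \<Lambda>) (\<lambda>A. conn A 0 x)))"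
proof -
  let ?E = "edges_at \<Lambda>" and ?P = "\<lambda>A. exits \<Lambda> A 0"
  let ?T = "\<lambda>A. touched ?E {0} A"
  have finE: "finite ?E" using fin(1) by (rule finite_edges_at)
  have "0 \<le> 1 - xit p \<Lambda> 0" using xit_le_1[OF fin(1) p] by simp
  then have "(1 - xit p \<Lambda> 0)\<^sup>2 \<le> (bexp p ?E (\<lambda>A. of_bool (?P A) * bal p (?T A) (A \<inter> ?T A)))\<^sup>2"
    using pivotal_lower_bound[OF fin(1) p \<open>0 \<in> \<Lambda>\<close> phi] exits_balance_touched[OF fin(1), of p]
    by (intro power_mono) auto
  also have "\<dots> \<le> bexp p ?E (\<lambda>A. (of_bool (?P A))\<^sup>2) * bexp p ?E (\<lambda>A. (bal p (?T A) (A \<inter> ?T A))\<^sup>2)"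
    by (rule bexp_Cauchy_Schwarz[OF p])
  also have "\<dots> \<le> xit p \<Lambda> 0 * (real deg * (\<Sum>x\<in>V. bprob p ?E (\<lambda>A. conn A 0 x)))"
  proof (rule mult_mono)
    show "bexp p ?E (\<lambda>A. (of_bool (?P A))\<^sup>2) \<le> xit p \<Lambda> 0"
      unfolding xit_def by (simp add: power2_eq_square of_bool_conj[symmetric])
    have "bexp p ?E (\<lambda>A. (bal p (?T A) (A \<inter> ?T A))\<^sup>2) \<le> bexp p ?E (\<lambda>A. real (card (?T A)))"
      by (rule exploration_variance[OF finE p])
    also have "\<dots> \<le> bexp p ?E (\<lambda>A. \<Sum>x\<in>V. real deg * of_bool (conn A 0 x))"
    proof (intro bexp_mono p)
      fix A assume A: "A \<subseteq> ?E"
      have "?T A \<subseteq> (\<Union>x\<in>{x \<in> V. conn A 0 x}. {e \<in> G. x \<in> e})"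
        using fin(3) edges_at_subset[of \<Lambda>] by (fastforce simp: touched_def)
      then have "card (?T A) \<le> card (\<Union>x\<in>{x \<in> V. conn A 0 x}. {e \<in> G. x \<in> e})"
        using fin finite_star by (intro card_mono) auto
      also have "\<dots> \<le> (\<Sum>x\<in>{x \<in> V. conn A 0 x}. card {e \<in> G. x \<in> e})"
        using fin by (intro card_UN_le) auto
      also have "\<dots> \<le> (\<Sum>x\<in>{x \<in> V. conn A 0 x}. deg)"
        by (intro sum_mono card_star)
      finally have "real (card (?T A)) \<le> real (\<Sum>x\<in>{x \<in> V. conn A 0 x}. deg)"
        by (simp only: of_nat_le_iff)
      also have "\<dots> = (\<Sum>x\<in>{x \<in> V. conn A 0 x}. real deg)" by simp
      also have "\<dots> = (\<Sum>x\<in>V. real deg * of_bool (conn A 0 x))"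
        using fin by (intro sum.mono_neutral_cong_left) auto
      finally show "real (card (?T A)) \<le> (\<Sum>x\<in>V. real deg * of_bool (conn A 0 x))" .
    qed
    also have "\<dots> = real deg * (\<Sum>x\<in>V. bprob p ?E (\<lambda>A. conn A 0 x))"
      by (simp add: bexp_sum bexp_cmult sum_distrib_left)
    finally show "bexp p ?E (\<lambda>A. (bal p (?T A) (A \<inter> ?T A))\<^sup>2) \<le> \<dots>" .
  qed (auto intro!: xit_nonneg bexp_nonneg p)
  finally show ?thesis .
qed

text \<open>A connection between 0 and \<open>x\<close> leaves both \<open>S\<close> and
  \<open>S'\<close>, and these two exits depend on disjoint sets of edges.\<close>

lemma two_point_bound:
  assumes fin: "finite \<Lambda>" "finite S" "finite S'" and p: "0 \<le> p" "p \<le> 1"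
    and "x \<notin> S" "0 \<notin> S'" "edges_at S \<inter> edges_at S' = {}"
  shows "bprob p (edges_at \<Lambda>) (\<lambda>A. conn A 0 x) \<le> xit p S 0 * xit p S' x"
proof -
  let ?F = "edges_at \<Lambda> \<union> edges_at S \<union> edges_at S'"
  have finF: "finite ?F" using fin finite_edges_at by auto
  have "bprob p (edges_at \<Lambda>) (\<lambda>A. conn A 0 x) = bprob p ?F (\<lambda>A. conn (A \<inter> edges_at \<Lambda>) 0 x)"
    by (rule bexp_marginal[OF finF, symmetric]) auto
  also have "\<dots> \<le> bprob p ?F (\<lambda>A. exits S (A \<inter> edges_at S) 0 \<and> exits S' (A \<inter> edges_at S') x)"
  proof (intro bprob_mono p conjI)
    fix A assume A: "A \<subseteq> ?F" "conn (A \<inter> edges_at \<Lambda>) 0 x"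
    have "A \<subseteq> G" using A edges_at_subset by blast
    have c: "conn A 0 x" using A(2) by (rule conn_mono[rotated]) auto
    then show "exits S (A \<inter> edges_at S) 0"
      using assms by (intro exits_first[OF _ \<open>A \<subseteq> G\<close>]) (auto simp: exits_def)
    show "exits S' (A \<inter> edges_at S') x"
      using assms conn_sym[OF c] by (intro exits_first[OF _ \<open>A \<subseteq> G\<close>]) (auto simp: exits_def)
  qed
  also have "\<dots> = xit p S 0 * xit p S' x"
    unfolding xit_def using assms by (intro bprob_indep finF) auto
  finally show ?thesis .
qed

end

subsection \<open>Planar duality\<close>

definition hor :: "int \<Rightarrow> int \<Rightarrow> (int \<times> int) set" where
  "hor x y = {(x, y), (x + 1, y)}"

definition ver :: "int \<Rightarrow> int \<Rightarrow> (int \<times> int) set" where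
  "ver x y = {(x, y), (x, y + 1)}"

definition sq_edges :: "(int \<times> int) set set" where
  "sq_edges = {hor x y | x y. True} \<union> {ver x y | x y. True}"

lemma sq_edgesE:
  assumes "e \<in> sq_edges"
  obtains x y where "e = hor x y" | x y where "e = ver x y"
  using assms by (auto simp: sq_edges_def)

lemma hor_in_sq_edges [simp, intro]: "hor x y \<in> sq_edges"
  and ver_in_sq_edges [simp, intro]: "ver x y \<in> sq_edges"
  by (auto simp: sq_edges_def)

lemma hor_eq_iff [simp]: "hor x y = hor x' y' \<longleftrightarrow> x = x' \<and> y = y'"
  by (auto simp: hor_def doubleton_eq_iff)

lemma ver_eq_iff [simp]: "ver x y = ver x' y' \<longleftrightarrow> x = x' \<and> y = y'"
  by (auto simp: ver_def doubleton_eq_iff)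

lemma hor_neq_ver [simp]: "hor x y \<noteq> ver x' y'" "ver x' y' \<noteq> hor x y"
  by (auto simp: ver_def hor_def doubleton_eq_iff)

lemma translate_hor: "(+) (s, t) ` hor x y = hor (s + x) (t + y)"
  and translate_ver: "(+) (s, t) ` ver x y = ver (s + x) (t + y)"
  by (simp_all add: hor_def ver_def add.assoc)

interpretation sq: translation_graph sq_edges
proof
  fix e :: "(int \<times> int) set" and t :: "int \<times> int" assume e: "e \<in> sq_edges"
  then show "\<exists>a b. a \<noteq> b \<and> e = {a, b}"
    by (elim sq_edgesE) (auto simp: hor_def ver_def intro!: exI)
  obtain s u where t: "t = (s, u)" by (cases t)
  show "(+) t ` e \<in> sq_edges"
    using e by (elim sq_edgesE) (simp_all add: t translate_hor translate_ver)
next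
  have "{e \<in> sq_edges. 0 \<in> e} \<subseteq> {hor 0 0, hor (-1) 0, ver 0 0, ver 0 (-1)}"
  proof
    fix e :: "(int \<times> int) set" assume e: "e \<in> {e \<in> sq_edges. 0 \<in> e}"
    then have "e \<in> sq_edges" by simp
    then show "e \<in> {hor 0 0, hor (-1) 0, ver 0 0, ver 0 (-1)}"
    proof (elim sq_edgesE)
      fix x y assume *: "e = hor x y"
      then have "y = 0" "x = 0 \<or> x = -1" using e by (auto simp: hor_def zero_prod_def)
      then show ?thesis using * by auto
    next
      fix x y assume *: "e = ver x y"
      then have "x = 0" "y = 0 \<or> y = -1" using e by (auto simp: ver_def zero_prod_def)
      then show ?thesis using * by auto
    qed
  qed
  then show "finite {e \<in> sq_edges. 0 \<in> e}" by (rule finite_subset) simp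
qed

text \<open>The inequalities are strict, so a path from inside first leaves \<open>ibox n\<close> at
  sup-norm exactly \<open>n\<close>. In particular \<open>ibox 0\<close> is empty and its exit
  probability is 1.\<close>

definition ibox :: "nat \<Rightarrow> (int \<times> int) set" where
  "ibox n = {- int n<..<int n} \<times> {- int n<..<int n}"

lemma mem_ibox [simp]: "(x, y) \<in> ibox n \<longleftrightarrow> \<bar>x\<bar> < int n \<and> \<bar>y\<bar> < int n"
  by (auto simp: ibox_def)

lemma finite_ibox [simp]: "finite (ibox n)"
  by (simp add: ibox_def)

lemma ibox_mono: "m \<le> n \<Longrightarrow> ibox m \<subseteq> ibox n"
  by (auto simp: ibox_def)

lemma ibox_mono': "m \<le> n \<Longrightarrow> v \<in> ibox m \<Longrightarrow> v \<in> ibox n"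
  using ibox_mono by blast

definition crosses :: "'a set \<Rightarrow> 'a set \<Rightarrow> bool" where
  "crosses S e \<longleftrightarrow> e \<inter> S \<noteq> {} \<and> \<not> e \<subseteq> S"

lemma crosses_pair: "crosses S {a, b} \<longleftrightarrow> (a \<in> S) \<noteq> (b \<in> S)"
  by (auto simp: crosses_def)

text \<open>\<open>H\<close> is the path as a chain modulo 2, the set of edges used an odd number of
  times; appending a step takes the symmetric difference with one edge. The planar argument works
  with parities of crossings, so no simple path is extracted.\<close>

lemma conn_chain:
  assumes "conn A u w"
  shows "\<exists>H\<subseteq>A. finite H \<and> (\<forall>S. odd (card {e \<in> H. crosses S e}) \<longleftrightarrow> (u \<in> S) \<noteq> (w \<in> S))"
  using assms
proof (induction rule: conn_induct)
  case refl
  show ?case by (rule exI[of _ "{}"]) simp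
next
  case (step y z)
  then obtain H where H: "H \<subseteq> A" "finite H"
    "\<And>S. odd (card {e \<in> H. crosses S e}) \<longleftrightarrow> (u \<in> S) \<noteq> (y \<in> S)" by blast
  let ?e = "{y, z}"
  define H' where "H' = (if ?e \<in> H then H - {?e} else insert ?e H)"
  have "odd (card {e \<in> H'. crosses S e}) \<longleftrightarrow> (u \<in> S) \<noteq> (z \<in> S)" for S
  proof (cases "crosses S ?e")
    case False
    then have "{e \<in> H'. crosses S e} = {e \<in> H. crosses S e}" by (auto simp: H'_def)
    then show ?thesis using H(3)[of S] False by (simp add: crosses_pair)
  next
    case cr: True
    have "odd (card {e \<in> H'. crosses S e}) \<longleftrightarrow> \<not> odd (card {e \<in> H. crosses S e})"
    proof (cases "?e \<in> H")
      case True
      then have "{e \<in> H. crosses S e} = insert ?e {e \<in> H'. crosses S e}" "?e \<notin> {e \<in> H'. crosses S e}"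
        using cr by (auto simp: H'_def)
      moreover have "finite {e \<in> H'. crosses S e}" using H(2) by (simp add: H'_def)
      ultimately show ?thesis by simp
    next
      case False
      then have "{e \<in> H'. crosses S e} = insert ?e {e \<in> H. crosses S e}" "?e \<notin> {e \<in> H. crosses S e}"
        using cr by (auto simp: H'_def)
      moreover have "finite {e \<in> H. crosses S e}" using H(2) by simp
      ultimately show ?thesis by simp
    qed
    then show ?thesis using H(3)[of S] cr by (auto simp: crosses_pair)
  qed
  moreover have "H' \<subseteq> A" "finite H'" using H step(2) by (auto simp: H'_def)
  ultimately show ?case by blast
qed

text \<open>The dual lattice is identified with \<open>\<int>\<^sup>2\<close>: the vertex \<open>(a, b)\<close> stands for the unit face whose
  lower left corner is \<open>(a, b)\<close>, and the dual of an edge joins the two faces containing it.\<close>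

definition dual :: "(int \<times> int) set \<Rightarrow> (int \<times> int) set" where
  "dual e = {f. \<forall>v\<in>e. fst f \<le> fst v \<and> fst v \<le> fst f + 1 \<and> snd f \<le> snd v \<and> snd v \<le> snd f + 1}"

lemma dual_hor: "dual (hor x y) = ver x (y - 1)"
proof (intro set_eqI iffI)
  fix f :: "int \<times> int" assume "f \<in> dual (hor x y)"
  then have "fst f = x" "snd f = y - 1 \<or> snd f = y" by (auto simp: dual_def hor_def)
  then show "f \<in> ver x (y - 1)" by (cases f) (auto simp: ver_def)
qed (auto simp: dual_def hor_def ver_def)

lemma dual_ver: "dual (ver x y) = hor (x - 1) y"
proof (intro set_eqI iffI)
  fix f :: "int \<times> int" assume "f \<in> dual (ver x y)"
  then have "snd f = y" "fst f = x - 1 \<or> fst f = x" by (auto simp: dual_def ver_def)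
  then show "f \<in> hor (x - 1) y" by (cases f) (auto simp: hor_def)
qed (auto simp: dual_def hor_def ver_def)

lemma dual_in_sq_edges: "e \<in> sq_edges \<Longrightarrow> dual e \<in> sq_edges"
  by (elim sq_edgesE) (simp_all add: dual_hor dual_ver)

lemma inj_on_dual: "inj_on dual sq_edges"
  by (rule inj_onI; elim sq_edgesE) (auto simp: dual_hor dual_ver)

lemma dual_surj:
  assumes "e \<in> sq_edges"
  obtains e' where "e' \<in> sq_edges" "e = dual e'"
  using assms
proof (elim sq_edgesE)
  fix x y assume "e = hor x y"
  then show thesis using that[of "ver (x + 1) y"] by (simp add: dual_ver)
next
  fix x y assume "e = ver x y"
  then show thesis using that[of "hor x (y + 1)"] by (simp add: dual_hor)
qed

text \<open>The boundary of the downward ray from \<open>(x, y)\<close> consists of the horizontal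
  edges at or below the faces \<open>(x - 1, y)\<close> and \<open>(x, y)\<close> and of the one
  edge between these two faces.\<close>

lemma crosses_column:
  assumes "e \<in> sq_edges"
  shows "crosses {(x', y'). x' = x \<and> y' \<le> y} e \<longleftrightarrow>
    (\<exists>y'\<le>y. e = hor (x - 1) y') \<or> (\<exists>y'\<le>y. e = hor x y') \<or> e = ver x y"
  using assms
proof (elim sq_edgesE)
  fix a b assume e: "e = hor a b"
  have "crosses {(x', y'). x' = x \<and> y' \<le> y} (hor a b) \<longleftrightarrow> b \<le> y \<and> (a = x - 1 \<or> a = x)"
    unfolding hor_def crosses_pair by auto
  then show ?thesis by (auto simp: e)
next
  fix a b assume e: "e = ver a b"
  have "crosses {(x', y'). x' = x \<and> y' \<le> y} (ver a b) \<longleftrightarrow> a = x \<and> b = y"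
    unfolding ver_def crosses_pair by auto
  then show ?thesis by (auto simp: e)
qed

lemma crosses_half_plane:
  assumes "e \<in> sq_edges"
  shows "crosses {(x', y' :: int). x' \<le> x} e \<longleftrightarrow> (\<exists>y. e = hor x y)"
  using assms
proof (elim sq_edgesE)
  fix a b assume e: "e = hor a b"
  have "crosses {(x', y' :: int). x' \<le> x} (hor a b) \<longleftrightarrow> a = x"
    unfolding hor_def crosses_pair by auto
  then show ?thesis by (auto simp: e)
next
  fix a b assume e: "e = ver a b"
  have "\<not> crosses {(x', y' :: int). x' \<le> x} (ver a b)"
    unfolding ver_def crosses_pair by auto
  then show ?thesis by (auto simp: e)
qed

text \<open>The parity of the number of horizontal steps of the open path below a face is constant along
  the dual path.\<close>

lemma no_crossing_paths:
  assumes A: "A \<subseteq> sq_edges" and B: "B \<subseteq> sq_edges" and AB: "A \<inter> B = {}"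
    and uw: "conn A u w" and fg: "conn (dual ` B) f g"
    and verB: "\<And>x y. ver x y \<in> B \<Longrightarrow> x \<noteq> fst u \<and> x \<noteq> fst w"
    and horA: "\<And>x y. hor x y \<in> A \<Longrightarrow> snd f < y \<and> y \<le> snd g"
    and g: "fst u \<le> fst g" "fst g < fst w"
  shows False
proof -
  obtain H where H: "H \<subseteq> A" "finite H"
    "\<And>S. odd (card {e \<in> H. crosses S e}) \<longleftrightarrow> (u \<in> S) \<noteq> (w \<in> S)"
    using conn_chain[OF uw] by blast
  define below where "below = (\<lambda>a b. {e \<in> H. \<exists>y\<le>b. e = hor a y})"
  define N where "N = (\<lambda>f. odd (card (below (fst f) (snd f))))"
  have finb: "finite (below a b)" for a b using H(2) by (simp add: below_def)
  \<comment> \<open>The ray from \<open>(x, y)\<close> downwards contains neither end of the open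
    path, so the chain crosses its boundary an even number of times; the edge between the two faces
    lies in \<open>B\<close> and does not contribute.\<close>
  have N_hor: "N (x - 1, y) = N (x, y)" if "ver x y \<in> B" for x y
  proof -
    let ?S = "{(x', y'). x' = x \<and> y' \<le> y}"
    have "ver x y \<notin> H" using that AB H(1) by blast
    have "crosses ?S e \<longleftrightarrow> (\<exists>y'\<le>y. e = hor (x - 1) y') \<or> (\<exists>y'\<le>y. e = hor x y')" if "e \<in> H" for e
    proof -
      have "e \<in> sq_edges" using that H(1) A by blast
      then show ?thesis using crosses_column[of e x y] \<open>ver x y \<notin> H\<close> that by blast
    qed
    then have "{e \<in> H. crosses ?S e} = below (x - 1) y \<union> below x y"
      unfolding below_def by blast
    moreover have "below (x - 1) y \<inter> below x y = {}" by (auto simp: below_def)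
    ultimately have "card {e \<in> H. crosses ?S e} = card (below (x - 1) y) + card (below x y)"
      using finb by (simp add: card_Un_disjoint)
    moreover have "u \<notin> ?S" "w \<notin> ?S" using verB[OF that] by auto
    ultimately show ?thesis using H(3)[of ?S] by (auto simp: N_def)
  qed
  have N_ver: "N (x, y - 1) = N (x, y)" if "hor x y \<in> B" for x y
  proof -
    have "hor x y \<notin> H" using that AB H(1) by blast
    then have "below x (y - 1) = below x y"
      by (auto simp: below_def) (metis linorder_not_less order_le_less zle_diff1_eq)
    then show ?thesis by (simp add: N_def)
  qed
  have "N g = N f"
    using fg
  proof (induction rule: conn_induct)
    case (step a b)
    then obtain e where e: "e \<in> B" "{a, b} = dual e" by auto
    then have "e \<in> sq_edges" using B by blast
    then have "N a = N b"
    proof (elim sq_edgesE)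
      fix x y assume *: "e = hor x y"
      then have "{a, b} = {(x, y - 1), (x, y)}" using e by (simp add: dual_hor ver_def)
      then show ?thesis using N_ver[of x y] e * by (auto simp: doubleton_eq_iff)
    next
      fix x y assume *: "e = ver x y"
      then have "{a, b} = {(x - 1, y), (x, y)}" using e by (simp add: dual_ver hor_def)
      then show ?thesis using N_hor[of x y] e * by (auto simp: doubleton_eq_iff)
    qed
    then show ?case using step by simp
  qed simp
  moreover have "below (fst f) (snd f) = {}"
    using horA H(1) by (force simp: below_def)
  then have "\<not> N f" by (simp add: N_def)
  \<comment> \<open>In the column of \<open>g\<close> all horizontal edges of the path lie at or
    below \<open>g\<close>, so the parity is that of the crossings of a vertical line separating
    \<open>u\<close> from \<open>w\<close>.\<close>
  moreover have "N g"
  proof -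
    let ?S = "{(x', y' :: int). x' \<le> fst g}"
    have "{e \<in> H. crosses ?S e} = {e \<in> H. \<exists>y. e = hor (fst g) y}"
      using H(1) A crosses_half_plane by blast
    also have "\<dots> = below (fst g) (snd g)"
      using horA H(1) by (force simp: below_def)
    finally have "odd (card (below (fst g) (snd g))) \<longleftrightarrow> (u \<in> ?S) \<noteq> (w \<in> ?S)"
      using H(3)[of ?S] by simp
    then show ?thesis using g by (cases u; cases w) (auto simp: N_def)
  qed
  ultimately show False by simp
qed

lemma ibox_connected:
  assumes "v \<in> ibox k" "w \<in> ibox k"
  shows "conn (inside (ibox k) sq_edges) v w"
proof -
  let ?A = "inside (ibox k) sq_edges"
  have h: "conn ?A (x, y) (x + int n, y)" if "(x, y) \<in> ibox k" "(x + int n, y) \<in> ibox k" for x y n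
    using that
  proof (induction n)
    case (Suc n)
    have "(x + int n, y) \<in> ibox k" using Suc.prems by auto
    moreover have "{(x + int n, y), (x + int (Suc n), y)} = hor (x + int n) y"
      by (simp add: hor_def algebra_simps)
    moreover have "hor (x + int n) y \<subseteq> ibox k"
      using Suc.prems by (auto simp: hor_def)
    ultimately have "{(x + int n, y), (x + int (Suc n), y)} \<in> ?A"
      by (simp add: inside_def)
    then show ?case using conn_step[OF Suc.IH] Suc.prems \<open>(x + int n, y) \<in> ibox k\<close> by blast
  qed simp
  have v: "conn ?A (x, y) (x, y + int n)" if "(x, y) \<in> ibox k" "(x, y + int n) \<in> ibox k" for x y n
    using that
  proof (induction n)
    case (Suc n)
    have "(x, y + int n) \<in> ibox k" using Suc.prems by auto
    moreover have "{(x, y + int n), (x, y + int (Suc n))} = ver x (y + int n)"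
      by (simp add: ver_def algebra_simps)
    moreover have "ver x (y + int n) \<subseteq> ibox k"
      using Suc.prems by (auto simp: ver_def)
    ultimately have "{(x, y + int n), (x, y + int (Suc n))} \<in> ?A"
      by (simp add: inside_def)
    then show ?case using conn_step[OF Suc.IH] Suc.prems \<open>(x, y + int n) \<in> ibox k\<close> by blast
  qed simp
  have h': "conn ?A (x, y) (x', y)" if "(x, y) \<in> ibox k" "(x', y) \<in> ibox k" for x x' y
  proof (cases "x \<le> x'")
    case True
    then show ?thesis using h[of x y "nat (x' - x)"] that by simp
  next
    case False
    then show ?thesis using h[of x' y "nat (x - x')"] that by (simp add: conn_sym)
  qed
  have v': "conn ?A (x, y) (x, y')" if "(x, y) \<in> ibox k" "(x, y') \<in> ibox k" for x y y'
  proof (cases "y \<le> y'")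
    case True
    then show ?thesis using v[of x y "nat (y' - y)"] that by simp
  next
    case False
    then show ?thesis using v[of x y' "nat (y - y')"] that by (simp add: conn_sym)
  qed
  obtain x y x' y' where vw: "v = (x, y)" "w = (x', y')" by (cases v; cases w)
  have "conn ?A (x, y) (x', y)" "conn ?A (x', y) (x', y')"
    using assms vw by (auto intro!: h' v')
  then show ?thesis unfolding vw by (rule conn_trans)
qed

lemma finite_dual_preimage: "finite F \<Longrightarrow> finite {e \<in> sq_edges. dual e \<in> F}"
  using finite_vimage_IntI[of F dual sq_edges] inj_on_dual
  by (simp add: vimage_def Int_def conj_commute)

lemma dual_preimage:
  assumes "F \<subseteq> sq_edges"
  shows "dual ` {e \<in> sq_edges. dual e \<in> F} = F"
proof
  show "F \<subseteq> dual ` {e \<in> sq_edges. dual e \<in> F}"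
  proof
    fix f assume "f \<in> F"
    moreover obtain e where "e \<in> sq_edges" "f = dual e"
      using dual_surj[of f] \<open>f \<in> F\<close> assms by blast
    ultimately show "f \<in> dual ` {e \<in> sq_edges. dual e \<in> F}" by blast
  qed
qed blast

subsection \<open>The Aizenman--Kesten--Newman bound on the square lattice\<close>

lemma card_sym_interval: "card {- int n..int n} = 2 * n + 1"
  unfolding card_atLeastAtMost_int by linarith

lemma card_centered_box: "card ({- int m..int m} \<times> {- int m..int m}) = (2 * m + 1)\<^sup>2"
  by (simp only: card_cartesian_product card_sym_interval power2_eq_square)

lemma card_outer_ibox: "card (sq.outer (ibox n)) \<le> 4 * (2 * n + 1)"
proof -
  let ?I = "{- int n..int n}"
  let ?Z = "{- int n, int n} \<times> ?I \<union> ?I \<times> {- int n, int n}"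
  have "sq.outer (ibox n) \<subseteq> ?Z"
  proof
    fix v assume "v \<in> sq.outer (ibox n)"
    then obtain e where e: "e \<in> sq_edges" "e \<inter> ibox n \<noteq> {}" "v \<in> e" "v \<notin> ibox n"
      by (auto simp: sq.outer_def sq.edges_at_def)
    from e(1) show "v \<in> ?Z"
    proof (elim sq_edgesE)
      fix x y assume "e = hor x y"
      then show ?thesis using e(2-) by (cases v) (auto simp: hor_def)
    next
      fix x y assume "e = ver x y"
      then show ?thesis using e(2-) by (cases v) (auto simp: ver_def)
    qed
  qed
  then have "card (sq.outer (ibox n)) \<le> card ?Z" by (intro card_mono) auto
  also have "\<dots> \<le> card ({- int n, int n} \<times> ?I) + card (?I \<times> {- int n, int n})"
    by (rule card_Un_le)
  also have "\<dots> = 2 * (card {- int n, int n} * (2 * n + 1))"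
    by (simp add: card_cartesian_product card_sym_interval del: card_atLeastAtMost_int)
  also have "\<dots> \<le> 2 * (2 * (2 * n + 1))"
    by (intro mult_le_mono) (auto intro: order.trans[OF card_insert_le_m1])
  finally show ?thesis by simp
qed

lemma card_ibox_le: "card (ibox n) \<le> (2 * n + 1)\<^sup>2"
proof -
  have "card (ibox n) \<le> card ({- int n..int n} \<times> {- int n..int n})"
    by (intro card_mono) (auto simp: ibox_def)
  also have "\<dots> = (2 * n + 1)\<^sup>2"
    by (rule card_centered_box)
  finally show ?thesis .
qed

lemma harm_le_ln: "harm n \<le> 1 + ln (1 + real n)"
proof (cases n)
  case (Suc m)
  have "harm (Suc m) - ln (real (Suc m)) \<le> 1"
    using euler_mascheroni_sequence_decreasing[of 1 "Suc m"] by (simp add: harm_def)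
  moreover have "ln (real (Suc m)) \<le> ln (1 + real (Suc m))" by simp
  ultimately show ?thesis unfolding Suc by linarith
qed (simp add: harm_def)

lemma translate_edge_inj:
  assumes "e \<in> sq_edges" "(+) t ` e = (+) t' ` e"
  shows "t = t'"
  using assms(1)
proof (elim sq_edgesE)
  fix x y assume "e = hor x y"
  then show ?thesis using assms(2) by (cases t; cases t') (simp add: translate_hor)
next
  fix x y assume "e = ver x y"
  then show ?thesis using assms(2) by (cases t; cases t') (simp add: translate_ver)
qed

text \<open>The translates of \<open>e\<close> by \<open>T\<close> are at least
  \<open>N\<^sup>2\<close> distinct edges of \<open>ibox N\<close>, and each of them joins exits of
  \<open>ibox N\<close> with at least the probability that \<open>e\<close> does so for the larger
  \<open>ibox (2 * N)\<close>. The choice \<open>l = sqrt N\<close> makes the surface and the volume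
  term equal in order up to a logarithm.\<close>

lemma joins_exits_average:
  assumes p: "0 \<le> p" "p \<le> 1" and e: "e \<in> sq_edges" "e \<subseteq> ibox k" and k: "2 * k \<le> N" "0 < N"
  shows "p * ((real N)\<^sup>2 * bprob p (sq.edges_at (ibox (2 * N))) (\<lambda>A. sq.joins_exits (ibox (2 * N)) A e))
    \<le> sqrt (real N) / 2 * (4 * (2 * real N + 1) * (1 + ln (1 + real sq.deg * (2 * real N + 1)\<^sup>2))) +
      real sq.deg * (2 * real N + 1)\<^sup>2 / sqrt (real N)"
proof -
  let ?Q = "\<lambda>S e. bprob p (sq.edges_at S) (\<lambda>A. sq.joins_exits S A e)"
  let ?q = "?Q (ibox (2 * N)) e"
  define m where "m = N - k"
  define T where "T = {- int m..int m} \<times> {- int m..int m}"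
  have T: "finite T" "card T = (2 * m + 1)\<^sup>2" by (simp_all add: T_def card_centered_box)
  have q: "?q \<le> ?Q (ibox N) ((+) t ` e)" "(+) t ` e \<in> sq.edges_at (ibox N)" if t: "t \<in> T" for t
  proof -
    have "(+) (- t) ` ibox N \<subseteq> ibox (2 * N)"
      using t k by (cases t) (auto simp: T_def m_def)
    then have "?q \<le> ?Q ((+) (- t) ` ibox N) e"
      by (intro sq.joins_exits_mono_set p) auto
    also have "\<dots> = ?Q ((+) t ` (+) (- t) ` ibox N) ((+) t ` e)"
      by (rule sq.joins_exits_translate[symmetric])
    also have "(+) t ` (+) (- t) ` ibox N = ibox N" by (simp add: image_image)
    finally show "?q \<le> ?Q (ibox N) ((+) t ` e)" .
    have "(+) t ` e \<subseteq> ibox N"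
    proof
      fix v assume "v \<in> (+) t ` e"
      then obtain w where w: "w \<in> e" "v = t + w" by auto
      then have "w \<in> ibox k" using e by blast
      then show "v \<in> ibox N" using t k w(2) by (cases t; cases w) (auto simp: T_def m_def)
    qed
    moreover have "(+) t ` e \<in> sq_edges" using e by (intro sq.translate)
    ultimately show "(+) t ` e \<in> sq.edges_at (ibox N)"
      using sq.inside_subset_edges_at by (auto simp: inside_def)
  qed
  have "(real N)\<^sup>2 * ?q \<le> real (card T) * ?q"
  proof (rule mult_right_mono)
    have "N \<le> 2 * m + 1" using k by (simp add: m_def)
    then have "N\<^sup>2 \<le> card T" unfolding T by (rule power_mono) simp
    then show "(real N)\<^sup>2 \<le> real (card T)" by (metis of_nat_le_iff of_nat_power)
  qed (rule bprob_nonneg[OF p])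
  also have "\<dots> \<le> (\<Sum>t\<in>T. ?Q (ibox N) ((+) t ` e))"
    using sum_mono[of T "\<lambda>_. ?q" "\<lambda>t. ?Q (ibox N) ((+) t ` e)"] q by simp
  also have "\<dots> = (\<Sum>e'\<in>(\<lambda>t. (+) t ` e) ` T. ?Q (ibox N) e')"
    using translate_edge_inj[OF e(1)] by (subst sum.reindex) (auto simp: inj_on_def)
  also have "\<dots> \<le> (\<Sum>e'\<in>sq.edges_at (ibox N). ?Q (ibox N) e')"
    using q by (intro sum_mono2 sq.finite_edges_at bprob_nonneg p) auto
  finally have "p * ((real N)\<^sup>2 * ?q) \<le> p * (\<Sum>e'\<in>sq.edges_at (ibox N). ?Q (ibox N) e')"
    using p by (intro mult_left_mono) auto
  also have "\<dots> \<le> sqrt (real N) / 2 * (real (card (sq.outer (ibox N))) * harm (card (sq.edges_at (ibox N))))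
      + real (card (sq.edges_at (ibox N))) / sqrt (real N)"
    using k by (intro sq.sum_joins_exits_le p) auto
  also have "\<dots> \<le> sqrt (real N) / 2 * (4 * (2 * real N + 1) * (1 + ln (1 + real sq.deg * (2 * real N + 1)\<^sup>2))) +
      real sq.deg * (2 * real N + 1)\<^sup>2 / sqrt (real N)"
  proof -
    have c: "card (sq.edges_at (ibox N)) \<le> sq.deg * (2 * N + 1)\<^sup>2"
      using sq.card_edges_at_le[of "ibox N"] card_ibox_le[of N]
      by (meson finite_ibox le_trans mult_le_mono2)
    then have "real (card (sq.edges_at (ibox N))) \<le> real (sq.deg * (2 * N + 1)\<^sup>2)"
      by (simp only: of_nat_le_iff)
    then have c': "real (card (sq.edges_at (ibox N))) \<le> real sq.deg * (2 * real N + 1)\<^sup>2"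
      by (simp only: of_nat_mult of_nat_power of_nat_add of_nat_1 of_nat_numeral)
    have "harm (card (sq.edges_at (ibox N))) \<le> 1 + ln (1 + real (card (sq.edges_at (ibox N))))"
      by (rule harm_le_ln)
    also have "\<dots> \<le> 1 + ln (1 + real sq.deg * (2 * real N + 1)\<^sup>2)"
      using c' by simp
    finally have h: "harm (card (sq.edges_at (ibox N))) \<le> 1 + ln (1 + real sq.deg * (2 * real N + 1)\<^sup>2)" .
    have o: "real (card (sq.outer (ibox N))) \<le> 4 * (2 * real N + 1)"
    proof -
      have "real (card (sq.outer (ibox N))) \<le> real (4 * (2 * N + 1))"
        using card_outer_ibox[of N] by (simp only: of_nat_le_iff)
      then show ?thesis by simp
    qed
    show ?thesis
      using h o c' by (intro add_mono mult_left_mono mult_mono divide_right_mono) (auto simp: harm_nonneg)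
  qed
  finally show ?thesis .
qed

text \<open>The bound of Aizenman, Kesten and Newman, averaged over the translates of \<open>e\<close> in a smaller box.\<close>

lemma joins_exits_small:
  assumes p: "0 < p" "p \<le> 1" and "c > 0"
  obtains n where "n \<ge> k" "\<And>e. e \<in> sq_edges \<Longrightarrow> e \<subseteq> ibox k \<Longrightarrow>
    bprob p (sq.edges_at (ibox n)) (\<lambda>A. sq.joins_exits (ibox n) A e) < c"
proof -
  \<comment> \<open>\<open>B\<close> is of order at most \<open>ln N / sqrt N\<close>: terms of
    order \<open>N powr (3/2)\<close>, one of them with a logarithm, are divided by
    \<open>N\<^sup>2\<close>.\<close>
  define B where "B = (\<lambda>N. (sqrt N / 2 * (4 * (2 * N + 1) * (1 + ln (1 + real sq.deg * (2 * N + 1)\<^sup>2))) + real sq.deg * (2 * N + 1)\<^sup>2 / sqrt N) / N\<^sup>2 :: real)"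
  have "((\<lambda>N. (sqrt N / 2 * (4 * (2 * N + 1) * (1 + ln (1 + d * (2 * N + 1)\<^sup>2))) + d * (2 * N + 1)\<^sup>2 / sqrt N) / N\<^sup>2 :: real) \<longlongrightarrow> 0) at_top"
    if "d > 0" for d :: real
    using that by real_asymp
  moreover have "((\<lambda>N. (sqrt N / 2 * (4 * (2 * N + 1) * (1 + ln (1 + 0 * (2 * N + 1)\<^sup>2))) + 0 * (2 * N + 1)\<^sup>2 / sqrt N) / N\<^sup>2 :: real) \<longlongrightarrow> 0) at_top"
    by real_asymp
  ultimately have "(B \<longlongrightarrow> 0) at_top"
    unfolding B_def by (cases "sq.deg = 0") auto
  then have "((\<lambda>N. B (real N)) \<longlongrightarrow> 0) sequentially"
    by (rule filterlim_compose[OF _ filterlim_real_sequentially])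
  then have "\<forall>\<^sub>F N in sequentially. B (real N) < c * p"
    using assms by (intro order_tendstoD) auto
  then have "\<forall>\<^sub>F N in sequentially. B (real N) < c * p \<and> 2 * k + 1 \<le> N"
    using eventually_ge_at_top by (intro eventually_conj) auto
  then obtain N where N: "B (real N) < c * p" "2 * k + 1 \<le> N"
    using eventually_happens'[OF sequentially_bot] by blast
  have "bprob p (sq.edges_at (ibox (2 * N))) (\<lambda>A. sq.joins_exits (ibox (2 * N)) A e) < c"
    if e: "e \<in> sq_edges" "e \<subseteq> ibox k" for e
  proof -
    let ?q = "bprob p (sq.edges_at (ibox (2 * N))) (\<lambda>A. sq.joins_exits (ibox (2 * N)) A e)"
    have "p * ((real N)\<^sup>2 * ?q) \<le> sqrt (real N) / 2 * (4 * (2 * real N + 1) * (1 + ln (1 + real sq.deg * (2 * real N + 1)\<^sup>2))) +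
        real sq.deg * (2 * real N + 1)\<^sup>2 / sqrt (real N)"
      using p N e by (intro joins_exits_average[of p e k N]) auto
    also have "\<dots> = B (real N) * (real N)\<^sup>2"
      using N by (simp add: B_def)
    also have "\<dots> < c * p * (real N)\<^sup>2"
      using N by (intro mult_strict_right_mono) auto
    finally have "(p * (real N)\<^sup>2) * ?q < (p * (real N)\<^sup>2) * c"
      by (simp add: mult_ac)
    then show ?thesis using p N by (simp add: mult_less_cancel_left)
  qed
  then show ?thesis using that[of "2 * N"] N by auto
qed

lemma ibox_translate_subset:
  assumes "\<bar>fst t\<bar> \<le> int k" "\<bar>snd t\<bar> \<le> int k"
  shows "(+) t ` ibox m \<subseteq> ibox (m + k)" "ibox m \<subseteq> (+) t ` ibox (m + k)"
proof -
  show "(+) t ` ibox m \<subseteq> ibox (m + k)" using assms by (cases t) auto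
  show "ibox m \<subseteq> (+) t ` ibox (m + k)"
  proof
    fix v assume "v \<in> ibox m"
    then have "- t + v \<in> ibox (m + k)" using assms by (cases t; cases v) auto
    then have "t + (- t + v) \<in> (+) t ` ibox (m + k)" by blast
    then show "v \<in> (+) t ` ibox (m + k)" by simp
  qed
qed

text \<open>Second moment method over far apart points.\<close>

lemma ibox_exits_likely:
  assumes p: "0 \<le> p" "p \<le> 1" and \<theta>: "\<theta> > 0" "\<And>n. \<theta> \<le> sq.xit p (ibox n) 0" and \<delta>: "\<delta> > 0"
  obtains k where "\<And>n. n \<ge> k \<Longrightarrow>
    bprob p (sq.edges_at (ibox n)) (\<lambda>A. \<not> (\<exists>z\<in>ibox k. exits (ibox n) A z)) \<le> \<delta>"
proof -
  define X where "X = (\<lambda>n. sq.xit p (ibox n) 0)"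
  have dec: "decseq X"
    unfolding X_def by (intro monotoneI sq.xit_mono ibox_mono p) auto
  have bdd: "bdd_below (range X)" using \<theta>(2) by (intro bdd_belowI[of _ \<theta>]) (auto simp: X_def)
  \<comment> \<open>The limit of the decreasing exit probabilities, positive by the hypothesis on
    \<open>\<theta>\<close>; the scale \<open>m\<close> below nearly attains it.\<close>
  define L where "L = (INF n. X n)"
  have lim: "X \<longlonglongrightarrow> L" unfolding L_def by (rule LIMSEQ_decseq_INF[OF bdd dec])
  have L: "L \<le> X n" for n unfolding L_def by (rule cINF_lower[OF bdd]) simp
  have "\<theta> \<le> L" unfolding L_def using \<theta>(2) by (intro cINF_greatest) (auto simp: X_def)
  then have L0: "L > 0" using \<theta>(1) by simp
  have L1: "L \<le> 1" using L[of 0] sq.xit_le_1[OF finite_ibox p, of 0 0] by (simp add: X_def)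
  \<comment> \<open>Chebyshev's inequality will leave the error
    \<open>real M + 3 * \<epsilon> * (real M)\<^sup>2\<close>, which must not exceed
    \<open>\<delta> * (real M * L)\<^sup>2\<close>. The 6 here and the 2 in the choice of
    \<open>M\<close> give each summand one half.\<close>
  define \<epsilon> where "\<epsilon> = min 1 (\<delta> * L\<^sup>2 / 6)"
  have \<epsilon>: "0 < \<epsilon>" "\<epsilon> \<le> 1" "6 * \<epsilon> \<le> \<delta> * L\<^sup>2" using \<delta> L0 by (auto simp: \<epsilon>_def)
  have "\<forall>\<^sub>F m in sequentially. X m < L + \<epsilon>"
    using lim \<epsilon>(1) by (intro order_tendstoD) auto
  then obtain m where m: "X m < L + \<epsilon>"
    using eventually_happens'[OF sequentially_bot] by blast
  obtain M :: nat where M: "2 / (\<delta> * L\<^sup>2) < real M" using reals_Archimedean2 by blast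
  have "0 < 2 / (\<delta> * L\<^sup>2)" using \<delta> L0 by simp
  then have M0: "0 < real M" using M by linarith
  have M': "2 \<le> \<delta> * L\<^sup>2 * real M" using M \<delta> L0 by (simp add: field_simps)
  \<comment> \<open>With spacing \<open>2 * m + 1\<close> no edge meets two of the boxes of radius
    \<open>m\<close> around these points.\<close>
  define x where "x = (\<lambda>j :: nat. (int j * (2 * int m + 1), 0 :: int))"
  define k where "k = M * (2 * m + 1) + m + 1"
  have xk: "\<bar>fst (x j)\<bar> \<le> int (M * (2 * m + 1))" "\<bar>snd (x j)\<bar> \<le> int (M * (2 * m + 1))" if "j < M" for j
  proof -
    have "int j * (2 * int m + 1) \<le> int M * (2 * int m + 1)" using that by (intro mult_right_mono) auto
    moreover have "int (M * (2 * m + 1)) = int M * (2 * int m + 1)" "0 \<le> int j * (2 * int m + 1)"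
      by (simp_all add: algebra_simps)
    moreover have "fst (x j) = int j * (2 * int m + 1)" "snd (x j) = 0" by (simp_all add: x_def)
    ultimately show "\<bar>fst (x j)\<bar> \<le> int (M * (2 * m + 1))" "\<bar>snd (x j)\<bar> \<le> int (M * (2 * m + 1))"
      by linarith+
  qed
  have "bprob p (sq.edges_at (ibox n)) (\<lambda>A. \<not> (\<exists>z\<in>ibox k. exits (ibox n) A z)) \<le> \<delta>" if n: "n \<ge> k" for n
  proof -
    let ?E = "sq.edges_at (ibox n)"
    have finE: "finite ?E" by (simp add: sq.finite_edges_at)
    let ?F = "\<lambda>j A. exits (ibox n) A (x j)"
    define Y where "Y = (\<lambda>A. \<Sum>j<M. of_bool (?F j A) :: real)"
    have F1: "L \<le> bprob p ?E (?F j)" if j: "j < M" for j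
    proof -
      have "L \<le> sq.xit p (ibox (n + M * (2 * m + 1))) 0" using L by (simp add: X_def)
      also have "\<dots> = sq.xit p ((+) (x j) ` ibox (n + M * (2 * m + 1))) (x j)"
        using sq.xit_translate[of p "x j" "ibox (n + M * (2 * m + 1))" 0] by simp
      also have "\<dots> \<le> sq.xit p (ibox n) (x j)"
        by (intro sq.xit_mono ibox_translate_subset xk j p) simp
      finally show ?thesis by (simp add: sq.xit_def)
    qed
    have sub: "(+) (x j) ` ibox m \<subseteq> ibox n" if "j < M" for j
      using ibox_translate_subset(1)[OF xk[OF that], of m] ibox_mono[of "m + M * (2 * m + 1)" n] n
      by (auto simp: k_def)
    \<comment> \<open>Leaving \<open>ibox n\<close> forces leaving the small boxes around both
      points, and those exits are independent with probability below \<open>L + \<epsilon>\<close>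
      each.\<close>
    have F2: "bprob p ?E (\<lambda>A. ?F i A \<and> ?F j A) \<le> (L + \<epsilon>)\<^sup>2" if ij: "i < M" "j < M" "i \<noteq> j" for i j
    proof -
      let ?S = "\<lambda>j. (+) (x j) ` ibox m"
      have disj: "sq.edges_at (?S i) \<inter> sq.edges_at (?S j) = {}"
      proof (rule ccontr)
        assume "sq.edges_at (?S i) \<inter> sq.edges_at (?S j) \<noteq> {}"
        then obtain e where "e \<in> sq.edges_at (?S i)" "e \<in> sq.edges_at (?S j)" by blast
        then have "e \<in> sq_edges" "e \<inter> ?S i \<noteq> {}" "e \<inter> ?S j \<noteq> {}"
          unfolding sq.edges_at_def by blast+
        then obtain a b where e: "e \<in> sq_edges" "a \<in> e" "a \<in> ?S i" "b \<in> e" "b \<in> ?S j"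
          by blast
        have ab: "\<bar>fst a - fst b\<bar> \<le> 1"
          using e(1) by (elim sq_edgesE) (use e(2,4) in \<open>auto simp: hor_def ver_def\<close>)
        define ci cj where "ci = int i * (2 * int m + 1)" and "cj = int j * (2 * int m + 1)"
        have a: "\<bar>fst a - ci\<bar> < int m" and b: "\<bar>fst b - cj\<bar> < int m"
          using e(3,5) by (auto simp: x_def ci_def cj_def)
        have "\<bar>int i - int j\<bar> \<ge> 1" using ij by linarith
        then have "\<bar>int i - int j\<bar> * (2 * int m + 1) \<ge> 1 * (2 * int m + 1)"
          by (intro mult_right_mono) auto
        also have "\<bar>int i - int j\<bar> * (2 * int m + 1) = \<bar>ci - cj\<bar>"
          by (simp add: abs_mult left_diff_distrib[symmetric] ci_def cj_def)
        finally show False using ab a b by (smt (verit))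
      qed
      have subE: "sq.edges_at (?S i) \<subseteq> ?E" "sq.edges_at (?S j) \<subseteq> ?E"
        using sub ij by (auto intro!: sq.edges_at_mono)
      have "bprob p ?E (\<lambda>A. ?F i A \<and> ?F j A) \<le>
          bprob p ?E (\<lambda>A. exits (?S i) (A \<inter> sq.edges_at (?S i)) (x i) \<and> exits (?S j) (A \<inter> sq.edges_at (?S j)) (x j))"
      proof (intro bprob_mono p)
        fix A assume A: "A \<subseteq> ?E" "?F i A \<and> ?F j A"
        then have "A \<subseteq> sq_edges" using sq.edges_at_subset by blast
        then show "exits (?S i) (A \<inter> sq.edges_at (?S i)) (x i) \<and> exits (?S j) (A \<inter> sq.edges_at (?S j)) (x j)"
          using A(2) exits_antimono[OF sub[OF ij(1)], of A "x i"] exits_antimono[OF sub[OF ij(2)], of A "x j"]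
          by (simp add: sq.exits_first)
      qed
      also have "\<dots> = sq.xit p (?S i) (x i) * sq.xit p (?S j) (x j)"
        unfolding sq.xit_def by (rule bprob_indep[OF finE subE disj])
      also have "\<dots> = X m * X m"
        using sq.xit_translate[of p "x i" "ibox m" 0] sq.xit_translate[of p "x j" "ibox m" 0] by (simp add: X_def)
      also have "\<dots> \<le> (L + \<epsilon>) * (L + \<epsilon>)"
        using m L0 L[of m] \<epsilon> by (intro mult_mono) auto
      finally show ?thesis by (simp add: power2_eq_square)
    qed
    have EY: "bexp p ?E Y \<ge> real M * L"
    proof -
      have "real M * L = (\<Sum>j<M. L)" by simp
      also have "\<dots> \<le> (\<Sum>j<M. bprob p ?E (?F j))" by (intro sum_mono F1) auto
      finally show ?thesis by (simp only: Y_def bexp_sum)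
    qed
    have EY2: "bexp p ?E (\<lambda>A. (Y A)\<^sup>2) \<le> real M + (real M)\<^sup>2 * (L + \<epsilon>)\<^sup>2"
    proof -
      have "bexp p ?E (\<lambda>A. (Y A)\<^sup>2) = (\<Sum>i<M. \<Sum>j<M. bprob p ?E (\<lambda>A. ?F i A \<and> ?F j A))"
        by (simp only: Y_def power2_eq_square sum_product bexp_sum of_bool_conj)
      also have "\<dots> \<le> (\<Sum>i<M. \<Sum>j<M. of_bool (i = j) + (L + \<epsilon>)\<^sup>2)"
      proof (intro sum_mono)
        fix i j assume ij: "i \<in> {..<M}" "j \<in> {..<M}"
        have "bprob p ?E (\<lambda>A. ?F i A \<and> ?F j A) \<le> 1" by (rule bprob_le_1[OF p finE])
        then show "bprob p ?E (\<lambda>A. ?F i A \<and> ?F j A) \<le> of_bool (i = j) + (L + \<epsilon>)\<^sup>2"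
          using F2[of i j] ij by (cases "i = j") (auto intro: add_increasing2)
      qed
      also have "\<dots> = real M + (real M)\<^sup>2 * (L + \<epsilon>)\<^sup>2"
        by (simp add: sum.distrib power2_eq_square algebra_simps)
      finally show ?thesis .
    qed
    let ?N = "\<lambda>A. \<not> (\<exists>z\<in>ibox k. exits (ibox n) A z)"
    have "bprob p ?E ?N * (real M * L)\<^sup>2 = bexp p ?E (\<lambda>A. of_bool (?N A) * (real M * L)\<^sup>2)"
      by (simp add: bexp_cmult_right)
    \<comment> \<open>On the event in question \<open>Y\<close> vanishes, so its squared deviation
      from \<open>real M * L\<close> is \<open>(real M * L)\<^sup>2\<close>.\<close>
    also have "\<dots> \<le> bexp p ?E (\<lambda>A. (Y A)\<^sup>2 - (2 * (real M * L)) * Y A + (real M * L)\<^sup>2)"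
    proof (intro bexp_mono p)
      fix A
      have "(Y A)\<^sup>2 - (2 * (real M * L)) * Y A + (real M * L)\<^sup>2 = (Y A - real M * L)\<^sup>2"
        by (simp add: power2_eq_square algebra_simps)
      moreover have "Y A = 0" if "?N A"
      proof -
        have "x j \<in> ibox k" if "j < M" for j
          using xk[OF that] by (cases "x j") (auto simp: k_def)
        then show ?thesis using that unfolding Y_def by (intro sum.neutral) auto
      qed
      ultimately show "of_bool (?N A) * (real M * L)\<^sup>2 \<le> (Y A)\<^sup>2 - (2 * (real M * L)) * Y A + (real M * L)\<^sup>2"
        by (cases "?N A") auto
    qed
    also have "\<dots> = bexp p ?E (\<lambda>A. (Y A)\<^sup>2) - 2 * (real M * L) * bexp p ?E Y + (real M * L)\<^sup>2"
      using finE by (simp only: bexp_add bexp_diff bexp_cmult bexp_const)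
    also have "\<dots> \<le> (real M + (real M)\<^sup>2 * (L + \<epsilon>)\<^sup>2) - 2 * (real M * L) * (real M * L) + (real M * L)\<^sup>2"
      using EY EY2 M0 L0 by (intro add_mono diff_mono mult_left_mono) auto
    also have "\<dots> = real M + (real M)\<^sup>2 * (\<epsilon> * (2 * L + \<epsilon>))"
      by (simp add: power2_eq_square algebra_simps)
    also have "\<dots> \<le> real M + (real M)\<^sup>2 * (\<epsilon> * 3)"
      using \<epsilon> L1 by (intro add_mono mult_left_mono) auto
    also have "\<dots> \<le> \<delta> * (real M * L)\<^sup>2"
    proof -
      have "2 * real M \<le> \<delta> * L\<^sup>2 * real M * real M" using M' M0 by (intro mult_right_mono) auto
      moreover have "(real M)\<^sup>2 * (6 * \<epsilon>) \<le> (real M)\<^sup>2 * (\<delta> * L\<^sup>2)" using \<epsilon> by (intro mult_left_mono) auto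
      ultimately show ?thesis by (simp add: power2_eq_square algebra_simps)
    qed
    finally show ?thesis using M0 L0 by simp
  qed
  then show ?thesis by (rule that)
qed

subsection \<open>Harris' theorem\<close>

definition rot :: "int \<times> int \<Rightarrow> int \<times> int" where
  "rot v = (- snd v, fst v)"

lemma inj_rot: "inj rot"
  by (auto simp: inj_on_def rot_def prod_eq_iff)

lemma rot_mem_iff: "v \<in> rot ` S \<longleftrightarrow> (snd v, - fst v) \<in> S"
proof
  assume "(snd v, - fst v) \<in> S"
  moreover have "v = rot (snd v, - fst v)" by (simp add: rot_def)
  ultimately show "v \<in> rot ` S" by blast
qed (auto simp: rot_def)

lemma rot_ibox: "rot ` ibox n = ibox n"
proof (rule set_eqI)
  fix v show "v \<in> rot ` ibox n \<longleftrightarrow> v \<in> ibox n"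
    unfolding rot_mem_iff by (cases v) auto
qed

lemma rot_hor: "rot ` hor x y = ver (- y) x"
  and rot_ver: "rot ` ver x y = hor (- y - 1) x"
  by (auto simp: hor_def ver_def rot_def)

lemma rot_sq_edges: "(`) rot ` sq_edges = sq_edges"
proof
  show "(`) rot ` sq_edges \<subseteq> sq_edges"
    by (auto elim!: sq_edgesE simp: rot_hor rot_ver)
  show "sq_edges \<subseteq> (`) rot ` sq_edges"
  proof
    fix e assume "e \<in> sq_edges"
    then show "e \<in> (`) rot ` sq_edges"
    proof (elim sq_edgesE)
      fix x y assume "e = hor x y"
      then have "e = rot ` ver y (- x - 1)" by (simp add: rot_ver)
      then show ?thesis by (rule image_eqI) simp
    next
      fix x y assume "e = ver x y"
      then have "e = rot ` hor y (- x)" by (simp add: rot_hor)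
      then show ?thesis by (rule image_eqI) simp
    qed
  qed
qed

lemma rot_edges_at_ibox: "(`) rot ` sq.edges_at (ibox n) = sq.edges_at (ibox n)"
proof -
  have "(`) rot ` sq.edges_at (ibox n) = {e \<in> (`) rot ` sq_edges. e \<inter> rot ` ibox n \<noteq> {}}"
    unfolding sq.edges_at_def using image_Int[OF inj_rot] by (auto intro!: imageI)
  then show ?thesis unfolding rot_sq_edges rot_ibox by (simp add: sq.edges_at_def)
qed

definition hits :: "nat \<Rightarrow> (int \<times> int) set \<Rightarrow> (int \<times> int) set set \<Rightarrow> bool" where
  "hits k T A \<longleftrightarrow> (\<exists>z\<in>ibox k. \<exists>v\<in>T. conn A z v)"

lemma hits_mono: "A \<subseteq> B \<Longrightarrow> hits k T A \<Longrightarrow> hits k T B"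
  using conn_mono[of A B] by (fastforce simp: hits_def)

lemma hits_rot: "hits k (rot ` T) ((`) rot ` A) \<longleftrightarrow> hits k T A"
proof -
  have "hits k (rot ` T) ((`) rot ` A) \<longleftrightarrow> (\<exists>z\<in>rot ` ibox k. \<exists>v\<in>rot ` T. conn ((`) rot ` A) z v)"
    by (simp add: hits_def rot_ibox)
  then show ?thesis by (simp add: hits_def conn_image_iff[OF inj_rot])
qed

lemma bprob_hits_rot:
  "bprob p (sq.edges_at (ibox n)) (hits k (rot ` T)) = bprob p (sq.edges_at (ibox n)) (hits k T)"
proof -
  have "inj_on ((`) rot) (sq.edges_at (ibox n))" using inj_rot by (intro inj_on_image) (auto intro: inj_on_subset)
  then have "bprob p ((`) rot ` sq.edges_at (ibox n)) (hits k (rot ` T)) = bprob p (sq.edges_at (ibox n)) (hits k T)"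
    by (simp add: bexp_image hits_rot)
  then show ?thesis by (simp add: rot_edges_at_ibox)
qed

text \<open>Corners are left out of the sides, as no edge joins a corner to the open box.\<close>

definition side_right :: "nat \<Rightarrow> (int \<times> int) set" where
  "side_right n = {(x, y). x = int n \<and> \<bar>y\<bar> < int n}"
definition side_top :: "nat \<Rightarrow> (int \<times> int) set" where
  "side_top n = {(x, y). y = int n \<and> \<bar>x\<bar> < int n}"
definition side_left :: "nat \<Rightarrow> (int \<times> int) set" where
  "side_left n = {(x, y). x = - int n \<and> \<bar>y\<bar> < int n}"
definition side_bottom :: "nat \<Rightarrow> (int \<times> int) set" where
  "side_bottom n = {(x, y). y = - int n \<and> \<bar>x\<bar> < int n}"

lemmas side_defs = side_right_def side_top_def side_left_def side_bottom_def

lemma rot_sides: "rot ` side_right n = side_top n" "rot ` side_top n = side_left n"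
    "rot ` side_left n = side_bottom n"
proof -
  show "rot ` side_right n = side_top n" by (rule set_eqI, unfold rot_mem_iff side_defs, auto)
  show "rot ` side_top n = side_left n" by (rule set_eqI, unfold rot_mem_iff side_defs, auto)
  show "rot ` side_left n = side_bottom n" by (rule set_eqI, unfold rot_mem_iff side_defs, auto)
qed

lemma exits_hits_side:
  assumes A: "A \<subseteq> sq.edges_at (ibox n)" and z: "z \<in> ibox k" "k \<le> n" and ex: "exits (ibox n) A z"
  shows "hits k (side_right n) A \<or> hits k (side_top n) A \<or> hits k (side_left n) A \<or> hits k (side_bottom n) A"
proof -
  obtain v where v: "v \<notin> ibox n" "conn A z v" using ex unfolding exits_def by blast
  have "z \<noteq> v" using v z ibox_mono' by blast
  then obtain e where "e \<in> A" "v \<in> e" using conn_in_edge[OF v(2)] by blast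
  then have e: "e \<in> sq_edges" "e \<inter> ibox n \<noteq> {}" "v \<in> e" using A by (auto simp: sq.edges_at_def)
  have "v \<in> side_right n \<or> v \<in> side_top n \<or> v \<in> side_left n \<or> v \<in> side_bottom n"
    using e(1)
  proof (elim sq_edgesE)
    fix x y assume "e = hor x y"
    then show ?thesis using e(2,3) v(1) by (cases v) (auto simp: hor_def side_defs)
  next
    fix x y assume "e = ver x y"
    then show ?thesis using e(2,3) v(1) by (cases v) (auto simp: ver_def side_defs)
  qed
  then show ?thesis using v(2) z unfolding hits_def by blast
qed

text \<open>The square root trick, with the fourfold symmetry of the box.\<close>

lemma hits_sides_likely:
  assumes p: "0 \<le> p" "p \<le> 1" and "k \<le> n"
    and small: "bprob p (sq.edges_at (ibox n)) (\<lambda>A. \<not> (\<exists>z\<in>ibox k. exits (ibox n) A z)) \<le> (1/8) ^ 4"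
    and T: "T \<in> {side_right n, side_top n, side_left n, side_bottom n}"
  shows "bprob p (sq.edges_at (ibox n)) (\<lambda>A. \<not> hits k T A) \<le> 1/8"
proof -
  let ?E = "sq.edges_at (ibox n)"
  have finE: "finite ?E" by (simp add: sq.finite_edges_at)
  define u where "u = bprob p ?E (\<lambda>A. \<not> hits k (side_right n) A)"
  have u0: "0 \<le> u" unfolding u_def by (rule bprob_nonneg[OF p])
  have all: "bprob p ?E (\<lambda>A. \<not> hits k T A) = u"
    if "T \<in> {side_right n, side_top n, side_left n, side_bottom n}" for T
    using that bprob_hits_rot[of p n k] finE
    by (auto simp: u_def bprob_not simp flip: rot_sides)
  let ?N = "\<lambda>T A. \<not> hits k T A"
  let ?Q = "\<lambda>T T' A. ?N T A \<and> ?N T' A"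
  have dec: "?N T A" if "A \<subseteq> B" "?N T B" for T A B using hits_mono[OF that(1), of k T] that(2) by blast
  have pair: "u * u \<le> bprob p ?E (?Q T T')"
    if "T \<in> {side_right n, side_top n, side_left n, side_bottom n}"
      "T' \<in> {side_right n, side_top n, side_left n, side_bottom n}" for T T'
  proof -
    have "bprob p ?E (?N T) * bprob p ?E (?N T') \<le> bprob p ?E (?Q T T')"
      by (rule Harris_decreasing[OF finE p]) (rule dec, assumption+)+
    then show ?thesis unfolding all[OF that(1)] all[OF that(2)] .
  qed
  \<comment> \<open>Missing a given side is a decreasing event of probability \<open>u\<close>, so
    all four are missed with probability at least \<open>u ^ 4\<close>. The value 1/8 is chosen so
    that four failures sum to 1/2 in the four-arm construction.\<close>
  have "u ^ 4 = (u * u) * (u * u)" by (simp add: power4_eq_xxxx)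
  also have "\<dots> \<le> bprob p ?E (?Q (side_right n) (side_top n)) * bprob p ?E (?Q (side_left n) (side_bottom n))"
    using u0 by (intro mult_mono pair mult_nonneg_nonneg bprob_nonneg p) auto
  also have "\<dots> \<le> bprob p ?E (\<lambda>A. ?Q (side_right n) (side_top n) A \<and> ?Q (side_left n) (side_bottom n) A)"
    by (rule Harris_decreasing[OF finE p]) (use dec in blast)+
  also have "\<dots> \<le> bprob p ?E (\<lambda>A. \<not> (\<exists>z\<in>ibox k. exits (ibox n) A z))"
    using exits_hits_side \<open>k \<le> n\<close> by (intro bprob_mono p) blast
  also have "\<dots> \<le> (1/8) ^ 4" by (rule small)
  finally have "u ^ 4 \<le> (1/8) ^ 4" .
  then have "u \<le> 1/8" using power_le_imp_le_base[of u 3 "1/8"] by simp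
  then show ?thesis using all[OF T] by simp
qed

section \<open>Local modification and the four-arm construction\<close>

lemma exists_pivotal_addition:
  assumes "finite I" "\<not> P {}" "P I"
  shows "\<exists>J\<subseteq>I. \<exists>e\<in>I. \<not> P J \<and> P (insert e J)"
  using assms
proof (induction I rule: finite_induct)
  case (insert e I)
  show ?case
  proof (cases "P I")
    case True
    then show ?thesis using insert by blast
  next
    case False
    then show ?thesis using insert.prems by blast
  qed
qed simp

lemma bexp_half:
  assumes "finite I"
  shows "2 ^ card I * bexp (1/2) I h = (\<Sum>J\<in>Pow I. h J)"
  unfolding bexp_def sum_distrib_left
proof (intro sum.cong refl)
  fix J assume J: "J \<in> Pow I"
  then have "finite J" "finite (I - J)" using assms finite_subset by auto
  then have "card (J \<union> (I - J)) = card J + card (I - J)" by (intro card_Un_disjoint) auto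
  moreover have "J \<union> (I - J) = I" using J by auto
  ultimately have "(2 :: real) ^ card I * ((1/2) ^ card J * (1 - 1/2) ^ card (I - J)) = 1"
    by (simp add: power_add power_divide)
  then show "2 ^ card I * ((1/2) ^ card J * (1 - 1/2) ^ card (I - J) * h J) = h J"
    by (simp only: mult.assoc[symmetric])
qed

text \<open>At parameter 1/2 the \<open>2 ^ card I\<close> patterns on \<open>I\<close> are equally
  likely and independent of the rest, so replacing the actual pattern by a suitable \<open>J\<close>
  costs at most the factor \<open>2 ^ card I\<close>.\<close>

lemma bprob_half_resample:
  assumes "finite E" "I \<subseteq> E"
    and imp: "\<And>A. A \<subseteq> E \<Longrightarrow> P A \<Longrightarrow> \<exists>J\<subseteq>I. \<exists>e\<in>I. Q e ((A - I) \<union> J)"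
  shows "bprob (1/2) E P \<le> 2 ^ card I * (\<Sum>e\<in>I. bprob (1/2) E (Q e))"
proof -
  have finI: "finite I" using assms finite_subset by blast
  have E: "E = (E - I) \<union> I" using assms by auto
  have "bprob (1/2) E P = bexp (1/2) (E - I) (\<lambda>B. bexp (1/2) I (\<lambda>J. of_bool (P (B \<union> J))))"
    using assms finI by (subst E, subst bexp_Un) auto
  also have "\<dots> \<le> bexp (1/2) (E - I) (\<lambda>B. bexp (1/2) I (\<lambda>_. of_bool (\<exists>J\<subseteq>I. \<exists>e\<in>I. Q e (B \<union> J))))"
  proof (intro bexp_mono)
    fix B J assume BJ: "B \<subseteq> E - I" "J \<subseteq> I"
    then have "(B \<union> J) - I = B" "B \<union> J \<subseteq> E" using assms(2) by auto
    then show "of_bool (P (B \<union> J)) \<le> (of_bool (\<exists>J\<subseteq>I. \<exists>e\<in>I. Q e (B \<union> J)) :: real)"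
      using imp[of "B \<union> J"] by (cases "P (B \<union> J)") auto
  qed auto
  also have "\<dots> \<le> bexp (1/2) (E - I) (\<lambda>B. 2 ^ card I * bexp (1/2) I (\<lambda>J. \<Sum>e\<in>I. of_bool (Q e (B \<union> J))))"
  proof (intro bexp_mono)
    fix B
    have "2 ^ card I * bexp (1/2) I (\<lambda>J. \<Sum>e\<in>I. of_bool (Q e (B \<union> J)) :: real) =
        (\<Sum>J\<in>Pow I. \<Sum>e\<in>I. of_bool (Q e (B \<union> J)))"
      by (rule bexp_half[OF finI])
    moreover have "of_bool (\<exists>J\<subseteq>I. \<exists>e\<in>I. Q e (B \<union> J)) \<le> (\<Sum>J\<in>Pow I. \<Sum>e\<in>I. of_bool (Q e (B \<union> J)) :: real)"
    proof (cases "\<exists>J\<subseteq>I. \<exists>e\<in>I. Q e (B \<union> J)")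
      case True
      then obtain J e where Je: "J \<subseteq> I" "e \<in> I" "Q e (B \<union> J)" by blast
      have "(1 :: real) = of_bool (Q e (B \<union> J))" using Je by simp
      also have "\<dots> \<le> (\<Sum>e\<in>I. of_bool (Q e (B \<union> J)))"
        using Je finI by (intro member_le_sum[of e I "\<lambda>e. of_bool (Q e (B \<union> J))"]) auto
      also have "\<dots> \<le> (\<Sum>J\<in>Pow I. \<Sum>e\<in>I. of_bool (Q e (B \<union> J)))"
        using Je finI by (intro member_le_sum[of J "Pow I" "\<lambda>J. \<Sum>e\<in>I. of_bool (Q e (B \<union> J))"]) (auto intro: sum_nonneg)
      finally show ?thesis using True by simp
    qed (simp add: sum_nonneg)
    ultimately show "bexp (1/2) I (\<lambda>_. of_bool (\<exists>J\<subseteq>I. \<exists>e\<in>I. Q e (B \<union> J))) \<le>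
        2 ^ card I * bexp (1/2) I (\<lambda>J. \<Sum>e\<in>I. of_bool (Q e (B \<union> J)))"
      using finI by (simp only: bexp_const)
  qed auto
  also have "\<dots> = 2 ^ card I * bexp (1/2) E (\<lambda>A. \<Sum>e\<in>I. of_bool (Q e A))"
  proof -
    have "bexp (1/2) ((E - I) \<union> I) (\<lambda>A. \<Sum>e\<in>I. of_bool (Q e A) :: real) =
        bexp (1/2) (E - I) (\<lambda>B. bexp (1/2) I (\<lambda>J. \<Sum>e\<in>I. of_bool (Q e (B \<union> J))))"
      using assms(1) finI by (intro bexp_Un) auto
    then show ?thesis unfolding bexp_cmult E[symmetric] by (simp only:)
  qed
  finally show ?thesis by (simp only: bexp_sum)
qed

definition dual_edges :: "(int \<times> int) set set \<Rightarrow> (int \<times> int) set set" where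
  "dual_edges F = {e \<in> sq_edges. dual e \<in> F}"

text \<open>The duals of closed edges form percolation at \<open>1 - p\<close>, by
  \<open>bexp_compl\<close> and the injectivity of \<open>dual\<close>.\<close>

lemma bprob_dual:
  assumes "finite E" "F \<subseteq> sq_edges" "finite F" "dual_edges F \<subseteq> E"
  shows "bprob p E (\<lambda>A. P (dual ` (dual_edges F - A))) = bprob (1 - p) F P"
proof -
  let ?D = "dual_edges F"
  have "bprob p E (\<lambda>A. P (dual ` (?D - A))) = bprob p E (\<lambda>A. P (dual ` (?D - (A \<inter> ?D))))"
    by (intro bexp_cong) (simp add: Diff_Int_distrib2 Diff_Int)
  also have "\<dots> = bprob p ?D (\<lambda>A. P (dual ` (?D - A)))"
    using bexp_marginal[OF assms(1,4), of p "\<lambda>A. of_bool (P (dual ` (?D - A)))"] by simp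
  also have "\<dots> = bprob (1 - p) ?D (\<lambda>A. P (dual ` A))"
    by (rule bexp_compl)
  also have "\<dots> = bprob (1 - p) (dual ` ?D) P"
    by (rule bexp_image[symmetric], rule inj_on_subset[OF inj_on_dual]) (auto simp: dual_edges_def)
  also have "dual ` ?D = F" unfolding dual_edges_def by (rule dual_preimage[OF assms(2)])
  finally show ?thesis .
qed

definition lr_crossing :: "nat \<Rightarrow> (int \<times> int) set set \<Rightarrow> bool" where
  "lr_crossing n A \<longleftrightarrow> (\<exists>u\<in>side_left n. \<exists>w\<in>side_right n. conn A u w)"

text \<open>The dual box has the same labels but is shifted by half a unit to the upper right, so
  the two boxes do not fit exactly and the hypotheses of \<open>no_crossing_paths\<close> have to be
  arranged at the sides.\<close>

lemma lr_crossing_blocked: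
  assumes A: "A \<subseteq> sq.edges_at (ibox n)" and B: "B \<subseteq> dual_edges (sq.edges_at (ibox n))"
    and AB: "A \<inter> B = {}" and lr: "lr_crossing n A"
    and fg: "f \<in> side_bottom n" "g \<in> side_top n" "conn (dual ` B) f g"
  shows False
proof -
  obtain u w where u: "u \<in> side_left n" and w: "w \<in> side_right n" and uw: "conn A u w"
    using lr by (auto simp: lr_crossing_def)
  obtain y where w_eq: "w = (int n, y)" and y: "\<bar>y\<bar> < int n" using w by (auto simp: side_defs)
  \<comment> \<open>Prolonging the path by one edge keeps dual vertices on the right side to its left.\<close>
  let ?A = "insert (hor (int n) y) A"
  have "hor (int n) y \<notin> B"
  proof
    assume "hor (int n) y \<in> B"
    then have "dual (hor (int n) y) \<inter> ibox n \<noteq> {}" using B unfolding dual_edges_def sq.edges_at_def by blast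
    then show False by (auto simp: dual_hor ver_def)
  qed
  moreover have "conn ?A u (int n + 1, y)"
  proof (rule conn_step)
    show "conn ?A u w" using uw by (rule conn_mono[rotated]) auto
    show "{w, (int n + 1, y)} \<in> ?A" by (simp add: w_eq hor_def)
  qed
  ultimately show False
  proof (intro no_crossing_paths[of ?A B u "(int n + 1, y)" f g])
    show "?A \<subseteq> sq_edges" using A sq.edges_at_subset by blast
    show "B \<subseteq> sq_edges" using B by (auto simp: dual_edges_def)
    fix x z assume "ver x z \<in> B"
    then have "dual (ver x z) \<inter> ibox n \<noteq> {}" using B unfolding dual_edges_def sq.edges_at_def by blast
    then have "hor (x - 1) z \<inter> ibox n \<noteq> {}" by (simp add: dual_ver)
    then have "- int n < x \<and> x \<le> int n" by (auto simp: hor_def)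
    then show "x \<noteq> fst u \<and> x \<noteq> fst (int n + 1, y)" using u by (auto simp: side_defs)
  next
    fix x z assume "hor x z \<in> ?A"
    then consider "z = y" | "hor x z \<inter> ibox n \<noteq> {}" using A unfolding sq.edges_at_def insert_iff hor_eq_iff by blast
    then have "\<bar>z\<bar> < int n" using y by cases (auto simp: hor_def)
    then show "snd f < z \<and> z \<le> snd g" using fg by (auto simp: side_defs)
  qed (use AB fg u in \<open>auto simp: side_defs\<close>)
qed

text \<open>A crossing created by opening \<open>e\<close> must use \<open>e\<close>. Its two ends,
  which lie outside the box, are therefore in different clusters, one at each endpoint of
  \<open>e\<close>.\<close>

lemma pivotal_joins_exits:
  assumes e: "e \<in> sq_edges" and piv: "\<not> lr_crossing n A" "lr_crossing n (insert e A)"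
  shows "sq.joins_exits (ibox n) A e"
proof -
  obtain a b where ab: "e = {a, b}" using sq.edge[OF e] by blast
  obtain u w where uw: "u \<in> side_left n" "w \<in> side_right n" "conn (insert {a, b} A) u w"
    using piv(2) ab by (auto simp: lr_crossing_def)
  have out: "u \<notin> ibox n" "w \<notin> ibox n" using uw(1,2) by (auto simp: side_defs)
  have n: "\<not> conn A u w" using piv(1) uw by (auto simp: lr_crossing_def)
  then consider "conn A u a" "conn A b w" | "conn A u b" "conn A a w"
    using conn_insert[OF uw(3)] by blast
  then show ?thesis
  proof cases
    case 1
    then have "\<not> conn A a b" using n conn_trans[of A u a b] conn_trans[of A u b w] by blast
    moreover have "exits (ibox n) A a" "exits (ibox n) A b"
      using out conn_sym[OF 1(1)] 1(2) unfolding exits_def by blast+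
    ultimately show ?thesis using ab unfolding sq.joins_exits_def by blast
  next
    case 2
    then have "\<not> conn A b a" using n conn_trans[of A u b a] conn_trans[of A u a w] by blast
    moreover have "exits (ibox n) A a" "exits (ibox n) A b"
      using out conn_sym[OF 2(1)] 2(2) unfolding exits_def by blast+
    moreover have "e = {b, a}" using ab by auto
    ultimately show ?thesis unfolding sq.joins_exits_def by blast
  qed
qed

text \<open>Harris' theorem. Otherwise, by self-duality, a central box is likely connected to the left and
  right sides by open paths and to the top and bottom by closed dual paths; modifying finitely many
  edges produces an edge joining two large clusters.\<close>

theorem theta_half_zero:
  assumes "\<theta> > 0"
  shows "\<exists>n. sq.xit (1/2) (ibox n) 0 < \<theta>"
proof (rule ccontr)
  assume "\<not> ?thesis"
  then have xit: "\<theta> \<le> sq.xit (1/2) (ibox n) 0" for n by (simp add: not_less)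
  obtain k where k: "\<And>n. n \<ge> k \<Longrightarrow>
    bprob (1/2) (sq.edges_at (ibox n)) (\<lambda>A. \<not> (\<exists>z\<in>ibox k. exits (ibox n) A z)) \<le> (1/8) ^ 4"
    using ibox_exits_likely[of "1/2" \<theta> "(1/8) ^ 4"] assms xit by auto
  \<comment> \<open>Opening all of \<open>I\<close> connects the central box; closing all of
    \<open>I\<close> connects the central box of the dual lattice.\<close>
  define I where "I = inside (ibox k) sq_edges \<union> dual_edges (inside (ibox k) sq_edges)"
  have finI: "finite I"
    using sq.finite_inside[of "ibox k"] finite_dual_preimage by (auto simp: I_def dual_edges_def)
  have I_sq: "I \<subseteq> sq_edges" by (auto simp: I_def inside_def dual_edges_def)
  have I_sub: "e \<subseteq> ibox (k + 1)" if "e \<in> I" for e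
  proof -
    have "e \<in> sq_edges" using that I_sq by blast
    then show ?thesis
    proof (elim sq_edgesE)
      fix x y assume "e = hor x y"
      then show ?thesis using that by (auto simp: I_def inside_def dual_edges_def dual_hor) (auto simp: hor_def ver_def)
    next
      fix x y assume "e = ver x y"
      then show ?thesis using that by (auto simp: I_def inside_def dual_edges_def dual_ver) (auto simp: hor_def ver_def)
    qed
  qed
  \<comment> \<open>The final sum is at most \<open>2 ^ card I * card I * c\<close>, which this
    choice keeps below 1/2; the summand 1 avoids division by zero.\<close>
  define c where "c = 1 / (2 * 2 ^ card I * (real (card I) + 1))"
  have "c > 0" by (auto simp: c_def add_pos_nonneg)
  then obtain n where n: "n \<ge> k + 1" and small: "\<And>e. e \<in> sq_edges \<Longrightarrow> e \<subseteq> ibox (k + 1) \<Longrightarrow>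
      bprob (1/2) (sq.edges_at (ibox n)) (\<lambda>A. sq.joins_exits (ibox n) A e) < c"
    using joins_exits_small[of "1/2" c "k + 1"] by auto
  define C where "C = sq.edges_at (ibox n)"
  \<comment> \<open>Open paths are sought in \<open>C\<close> and dual paths in the box with the
    same labels; \<open>E\<close> contains the primal edges that govern both.\<close>
  define E where "E = C \<union> dual_edges C"
  have finC: "finite C" by (simp add: C_def sq.finite_edges_at)
  have C_sq: "C \<subseteq> sq_edges" by (simp add: C_def sq.edges_at_subset)
  have finE: "finite E" using finC finite_dual_preimage by (auto simp: E_def dual_edges_def)
  have inC: "inside (ibox k) sq_edges \<subseteq> C"
    using sq.inside_subset_edges_at[of "ibox k"] sq.edges_at_mono[OF ibox_mono, of k n] n
    by (auto simp: C_def)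
  then have IE: "I \<subseteq> E" by (auto simp: I_def E_def dual_edges_def)
  define Op where "Op = (\<lambda>T A. hits k T (A \<inter> C))"
  define Dp where "Dp = (\<lambda>T A. hits k T (dual ` (dual_edges C - A)))"
  let ?Ts = "{side_right n, side_top n, side_left n, side_bottom n}"
  have PC: "bprob (1/2) C (\<lambda>A. \<not> hits k T A) \<le> 1/8" if "T \<in> ?Ts" for T
    unfolding C_def using n that by (intro hits_sides_likely k) auto
  have PO: "bprob (1/2) E (\<lambda>A. \<not> Op T A) \<le> 1/8" if "T \<in> ?Ts" for T
  proof -
    have "bprob (1/2) E (\<lambda>A. \<not> Op T A) = bprob (1/2) C (\<lambda>A. \<not> hits k T A)"
      unfolding Op_def using bexp_marginal[OF finE, of C "1/2" "\<lambda>A. of_bool (\<not> hits k T A)"] by (simp add: E_def)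
    then show ?thesis using PC[OF that] by simp
  qed
  have PD: "bprob (1/2) E (\<lambda>A. \<not> Dp T A) \<le> 1/8" if "T \<in> ?Ts" for T
  proof -
    have "bprob (1/2) E (\<lambda>A. \<not> Dp T A) = bprob (1 - 1/2) C (\<lambda>A. \<not> hits k T A)"
      unfolding Dp_def using bprob_dual[OF finE C_sq finC, of "1/2" "\<lambda>A. \<not> hits k T A"] by (simp add: E_def)
    also have "(1 - 1/2 :: real) = 1/2" by simp
    finally show ?thesis using PC[OF that] by simp
  qed
  define F where "F = (\<lambda>A. Op (side_left n) A \<and> Op (side_right n) A \<and> Dp (side_top n) A \<and> Dp (side_bottom n) A)"
  have "1 - bprob (1/2) E F = bprob (1/2) E (\<lambda>A. \<not> F A)"
    using finE by (simp add: bprob_not)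
  also have "\<dots> \<le> bexp (1/2) E (\<lambda>A. of_bool (\<not> Op (side_left n) A) + of_bool (\<not> Op (side_right n) A) +
      of_bool (\<not> Dp (side_top n) A) + of_bool (\<not> Dp (side_bottom n) A))"
    by (intro bexp_mono) (auto simp: F_def)
  also have "\<dots> \<le> 1/8 + 1/8 + 1/8 + 1/8"
    unfolding bexp_add by (intro add_mono PO PD) auto
  finally have F_likely: "1/2 \<le> bprob (1/2) E F" by simp
  have link: "conn A f g" if "conn A z f" "conn A z' g" "z \<in> ibox k" "z' \<in> ibox k"
      "inside (ibox k) sq_edges \<subseteq> A" for A f g z z'
  proof -
    have "conn A z z'" using ibox_connected[OF that(3,4)] by (rule conn_mono[OF that(5)])
    then show ?thesis using conn_trans[OF conn_sym[OF that(1)]] conn_trans that(2) by metis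
  qed
  have "bprob (1/2) E F \<le> 2 ^ card I * (\<Sum>e\<in>I. bprob (1/2) E (\<lambda>A. sq.joins_exits (ibox n) (A \<inter> C) e))"
  proof (rule bprob_half_resample[OF finE IE])
    fix A assume A: "A \<subseteq> E" "F A"
    \<comment> \<open>With all of \<open>I\<close> open the left and right arms join into a
      crossing; with all of \<open>I\<close> closed the two dual arms join and block it. In between,
      one added edge creates the crossing.\<close>
    let ?P = "\<lambda>J. lr_crossing n (((A - I) \<union> J) \<inter> C)"
    have "?P I"
    proof -
      let ?A = "((A - I) \<union> I) \<inter> C"
      obtain z u where zu: "z \<in> ibox k" "u \<in> side_left n" "conn (A \<inter> C) z u"
        using A(2) by (auto simp: F_def Op_def hits_def)
      obtain z' w where zw: "z' \<in> ibox k" "w \<in> side_right n" "conn (A \<inter> C) z' w"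
        using A(2) by (auto simp: F_def Op_def hits_def)
      have sub: "A \<inter> C \<subseteq> ?A" by auto
      have "conn ?A u w"
        using zu(1) zw(1) inC
        by (intro link[OF conn_mono[OF sub zu(3)] conn_mono[OF sub zw(3)]]) (auto simp: I_def)
      then show ?thesis using zu zw by (auto simp: lr_crossing_def)
    qed
    moreover have "\<not> ?P {}"
    proof
      assume P: "?P {}"
      let ?B = "dual_edges C - (A - I)"
      obtain z g where zg: "z \<in> ibox k" "g \<in> side_top n" "conn (dual ` (dual_edges C - A)) z g"
        using A(2) by (auto simp: F_def Dp_def hits_def)
      obtain z' f where zf: "z' \<in> ibox k" "f \<in> side_bottom n" "conn (dual ` (dual_edges C - A)) z' f"
        using A(2) by (auto simp: F_def Dp_def hits_def)
      have sub: "dual ` (dual_edges C - A) \<subseteq> dual ` ?B" by auto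
      have "inside (ibox k) sq_edges = dual ` dual_edges (inside (ibox k) sq_edges)"
        unfolding dual_edges_def by (rule dual_preimage[symmetric]) (auto simp: inside_def)
      also have "\<dots> \<subseteq> dual ` ?B"
        using inC by (intro image_mono) (auto simp: I_def dual_edges_def)
      finally have "conn (dual ` ?B) f g"
        using zf(1) zg(1) by (intro link[OF conn_mono[OF sub zf(3)] conn_mono[OF sub zg(3)]])
      then show False
        using P zf zg by (intro lr_crossing_blocked[of "((A - I) \<union> {}) \<inter> C" n ?B f g]) (auto simp: C_def)
    qed
    ultimately obtain J e where Je: "J \<subseteq> I" "e \<in> I" "\<not> ?P J" "?P (insert e J)"
      using exists_pivotal_addition[OF finI, of ?P] by blast
    have "e \<in> C"
    proof (rule ccontr)
      assume "e \<notin> C"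
      then have "((A - I) \<union> insert e J) \<inter> C = ((A - I) \<union> J) \<inter> C" by auto
      then show False using Je by simp
    qed
    then have "((A - I) \<union> insert e J) \<inter> C = insert e (((A - I) \<union> J) \<inter> C)" by auto
    then have "sq.joins_exits (ibox n) (((A - I) \<union> J) \<inter> C) e"
      using Je I_sq by (intro pivotal_joins_exits) auto
    then show "\<exists>J\<subseteq>I. \<exists>e\<in>I. sq.joins_exits (ibox n) (((A - I) \<union> J) \<inter> C) e" using Je by blast
  qed
  also have "\<dots> \<le> 2 ^ card I * (\<Sum>e\<in>I. c)"
  proof (intro mult_left_mono sum_mono)
    fix e assume e: "e \<in> I"
    have "bprob (1/2) E (\<lambda>A. sq.joins_exits (ibox n) (A \<inter> C) e) = bprob (1/2) C (\<lambda>A. sq.joins_exits (ibox n) A e)"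
      using bexp_marginal[OF finE, of C "1/2" "\<lambda>A. of_bool (sq.joins_exits (ibox n) A e)"] by (simp add: E_def)
    also have "\<dots> \<le> c" using small[OF _ I_sub[OF e]] e I_sq by (force simp: C_def)
    finally show "bprob (1/2) E (\<lambda>A. sq.joins_exits (ibox n) (A \<inter> C) e) \<le> c" .
  qed auto
  also have "\<dots> < 1/2"
    by (simp add: c_def field_simps add_pos_nonneg)
  finally show False using F_likely by simp
qed

subsection \<open>The planar three-arm inequality\<close>

text \<open>The self-dual rectangle: \<open>n + 1\<close> columns and \<open>n\<close> rows of vertices.\<close>

definition rect :: "nat \<Rightarrow> (int \<times> int) set set" where
  "rect n = {hor x y | x y. 0 \<le> x \<and> x < int n \<and> 0 \<le> y \<and> y < int n} \<union>
    {ver x y | x y. 0 < x \<and> x < int n \<and> 0 \<le> y \<and> y < int n - 1}"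

lemma hor_in_rect [simp]: "hor x y \<in> rect n \<longleftrightarrow> 0 \<le> x \<and> x < int n \<and> 0 \<le> y \<and> y < int n"
  by (auto simp: rect_def)

lemma ver_in_rect [simp]: "ver x y \<in> rect n \<longleftrightarrow> 0 < x \<and> x < int n \<and> 0 \<le> y \<and> y < int n - 1"
  by (auto simp: rect_def)

lemma rect_subset: "rect n \<subseteq> sq_edges"
  by (auto simp: rect_def)

lemma mem_hor: "(x, y) \<in> hor a b \<longleftrightarrow> b = y \<and> (a = x \<or> a = x - 1)"
  and mem_ver: "(x, y) \<in> ver a b \<longleftrightarrow> a = x \<and> (b = y \<or> b = y - 1)"
  by (auto simp: hor_def ver_def)

lemma rectE:
  assumes "e \<in> rect n"
  obtains x y where "e = hor x y" "0 \<le> x" "x < int n" "0 \<le> y" "y < int n"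
  | x y where "e = ver x y" "0 < x" "x < int n" "0 \<le> y" "y < int n - 1"
  using assms by (auto simp: rect_def)

lemma finite_rect [simp]: "finite (rect n)"
proof -
  have "rect n \<subseteq> (\<lambda>(x, y). hor x y) ` ({0..int n} \<times> {0..int n}) \<union> (\<lambda>(x, y). ver x y) ` ({0..int n} \<times> {0..int n})"
    by (auto elim!: rectE)
  then show ?thesis by (rule finite_subset) simp
qed

definition crossing :: "nat \<Rightarrow> (int \<times> int) set set \<Rightarrow> bool" where
  "crossing n A \<longleftrightarrow> (\<exists>u w. fst u = 0 \<and> fst w = int n \<and> conn A u w)"

definition dual_crossing :: "nat \<Rightarrow> (int \<times> int) set set \<Rightarrow> bool" where
  "dual_crossing n A \<longleftrightarrow> (\<exists>f g. snd f = -1 \<and> snd g = int n - 1 \<and> conn (dual ` (rect n - A)) f g)"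

lemma crossing_mono: "A \<subseteq> B \<Longrightarrow> crossing n A \<Longrightarrow> crossing n B"
  using conn_mono[of A B] unfolding crossing_def by blast

text \<open>A reflection that carries the dual of \<open>rect n\<close> back to
  \<open>rect n\<close>; the dual rows \<open>-1\<close> and \<open>n - 1\<close> become the columns
  \<open>0\<close> and \<open>n\<close>.\<close>

definition flip :: "int \<times> int \<Rightarrow> int \<times> int" where
  "flip f = (snd f + 1, fst f)"

lemma inj_flip: "inj flip"
  by (auto simp: inj_on_def flip_def prod_eq_iff)

lemma flip_dual_hor: "flip ` dual (hor x y) = hor y x"
  and flip_dual_ver: "flip ` dual (ver x y) = ver (y + 1) (x - 1)"
  by (auto simp: dual_hor dual_ver flip_def) (auto simp: hor_def ver_def flip_def)

lemma flip_dual_rect: "(\<lambda>e. flip ` dual e) ` rect n = rect n"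
proof
  show "(\<lambda>e. flip ` dual e) ` rect n \<subseteq> rect n"
    by (auto elim!: rectE simp: flip_dual_hor flip_dual_ver)
  show "rect n \<subseteq> (\<lambda>e. flip ` dual e) ` rect n"
  proof
    fix e assume "e \<in> rect n"
    then show "e \<in> (\<lambda>e. flip ` dual e) ` rect n"
    proof (elim rectE)
      fix x y assume *: "e = hor x y" "0 \<le> x" "x < int n" "0 \<le> y" "y < int n"
      then have "e = flip ` dual (hor y x)" by (simp add: flip_dual_hor)
      then show ?thesis by (rule image_eqI) (use * in simp)
    next
      fix x y assume *: "e = ver x y" "0 < x" "x < int n" "0 \<le> y" "y < int n - 1"
      then have "e = flip ` dual (ver (y + 1) (x - 1))" by (simp add: flip_dual_ver)
      then show ?thesis by (rule image_eqI) (use * in simp)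
    qed
  qed
qed

lemma inj_on_flip_dual: "inj_on (\<lambda>e. flip ` dual e) (rect n)"
proof (rule inj_onI)
  fix e e' assume *: "e \<in> rect n" "e' \<in> rect n" "flip ` dual e = flip ` dual e'"
  then have "dual e = dual e'" using inj_image_eq_iff[OF inj_flip] by metis
  then show "e = e'" using * rect_subset inj_onD[OF inj_on_dual, of e e'] by blast
qed

lemma dual_crossing_iff: "dual_crossing n A \<longleftrightarrow> crossing n ((\<lambda>e. flip ` dual e) ` (rect n - A))"
proof -
  have eq: "(\<lambda>e. flip ` dual e) ` (rect n - A) = (`) flip ` (dual ` (rect n - A))"
    by (simp add: image_image)
  show ?thesis
  proof
    assume "dual_crossing n A"
    then obtain f g where "snd f = -1" "snd g = int n - 1" "conn (dual ` (rect n - A)) f g"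
      by (auto simp: dual_crossing_def)
    then show "crossing n ((\<lambda>e. flip ` dual e) ` (rect n - A))"
      unfolding eq crossing_def by (intro exI[of _ "flip f"] exI[of _ "flip g"]) (auto simp: flip_def[symmetric] conn_image, auto simp: flip_def)
  next
    assume "crossing n ((\<lambda>e. flip ` dual e) ` (rect n - A))"
    then obtain u w where uw: "fst u = 0" "fst w = int n" "conn ((`) flip ` (dual ` (rect n - A))) u w"
      unfolding eq crossing_def by blast
    have "u = flip (snd u, -1)" "w = flip (snd w, int n - 1)" using uw by (auto simp: flip_def prod_eq_iff)
    then have "conn (dual ` (rect n - A)) (snd u, -1) (snd w, int n - 1)"
      using uw(3) conn_image_iff[OF inj_flip] by metis
    then show "dual_crossing n A" unfolding dual_crossing_def by (intro exI conjI) auto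
  qed
qed

lemma bprob_dual_crossing: "bprob p (rect n) (dual_crossing n) = bprob (1 - p) (rect n) (crossing n)"
proof -
  have "bprob p (rect n) (dual_crossing n) =
      bprob p (rect n) (\<lambda>A. crossing n ((\<lambda>e. flip ` dual e) ` (rect n - A)))"
    by (simp add: dual_crossing_iff)
  also have "\<dots> = bprob (1 - p) (rect n) (\<lambda>A. crossing n ((\<lambda>e. flip ` dual e) ` A))"
    by (rule bexp_compl)
  also have "\<dots> = bprob (1 - p) ((\<lambda>e. flip ` dual e) ` rect n) (crossing n)"
    by (rule bexp_image[OF inj_on_flip_dual, symmetric])
  finally show ?thesis by (simp only: flip_dual_rect)
qed

section \<open>The lowest crossing\<close>

definition flooded :: "nat \<Rightarrow> (int \<times> int) set set \<Rightarrow> (int \<times> int) set" where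
  "flooded n A = {f. \<exists>a. 0 \<le> a \<and> a < int n \<and> conn (dual ` (rect n - A)) (a, -1) f}"

text \<open>It plays the role of the lowest crossing. Two properties are used instead of an actual
  lowest path: every edge of it borders a face joined to the bottom by a closed dual path, and it
  contains a crossing whenever there is no dual crossing.\<close>

definition shore :: "nat \<Rightarrow> (int \<times> int) set set \<Rightarrow> (int \<times> int) set set" where
  "shore n A = {e \<in> rect n. crosses (flooded n A) (dual e)}"

lemma shore_subset: "shore n A \<subseteq> A"
proof
  fix e assume e: "e \<in> shore n A"
  then have "e \<in> sq_edges" "e \<in> rect n" using rect_subset by (auto simp: shore_def)
  then obtain f g where fg: "dual e = {f, g}" using sq.edge[OF dual_in_sq_edges] by blast
  show "e \<in> A"
  proof (rule ccontr)
    assume "e \<notin> A"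
    then have "{f, g} \<in> dual ` (rect n - A)" "{g, f} \<in> dual ` (rect n - A)"
      using \<open>e \<in> rect n\<close> fg by (auto simp: insert_commute)
    then have "f \<in> flooded n A \<longleftrightarrow> g \<in> flooded n A"
      using conn_step[of "dual ` (rect n - A)" _ f g] conn_step[of "dual ` (rect n - A)" _ g f]
      unfolding flooded_def by blast
    then show False using e fg by (simp add: shore_def crosses_pair)
  qed
qed

lemma odd_changes:
  fixes P :: "int \<Rightarrow> bool"
  shows "odd (card {y. 0 \<le> y \<and> y < int m \<and> P (y - 1) \<noteq> P y}) \<longleftrightarrow> P (-1) \<noteq> P (int m - 1)"
proof (induction m)
  case (Suc m)
  let ?S = "{y. 0 \<le> y \<and> y < int m \<and> P (y - 1) \<noteq> P y}"
  have "?S \<subseteq> {0..int m}" by auto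
  then have fin: "finite ?S" by (rule finite_subset) simp
  have "{y. 0 \<le> y \<and> y < int (Suc m) \<and> P (y - 1) \<noteq> P y} =
      (if P (int m - 1) \<noteq> P (int m) then insert (int m) ?S else ?S)"
  proof -
    have "y < int (Suc m) \<longleftrightarrow> y = int m \<or> y < int m" for y by auto
    then have "{y. 0 \<le> y \<and> y < int (Suc m) \<and> P (y - 1) \<noteq> P y} =
        {y. 0 \<le> y \<and> (y = int m \<or> y < int m) \<and> P (y - 1) \<noteq> P y}" by (simp only:)
    also have "\<dots> = (if P (int m - 1) \<noteq> P (int m) then insert (int m) ?S else ?S)" by auto
    finally show ?thesis .
  qed
  then show ?case using Suc fin by auto
next
  case 0
  have eq: "{y. 0 \<le> y \<and> y < int 0 \<and> P (y - 1) \<noteq> P y} = {}" by auto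
  show ?case unfolding eq by simp
qed

lemma even_of_bool_sum4:
  fixes a b c d :: bool
  shows "even (of_bool (a \<noteq> b) + of_bool (b \<noteq> c) + of_bool (c \<noteq> d) + of_bool (d \<noteq> a) :: nat)"
  by (cases a; cases b; cases c; cases d) auto

lemma card_filter_distinct4:
  assumes "distinct [a, b, c, d]"
  shows "card {e \<in> {a, b, c, d}. Q e} = of_bool (Q a) + of_bool (Q b) + of_bool (Q c) + of_bool (Q d)"
proof -
  have "card {e \<in> {a, b, c, d}. Q e} = (\<Sum>e\<in>{a, b, c, d}. of_bool (Q e))"
    by (simp add: sum.inter_filter[symmetric] of_bool_def flip: card_eq_sum) 
  then show ?thesis using assms by simp
qed

text \<open>The handshake lemma for the shore edges: interior vertices have even degree because the
  four faces around them are visited cyclically, while the left side has odd total degree.\<close>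

lemma shore_crossing:
  assumes n: "n \<ge> 1" and nd: "\<not> dual_crossing n A"
  shows "crossing n (shore n A)"
proof (rule ccontr)
  assume nc: "\<not> crossing n (shore n A)"
  let ?H = "shore n A" and ?D = "flooded n A"
  have finH: "finite ?H" by (simp add: shore_def)
  have D_bottom: "(a, -1) \<in> ?D" if "0 \<le> a" "a < int n" for a
    using that by (auto simp: flooded_def intro!: exI[of _ a])
  have D_top: "(a, int n - 1) \<notin> ?D" for a
    using nd by (fastforce simp: flooded_def dual_crossing_def)
  have H_hor: "hor x y \<in> ?H \<longleftrightarrow> 0 \<le> x \<and> x < int n \<and> 0 \<le> y \<and> y < int n \<and>
      ((x, y - 1) \<in> ?D) \<noteq> ((x, y) \<in> ?D)" for x y
    by (auto simp: shore_def dual_hor ver_def crosses_pair)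
  have H_ver: "ver x y \<in> ?H \<longleftrightarrow> 0 < x \<and> x < int n \<and> 0 \<le> y \<and> y < int n - 1 \<and>
      ((x - 1, y) \<in> ?D) \<noteq> ((x, y) \<in> ?D)" for x y
    by (auto simp: shore_def dual_ver hor_def crosses_pair)
  define V where "V = \<Union>?H"
  \<comment> \<open>The vertices of the shore that are connected to the left side. By assumption
    they do not reach the right side, so only left vertices can have odd degree.\<close>
  define K where "K = {v \<in> V. \<exists>y. conn ?H (0, y) v}"
  have fine: "finite e" if "e \<in> ?H" for e
    using that by (auto simp: shore_def hor_def ver_def elim!: rectE)
  have finK: "finite K" using finH fine by (auto simp: K_def V_def)
  have KV: "0 \<le> x \<and> x < int n \<and> 0 \<le> y \<and> y < int n" if v: "(x, y) \<in> K" for x y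
  proof -
    obtain e where e: "e \<in> ?H" "(x, y) \<in> e" using v by (auto simp: K_def V_def)
    then have "e \<in> rect n" by (simp add: shore_def)
    then have "0 \<le> x \<and> x \<le> int n \<and> 0 \<le> y \<and> y < int n"
      using e(2) by (elim rectE) (auto simp: hor_def ver_def)
    moreover have "x \<noteq> int n"
    proof
      assume "x = int n"
      moreover obtain y' where "conn ?H (0, y') (x, y)" using v by (auto simp: K_def)
      ultimately show False using nc by (auto simp: crossing_def)
    qed
    ultimately show ?thesis by auto
  qed
  have K_closed: "e \<subseteq> K" if h: "e \<in> ?H" "e \<inter> K \<noteq> {}" for e
  proof -
    obtain v y where v: "v \<in> e" "conn ?H (0, y) v" using h unfolding K_def by blast
    obtain a b where ab: "e = {a, b}" using h(1) sq.edge rect_subset unfolding shore_def by blast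
    have "conn ?H (0, y) w" if "w \<in> e" for w
    proof (cases "w = v")
      case False
      then have "{v, w} = e" using v(1) that ab by auto
      then show ?thesis using v(2) \<open>e \<in> ?H\<close> conn_step by metis
    qed (use v in simp)
    then show ?thesis using h(1) unfolding K_def V_def by blast
  qed
  have deg: "(\<Sum>v\<in>K. card {e \<in> ?H. v \<in> e}) = (\<Sum>e\<in>?H. card (e \<inter> K))"
  proof -
    have "(\<Sum>v\<in>K. card {e \<in> ?H. v \<in> e}) = (\<Sum>v\<in>K. \<Sum>e\<in>?H. of_bool (v \<in> e))"
      using finH by (intro sum.cong refl) (simp add: Collect_conj_eq)
    also have "\<dots> = (\<Sum>e\<in>?H. \<Sum>v\<in>K. of_bool (v \<in> e))" by (rule sum.swap)
    also have "\<dots> = (\<Sum>e\<in>?H. card (e \<inter> K))"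
      using finK by (intro sum.cong refl) (simp add: Int_commute)
    finally show ?thesis .
  qed
  have "even (\<Sum>e\<in>?H. card (e \<inter> K))"
  proof (rule dvd_sum)
    fix e assume e: "e \<in> ?H"
    then obtain a b where ab: "a \<noteq> b" "e = {a, b}" using sq.edge rect_subset unfolding shore_def by blast
    show "even (card (e \<inter> K))"
    proof (cases "e \<inter> K = {}")
      case False
      then have "e \<inter> K = {a, b}" using K_closed[OF e] ab by auto
      then show ?thesis using ab by simp
    qed simp
  qed
  then have even: "even (\<Sum>v\<in>K. card {e \<in> ?H. v \<in> e})" using deg by simp
  define L where "L = {v \<in> K. fst v = 0}"
  have interior: "even (card {e \<in> ?H. v \<in> e})" if v: "v \<in> K - L" for v
  proof -
    obtain x y where xy: "v = (x, y)" by (cases v)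
    have b: "0 < x" "x < int n" "0 \<le> y" "y < int n" using v KV[of x y] xy by (auto simp: L_def)
    let ?d = "\<lambda>a b. (a, b) \<in> ?D"
    have "{e \<in> ?H. v \<in> e} = {e \<in> {hor (x - 1) y, ver x y, hor x y, ver x (y - 1)}. e \<in> ?H}"
    proof (intro set_eqI iffI)
      fix e assume e: "e \<in> {e \<in> ?H. v \<in> e}"
      then have "e \<in> sq_edges" using rect_subset by (auto simp: shore_def)
      then show "e \<in> {e \<in> {hor (x - 1) y, ver x y, hor x y, ver x (y - 1)}. e \<in> ?H}"
        using e by (elim sq_edgesE) (auto simp: xy mem_hor mem_ver)
    qed (auto simp: xy mem_hor mem_ver)
    also have "card \<dots> = of_bool (hor (x - 1) y \<in> ?H) + of_bool (ver x y \<in> ?H) + of_bool (hor x y \<in> ?H) + of_bool (ver x (y - 1) \<in> ?H)"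
      by (rule card_filter_distinct4) simp
    also have "hor (x - 1) y \<in> ?H \<longleftrightarrow> ?d (x - 1) (y - 1) \<noteq> ?d (x - 1) y" using b by (auto simp: H_hor)
    also have "hor x y \<in> ?H \<longleftrightarrow> ?d x y \<noteq> ?d x (y - 1)" using b by (auto simp: H_hor)
    \<comment> \<open>On the top row the vertical edge is missing from \<open>rect n\<close>, but
      both faces there are dry, so the formula persists. On the bottom row both faces below are
      flooded.\<close>
    also have "ver x y \<in> ?H \<longleftrightarrow> ?d (x - 1) y \<noteq> ?d x y"
    proof (cases "y = int n - 1")
      case True
      then show ?thesis using D_top by (auto simp: H_ver)
    qed (use b in \<open>auto simp: H_ver\<close>)
    also have "ver x (y - 1) \<in> ?H \<longleftrightarrow> ?d x (y - 1) \<noteq> ?d (x - 1) (y - 1)"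
    proof (cases "y = 0")
      case True
      then show ?thesis using D_bottom b by (auto simp: H_ver)
    qed (use b in \<open>auto simp: H_ver\<close>)
    finally show ?thesis by (simp only: even_of_bool_sum4)
  qed
  have left_edge: "\<exists>y. v = (0, y) \<and> hor 0 y \<in> ?H \<and> {e \<in> ?H. v \<in> e} = {hor 0 y}" if h: "v \<in> L" for v
  proof -
    obtain y where y: "v = (0, y)" using h by (cases v) (simp add: L_def)
    obtain e where e: "e \<in> ?H" "v \<in> e" using h unfolding L_def K_def V_def by blast
    have "e' = hor 0 y" if h': "e' \<in> ?H" "v \<in> e'" for e'
    proof -
      have "e' \<in> rect n" using h' by (simp add: shore_def)
      then show ?thesis using h'(2) y by (elim rectE) (auto simp: mem_hor mem_ver)
    qed
    then have "{e \<in> ?H. v \<in> e} = {hor 0 y}" using e by blast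
    then show ?thesis using y by blast
  qed
  have left: "card {e \<in> ?H. v \<in> e} = 1" if "v \<in> L" for v
    using left_edge[OF that] by auto
  \<comment> \<open>Going up the leftmost column of faces, each change between flooded and dry is
    one left vertex of degree 1. The column starts flooded and ends dry, so the number of changes is
    odd.\<close>
  have L_eq: "L = (\<lambda>y. (0 :: int, y)) ` {y. 0 \<le> y \<and> y < int n \<and> ((0, y - 1) \<in> ?D) \<noteq> ((0, y) \<in> ?D)}"
  proof (intro set_eqI iffI)
    fix v assume v: "v \<in> L"
    then obtain y where y: "v = (0, y)" "hor 0 y \<in> ?H" using left_edge by blast
    then show "v \<in> (\<lambda>y. (0 :: int, y)) ` {y. 0 \<le> y \<and> y < int n \<and> ((0, y - 1) \<in> ?D) \<noteq> ((0, y) \<in> ?D)}"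
      unfolding H_hor by blast
  next
    fix v assume "v \<in> (\<lambda>y. (0 :: int, y)) ` {y. 0 \<le> y \<and> y < int n \<and> ((0, y - 1) \<in> ?D) \<noteq> ((0, y) \<in> ?D)}"
    then obtain y where y: "v = (0, y)" "0 \<le> y" "y < int n" "((0, y - 1) \<in> ?D) \<noteq> ((0, y) \<in> ?D)" by auto
    then have "hor 0 y \<in> ?H" using n H_hor by auto
    then have "v \<in> V" using y(1) unfolding V_def by (auto simp: mem_hor intro!: bexI[of _ "hor 0 y"])
    moreover have "\<exists>y. conn ?H (0, y) v" using y(1) by (intro exI[of _ y]) simp
    ultimately show "v \<in> L" using y(1) unfolding L_def K_def by simp
  qed
  have "card L = card {y. 0 \<le> y \<and> y < int n \<and> ((0, y - 1) \<in> ?D) \<noteq> ((0, y) \<in> ?D)}"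
    unfolding L_eq by (rule card_image) (auto simp: inj_on_def)
  then have "odd (card L)"
    using odd_changes[of n "\<lambda>y. (0, y) \<in> ?D"] D_bottom[of 0] D_top[of 0] n by simp
  have "(\<Sum>v\<in>K. card {e \<in> ?H. v \<in> e}) = (\<Sum>v\<in>K - L. card {e \<in> ?H. v \<in> e}) + (\<Sum>v\<in>L. card {e \<in> ?H. v \<in> e})"
    using finK by (intro sum.subset_diff) (auto simp: L_def)
  also have "(\<Sum>v\<in>L. card {e \<in> ?H. v \<in> e}) = card L" using left by simp
  finally have "odd (\<Sum>v\<in>K. card {e \<in> ?H. v \<in> e})"
    using \<open>odd (card L)\<close> interior dvd_sum[of "K - L" 2 "\<lambda>v. card {e \<in> ?H. v \<in> e}"] by auto
  then show False using even by simp
qed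

lemma crossing_no_dual_crossing:
  assumes n: "n \<ge> 1" and A: "A \<subseteq> rect n" and c: "crossing n A"
  shows "\<not> dual_crossing n A"
proof
  assume "dual_crossing n A"
  then obtain f g where fg: "snd f = -1" "snd g = int n - 1" "conn (dual ` (rect n - A)) f g"
    by (auto simp: dual_crossing_def)
  obtain u w where uw: "fst u = 0" "fst w = int n" "conn A u w" using c by (auto simp: crossing_def)
  have "f \<noteq> g" using fg n by auto
  then obtain e where e: "e \<in> rect n" "g \<in> dual e" using conn_in_edge[OF fg(3)] by blast
  then have g: "0 \<le> fst g" "fst g < int n"
    by (auto elim!: rectE simp: dual_hor dual_ver) (auto simp: hor_def ver_def)
  show False
  proof (rule no_crossing_paths[of A "rect n - A" u w f g])
    fix x y assume "ver x y \<in> rect n - A"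
    then show "x \<noteq> fst u \<and> x \<noteq> fst w" using uw by auto
  next
    fix x y assume "hor x y \<in> A"
    then have "hor x y \<in> rect n" using A by blast
    then show "snd f < y \<and> y \<le> snd g" using fg by simp
  qed (use A rect_subset uw fg g in auto)
qed

text \<open>Without a crossing there is a dual crossing, and at 1/2 both are equally likely, so a
  crossing has probability at least 1/2; raising \<open>p\<close> helps. An open crossing excludes
  dual ones, and then the shore itself contains a crossing.\<close>

lemma crossing_likely:
  assumes n: "n \<ge> 1" and p: "1/2 \<le> p" "p \<le> 1"
  shows "1/2 \<le> bprob p (rect n) (\<lambda>A. crossing n (shore n A))"
proof -
  let ?f = "\<lambda>p. bprob p (rect n) (crossing n)"
  have "1 - ?f (1/2) = bprob (1/2) (rect n) (\<lambda>A. \<not> crossing n A)"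
    by (simp add: bprob_not)
  also have "\<dots> \<le> bprob (1/2) (rect n) (dual_crossing n)"
    using shore_crossing[OF n] crossing_mono[OF shore_subset] by (intro bprob_mono) auto
  also have "\<dots> = ?f (1/2)" by (simp add: bprob_dual_crossing)
  finally have "1/2 \<le> ?f (1/2)" by simp
  also have "\<dots> \<le> ?f p"
    using p crossing_mono by (intro bexp_mono_param) (auto simp: of_bool_def)
  also have "\<dots> \<le> bprob p (rect n) (\<lambda>A. crossing n (shore n A))"
    using p crossing_no_dual_crossing[OF n] shore_crossing[OF n] by (intro bprob_mono) auto
  finally show ?thesis .
qed

text \<open>Kesten's three-arm argument on the middle column.\<close>

theorem three_arm_inequality:
  assumes m: "m \<ge> 1" and p: "1/2 \<le> p" "p \<le> 1"
  shows "1/2 \<le> (\<Sum>y<2 * m. 2 * (sq.xit p (ibox m) 0)\<^sup>2 * sq.xit p (ibox y) 0)"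
proof -
  let ?n = "2 * m" and ?E = "rect (2 * m)"
  have p0: "0 \<le> p" using p by simp
  define F where "F = (\<lambda>y :: nat. {I. \<exists>u. fst u = 0 \<and> conn I (int m, int y) u})"
  define F' where "F' = (\<lambda>y :: nat. {J. \<exists>w. fst w = int (2 * m) \<and> conn J (int m, int y) w})"
  define X where "X = (\<lambda>y A. \<exists>I\<in>F y. \<exists>J\<in>F' y. I \<subseteq> A \<and> J \<subseteq> A \<and> I \<inter> J = {})"
  define Z where "Z = (\<lambda>f A. \<exists>g. snd g = -1 \<and> conn (dual ` (?E - A)) f g)"
  \<comment> \<open>The two faces on either side of the edge \<open>hor (int m - 1) y\<close>. One
    of them is flooded if this is a shore edge, which accounts for the factor 2.\<close>
  define face where "face = (\<lambda>(y :: nat, i :: nat). (int m - 1, int y - int i))"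
  have P1: "bprob p ?E (X y) \<le> (sq.xit p (ibox m) 0)\<^sup>2" for y
  proof -
    let ?v = "(int m, int y)" and ?S = "(+) (int m, int y) ` ibox m"
    have out: "v \<notin> ?S" if "\<bar>fst v - int m\<bar> \<ge> int m" for v using that by (cases v) auto
    have xit: "bprob p ?E (\<lambda>A. exits ?S A ?v) \<le> sq.xit p (ibox m) 0"
    proof -
      have "bprob p ?E (\<lambda>A. exits ?S A ?v) \<le> sq.xit p ?S ?v"
        by (intro sq.bprob_exits_le_xit rect_subset p0 p) auto
      also have "\<dots> = sq.xit p (ibox m) 0"
        using sq.xit_translate[of p ?v "ibox m" 0] by simp
      finally show ?thesis .
    qed
    have "bprob p ?E (\<lambda>A. \<exists>I\<in>F y. I \<subseteq> A) \<le> bprob p ?E (\<lambda>A. exits ?S A ?v)"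
    proof (intro bprob_mono p0 p)
      fix A assume "\<exists>I\<in>F y. I \<subseteq> A"
      then obtain I u where I: "I \<subseteq> A" "fst u = 0" "conn I ?v u" by (auto simp: F_def)
      then have "u \<notin> ?S" using out[of u] by simp
      then show "exits ?S A ?v" using conn_mono[OF I(1,3)] unfolding exits_def by blast
    qed
    then have 1: "bprob p ?E (\<lambda>A. \<exists>I\<in>F y. I \<subseteq> A) \<le> sq.xit p (ibox m) 0" using xit by simp
    have "bprob p ?E (\<lambda>A. \<exists>J\<in>F' y. J \<subseteq> A) \<le> bprob p ?E (\<lambda>A. exits ?S A ?v)"
    proof (intro bprob_mono p0 p)
      fix A assume "\<exists>J\<in>F' y. J \<subseteq> A"
      then obtain I u where I: "I \<subseteq> A" "fst u = int (2 * m)" "conn I ?v u" by (auto simp: F'_def)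
      then have "u \<notin> ?S" using out[of u] by simp
      then show "exits ?S A ?v" using conn_mono[OF I(1,3)] unfolding exits_def by blast
    qed
    then have 2: "bprob p ?E (\<lambda>A. \<exists>J\<in>F' y. J \<subseteq> A) \<le> sq.xit p (ibox m) 0" using xit by simp
    have "bprob p ?E (X y) \<le> bprob p ?E (\<lambda>A. \<exists>I\<in>F y. I \<subseteq> A) * bprob p ?E (\<lambda>A. \<exists>J\<in>F' y. J \<subseteq> A)"
      unfolding X_def by (rule BK_inequality[OF finite_rect p0 p(2)])
    also have "\<dots> \<le> sq.xit p (ibox m) 0 * sq.xit p (ibox m) 0"
      using 1 2 by (intro mult_mono sq.xit_nonneg bprob_nonneg p0 p)
    finally show ?thesis by (simp add: power2_eq_square)
  qed
  \<comment> \<open>From row \<open>y - i\<close> to row \<open>-1\<close> there are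
    \<open>y - i + 1 \<ge> y\<close> steps, enough to leave the open box of radius \<open>y\<close>
    around the face.\<close>
  have P2: "bprob p ?E (Z (face (y, i))) \<le> sq.xit p (ibox y) 0" if "i \<in> {0, 1}" for y i
  proof -
    let ?f = "face (y, i)" and ?S = "(+) (face (y, i)) ` ibox y"
    have "bprob p ?E (Z ?f) = bprob p ?E (\<lambda>A. \<exists>g. snd g = -1 \<and> conn (dual ` (?E - A)) ?f g)"
      by (simp add: Z_def)
    also have "\<dots> = bprob (1 - p) ?E (\<lambda>A. \<exists>g. snd g = -1 \<and> conn (dual ` A) ?f g)"
      by (rule bexp_compl)
    also have "\<dots> = bprob (1 - p) (dual ` ?E) (\<lambda>A. \<exists>g. snd g = -1 \<and> conn A ?f g)"
      by (rule bexp_image[symmetric]) (rule inj_on_subset[OF inj_on_dual rect_subset])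
    also have "\<dots> \<le> bprob (1 - p) (dual ` ?E) (\<lambda>A. exits ?S A ?f)"
    proof (intro bprob_mono)
      fix A assume "\<exists>g. snd g = -1 \<and> conn A ?f g"
      then obtain g where g: "snd g = -1" "conn A ?f g" by blast
      then have "g \<notin> ?S" using that by (auto simp: face_def)
      then show "exits ?S A ?f" using g unfolding exits_def by blast
    qed (use p in auto)
    also have "\<dots> \<le> sq.xit (1 - p) ?S ?f"
      using p rect_subset dual_in_sq_edges by (intro sq.bprob_exits_le_xit) auto
    also have "\<dots> = sq.xit (1 - p) (ibox y) 0"
      using sq.xit_translate[of "1 - p" ?f "ibox y" 0] by simp
    also have "\<dots> \<le> sq.xit p (ibox y) 0"
      using p by (intro sq.xit_mono_param) auto
    finally show ?thesis .
  qed
  have X_mono: "X y B" if "A \<subseteq> B" "X y A" for A B y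
    using that unfolding X_def by (meson order.trans)
  have Z_mono: "Z f A" if "A \<subseteq> B" "Z f B" for A B f
  proof -
    have "dual ` (?E - B) \<subseteq> dual ` (?E - A)" using that(1) by auto
    then show ?thesis using that(2) conn_mono unfolding Z_def by metis
  qed
  have "1/2 \<le> bprob p ?E (\<lambda>A. crossing ?n (shore ?n A))"
    using m p by (intro crossing_likely) auto
  also have "\<dots> \<le> (\<Sum>yi\<in>{..<2 * m} \<times> {0, 1}. bprob p ?E (\<lambda>A. X (fst yi) A \<and> Z (face yi) A))"
  proof (rule bprob_Ex_le[OF p0 p(2)])
    fix A assume A: "A \<subseteq> ?E" "crossing ?n (shore ?n A)"
    then obtain u w where uw: "fst u = 0" "fst w = int ?n" "conn (shore ?n A) u w"
      by (auto simp: crossing_def)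
    \<comment> \<open>The crossing is cut at an edge from column \<open>m - 1\<close> to column
      \<open>m\<close>. The witness containing that edge and the one for the remaining piece are
      disjoint, as BK requires.\<close>
    let ?S = "{v :: int \<times> int. fst v < int m}"
    have "u \<in> ?S" "w \<notin> ?S" using uw m by auto
    then obtain a b I J where *: "a \<in> ?S" "b \<notin> ?S" "{a, b} \<in> I" "I \<subseteq> shore ?n A" "J \<subseteq> shore ?n A"
      "I \<inter> J = {}" "conn (inside ?S I) u a" "conn J b w"
      using conn_split[OF uw(3)] by metis
    have ab: "{a, b} \<in> shore ?n A" using * by blast
    then have "{a, b} \<in> rect ?n" by (simp add: shore_def)
    then obtain y where y: "{a, b} = hor (int m - 1) y" "b = (int m, y)" "0 \<le> y" "y < int ?n"
      using *(1,2) by (elim rectE) (auto simp: hor_def ver_def doubleton_eq_iff)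
    define k where "k = nat y"
    have k: "y = int k" "k < 2 * m" using y by (auto simp: k_def)
    have "conn I u b"
      using conn_step[OF conn_mono[OF inside_subset *(7)] *(3)] .
    then have "conn I (int m, int k) u" using conn_sym[of I u b] y(2) k(1) by simp
    then have "I \<in> F k" unfolding F_def using uw(1) by blast
    moreover have "conn J (int m, int k) w" using *(8) y(2) k(1) by simp
    then have "J \<in> F' k" unfolding F'_def using uw(2) by blast
    moreover have "I \<subseteq> A" "J \<subseteq> A" using * shore_subset by blast+
    ultimately have X: "X k A" using *(6) unfolding X_def by blast
    have "crosses (flooded ?n A) (dual (hor (int m - 1) y))" using ab y by (simp add: shore_def)
    then have "(int m - 1, y - 1) \<in> flooded ?n A \<or> (int m - 1, y) \<in> flooded ?n A"
      by (auto simp: dual_hor ver_def crosses_pair)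
    then have "face (k, 1) \<in> flooded ?n A \<or> face (k, 0) \<in> flooded ?n A"
      using k by (simp add: face_def)
    then obtain i where i: "i \<in> {0, 1 :: nat}" "face (k, i) \<in> flooded ?n A"
      by blast
    then obtain c where "conn (dual ` (?E - A)) (c, -1) (face (k, i))" by (auto simp: flooded_def)
    then have "Z (face (k, i)) A" unfolding Z_def using conn_sym by (intro exI[of _ "(c, -1)"]) auto
    then show "\<exists>yi\<in>{..<2 * m} \<times> {0, 1}. X (fst yi) A \<and> Z (face yi) A"
      using X k i by (intro bexI[of _ "(k, i)"]) auto
  qed auto
  also have "\<dots> \<le> (\<Sum>yi\<in>{..<2 * m} \<times> {0, 1 :: nat}. (sq.xit p (ibox m) 0)\<^sup>2 * sq.xit p (ibox (fst yi)) 0)"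
  proof (rule sum_mono)
    fix yi assume yi: "yi \<in> {..<2 * m} \<times> {0, 1 :: nat}"
    have "bprob p ?E (\<lambda>A. X (fst yi) A \<and> Z (face yi) A) \<le> bprob p ?E (X (fst yi)) * bprob p ?E (Z (face yi))"
      by (rule Harris_opposite[OF finite_rect p0 p(2)]) (use X_mono Z_mono in blast)+
    also have "\<dots> \<le> (sq.xit p (ibox m) 0)\<^sup>2 * sq.xit p (ibox (fst yi)) 0"
      using P1[of "fst yi"] P2[of "snd yi" "fst yi"] yi by (intro mult_mono bprob_nonneg p0 p) auto
    finally show "bprob p ?E (\<lambda>A. X (fst yi) A \<and> Z (face yi) A) \<le> \<dots>" .
  qed
  also have "\<dots> = (\<Sum>y<2 * m. 2 * (sq.xit p (ibox m) 0)\<^sup>2 * sq.xit p (ibox y) 0)"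
  proof -
    have "(\<Sum>yi\<in>{..<2 * m} \<times> {0, 1 :: nat}. (sq.xit p (ibox m) 0)\<^sup>2 * sq.xit p (ibox (fst yi)) 0) =
        (\<Sum>y<2 * m. \<Sum>i\<in>{0, 1 :: nat}. (sq.xit p (ibox m) 0)\<^sup>2 * sq.xit p (ibox y) 0)"
      by (simp only: sum.cartesian_product case_prod_unfold)
    then show ?thesis by (simp add: mult.assoc)
  qed
  finally show ?thesis .
qed

subsection \<open>Percolation on the hypercubic lattice\<close>

lemma lattice_adj_commute: "lattice_adj x y \<longleftrightarrow> lattice_adj y x"
  by (simp add: lattice_adj_def abs_minus_commute)

lemma lattice_edge_iff: "{x, y} \<in> lattice_edges \<longleftrightarrow> lattice_adj x y"
proof
  assume "{x, y} \<in> lattice_edges"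
  then obtain a b where "{x, y} = {a, b}" "lattice_adj a b" by (auto simp: lattice_edges_def)
  then show "lattice_adj x y" using lattice_adj_commute[of a b] by (auto simp: doubleton_eq_iff)
qed (auto simp: lattice_edges_def)

lemma lattice_adj_diff:
  assumes "lattice_adj x y"
  shows "\<bar>x $ i - y $ i\<bar> \<le> 1"
proof -
  have "\<bar>x $ i - y $ i\<bar> \<le> (\<Sum>i\<in>UNIV. \<bar>x $ i - y $ i\<bar>)"
    by (rule member_le_sum) auto
  then show ?thesis using assms by (simp add: lattice_adj_def)
qed

lemma vec_box_eq: "{x :: int ^ 'd. \<forall>i. x $ i \<in> X} = (\<lambda>f. \<chi> i. f i) ` (\<Pi>\<^sub>E i\<in>UNIV. X)"
proof (intro set_eqI iffI)
  fix x :: "int ^ 'd" assume "x \<in> {x. \<forall>i. x $ i \<in> X}"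
  moreover have "x = (\<chi> i. ($) x i)" by (simp add: vec_eq_iff)
  ultimately show "x \<in> (\<lambda>f. \<chi> i. f i) ` (\<Pi>\<^sub>E i\<in>UNIV. X)" by (intro image_eqI[of _ _ "($) x"]) auto
qed auto

lemma finite_vec_box: "finite X \<Longrightarrow> finite {x :: int ^ 'd::finite. \<forall>i. x $ i \<in> X}"
  unfolding vec_box_eq by (intro finite_imageI finite_PiE) auto

definition dbox :: "nat \<Rightarrow> (int ^ 'd) set" where
  "dbox R = {x. \<forall>i. \<bar>x $ i\<bar> < int R}"

lemma finite_dbox [simp]: "finite (dbox R :: (int ^ 'd::finite) set)"
proof (rule finite_subset)
  show "dbox R \<subseteq> {x :: int ^ 'd. \<forall>i. x $ i \<in> {- int R..int R}}"
  proof
    fix x :: "int ^ 'd" assume "x \<in> dbox R"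
    then have "\<bar>x $ i\<bar> < int R" for i by (simp add: dbox_def)
    then have "x $ i \<in> {- int R..int R}" for i by (smt (verit) atLeastAtMost_iff)
    then show "x \<in> {x. \<forall>i. x $ i \<in> {- int R..int R}}" by blast
  qed
qed (simp only: finite_vec_box finite_atLeastAtMost_int)

lemma dbox_mono: "m \<le> n \<Longrightarrow> dbox m \<subseteq> dbox n"
  by (auto simp: dbox_def intro: order.strict_trans2)

interpretation ld: translation_graph "lattice_edges :: (int ^ 'd::finite) set set"
proof
  fix e :: "(int ^ 'd) set" and t assume e: "e \<in> lattice_edges"
  then obtain x y where xy: "e = {x, y}" "lattice_adj x y" by (auto simp: lattice_edges_def)
  then have "x \<noteq> y" by (auto simp: lattice_adj_def)
  then show "\<exists>a b. a \<noteq> b \<and> e = {a, b}" using xy by blast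
  have "lattice_adj (t + x) (t + y)" using xy(2) by (simp add: lattice_adj_def)
  then show "(+) t ` e \<in> lattice_edges" using xy(1) by (simp add: lattice_edge_iff)
next
  have "{e \<in> lattice_edges. 0 \<in> e} \<subseteq> (\<lambda>y :: int ^ 'd. {0, y}) ` {y. \<forall>i. y $ i \<in> {-1..1}}"
  proof
    fix e :: "(int ^ 'd) set" assume e: "e \<in> {e \<in> lattice_edges. 0 \<in> e}"
    then obtain x y where xy: "e = {x, y}" "lattice_adj x y" by (auto simp: lattice_edges_def)
    then obtain z where z: "e = {0, z}" using e by auto
    then have "lattice_adj 0 z" using e by (simp add: lattice_edge_iff)
    then have "z $ i \<in> {-1..1}" for i using lattice_adj_diff[of 0 z i] by auto
    then show "e \<in> (\<lambda>y. {0, y}) ` {y. \<forall>i. y $ i \<in> {-1..1}}" using z by auto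
  qed
  then show "finite {e \<in> (lattice_edges :: (int ^ 'd) set set). 0 \<in> e}"
    by (rule finite_subset) (intro finite_imageI finite_vec_box, simp)
qed

lemma conn_walk:
  assumes "conn A x y"
  shows "\<exists>xs. xs \<noteq> [] \<and> hd xs = x \<and> last xs = y \<and> (\<forall>i. Suc i < length xs \<longrightarrow> {xs ! i, xs ! Suc i} \<in> A)"
  using assms
proof (induction rule: conn_induct)
  case refl
  show ?case by (rule exI[of _ "[x]"]) simp
next
  case (step y z)
  then obtain xs where xs: "xs \<noteq> []" "hd xs = x" "last xs = y" "\<forall>i. Suc i < length xs \<longrightarrow> {xs ! i, xs ! Suc i} \<in> A"
    by blast
  have "{(xs @ [z]) ! i, (xs @ [z]) ! Suc i} \<in> A" if i: "Suc i < length (xs @ [z])" for i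
  proof (cases "Suc i < length xs")
    case False
    then have len: "length xs = Suc i" using i by simp
    then have "xs ! i = y" using xs(1,3) by (simp add: last_conv_nth)
    then show ?thesis using step(2) len by (simp add: nth_append)
  qed (use xs in \<open>simp add: nth_append\<close>)
  then show ?case using xs by (intro exI[of _ "xs @ [z]"]) auto
qed

lemma walk_conn:
  assumes "\<forall>i. Suc i < length xs \<longrightarrow> {xs ! i, xs ! Suc i} \<in> A" "i < length xs"
  shows "conn A (xs ! 0) (xs ! i)"
  using assms(2)
proof (induction i)
  case (Suc i)
  then have "conn A (xs ! 0) (xs ! i)" by simp
  moreover have "{xs ! i, xs ! Suc i} \<in> A" using assms(1) Suc.prems by blast
  ultimately show ?case by (rule conn_step)
qed simp

text \<open>A path to the boundary can be stopped when it first leaves \<open>dbox R\<close>;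
  conversely a vertex outside the open box but adjacent to it has sup-norm exactly \<open>R\<close>.
  So the event is decided by finitely many edges.\<close>

lemma connects_iff_exits:
  fixes \<omega> :: "(int ^ 'd::finite) set \<Rightarrow> bool"
  shows "connects \<omega> {0} (box_boundary R) \<longleftrightarrow> exits (dbox R) {e \<in> ld.edges_at (dbox R). \<omega> e} 0"
proof
  let ?A = "{e \<in> lattice_edges. \<omega> e}"
  assume "connects \<omega> {0} (box_boundary R)"
  then obtain xs where xs: "\<forall>i. Suc i < length xs \<longrightarrow> {xs ! i, xs ! Suc i} \<in> ?A"
    "0 \<in> set xs" "set xs \<inter> box_boundary R \<noteq> {}"
    unfolding connects_def by auto
  then obtain i j where ij: "i < length xs" "xs ! i = 0" "j < length xs" "xs ! j \<in> box_boundary R"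
    by (auto simp: in_set_conv_nth)
  have "conn ?A 0 (xs ! j)"
    using conn_trans[OF conn_sym[OF walk_conn[OF xs(1) ij(1)]] walk_conn[OF xs(1) ij(3)]] ij(2) by simp
  moreover have "xs ! j \<notin> dbox R" using ij(4) by (auto simp: box_boundary_def dbox_def) (metis less_irrefl)
  ultimately have "exits (dbox R) ?A 0" by (auto simp: exits_def)
  then have "exits (dbox R) (?A \<inter> ld.edges_at (dbox R)) 0" by (rule ld.exits_first) auto
  moreover have "?A \<inter> ld.edges_at (dbox R) = {e \<in> ld.edges_at (dbox R). \<omega> e}"
    using ld.edges_at_subset by auto
  ultimately show "exits (dbox R) {e \<in> ld.edges_at (dbox R). \<omega> e} 0" by simp
next
  let ?A = "{e \<in> ld.edges_at (dbox R). \<omega> e}"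
  assume "exits (dbox R) ?A 0"
  then obtain v where v: "v \<notin> dbox R" "conn ?A 0 v" by (auto simp: exits_def)
  have "v \<in> box_boundary R"
  proof (cases "v = 0")
    case True
    then have "R = 0" using v(1) by (auto simp: dbox_def)
    then show ?thesis using True by (simp add: box_boundary_def)
  next
    case False
    then obtain e where e: "e \<in> ?A" "v \<in> e" using conn_in_edge[OF v(2)] by blast
    then obtain u where u: "u \<in> e" "u \<in> dbox R" "e \<in> lattice_edges" by (auto simp: ld.edges_at_def)
    have "u \<noteq> v" using u v by auto
    then have "e = {u, v}" using ld.edge[OF u(3)] u(1) e(2) by auto
    then have "lattice_adj u v" using u(3) by (simp add: lattice_edge_iff)
    then have le: "\<bar>v $ i\<bar> \<le> int R" for i
    proof -
      have "\<bar>u $ i - v $ i\<bar> \<le> 1" using \<open>lattice_adj u v\<close> by (rule lattice_adj_diff)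
      moreover have "\<bar>u $ i\<bar> < int R" using u(2) by (simp add: dbox_def)
      ultimately show ?thesis by linarith
    qed
    moreover obtain i where "\<not> \<bar>v $ i\<bar> < int R" using v(1) by (auto simp: dbox_def)
    ultimately show ?thesis unfolding box_boundary_def by (auto intro!: exI[of _ i] antisym)
  qed
  moreover obtain xs where xs: "xs \<noteq> []" "hd xs = 0" "last xs = v"
    "\<forall>i. Suc i < length xs \<longrightarrow> {xs ! i, xs ! Suc i} \<in> ?A"
    using conn_walk[OF v(2)] by blast
  moreover have "0 \<in> set xs" "v \<in> set xs" using xs(1-3) hd_in_set last_in_set by metis+
  ultimately show "connects \<omega> {0} (box_boundary R)"
    unfolding connects_def using ld.edges_at_subset by (intro exI[of _ xs]) blast
qed

section \<open>From the infinite product measure to finite sums\<close>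

lemma measure_perc_finite:
  fixes E :: "(int ^ 'd::finite) set set"
  assumes p: "0 \<le> p" "p \<le> 1" and E: "finite E" "E \<subseteq> lattice_edges"
  shows "measure (perc_measure p) {\<omega> \<in> space (perc_measure p). Q {e \<in> E. \<omega> e}} = bprob p E Q"
proof -
  let ?M = "perc_measure p :: ((int ^ 'd) set \<Rightarrow> bool) measure"
  interpret P: product_prob_space "\<lambda>_. measure_pmf (bernoulli_pmf p)" "lattice_edges :: (int ^ 'd) set set"
    by unfold_locales
  \<comment> \<open>The cylinder event that the open edges of \<open>E\<close> are exactly
    \<open>A\<close>. These cylinders are disjoint, and each has the product weight occurring in
    \<open>bexp\<close>.\<close>
  define C where "C = (\<lambda>A. prod_emb (lattice_edges :: (int ^ 'd) set set) (\<lambda>_. measure_pmf (bernoulli_pmf p)) E (\<Pi>\<^sub>E e\<in>E. {e \<in> A}))"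
  have M: "?M = PiM lattice_edges (\<lambda>_. measure_pmf (bernoulli_pmf p))" by (simp add: perc_measure_def)
  have C: "\<omega> \<in> C A \<longleftrightarrow> \<omega> \<in> space ?M \<and> {e \<in> E. \<omega> e} = A" if "A \<subseteq> E" for A \<omega>
    using that E(2) by (auto simp: C_def M prod_emb_def space_PiM PiE_iff restrict_def extensional_def)
  have meas: "C A \<in> sets ?M" for A
    unfolding C_def M using E by (intro sets_PiM_I) auto
  have prob: "measure ?M (C A) = p ^ card A * (1 - p) ^ card (E - A)" if A: "A \<subseteq> E" for A
  proof -
    have "measure ?M (C A) = (\<Prod>e\<in>E. measure (measure_pmf (bernoulli_pmf p)) {e \<in> A})"
      unfolding M C_def by (rule P.measure_PiM_emb) (use E in auto)
    also have "\<dots> = (\<Prod>e\<in>E. if e \<in> A then p else 1 - p)"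
      using p by (intro prod.cong refl) (simp add: measure_pmf_single)
    also have "\<dots> = (\<Prod>e\<in>A. p) * (\<Prod>e\<in>E - A. 1 - p)"
      using A E(1) by (simp add: prod.If_cases Int_absorb1 Diff_eq Collect_conj_eq)
    finally show ?thesis by simp
  qed
  have "{\<omega> \<in> space ?M. Q {e \<in> E. \<omega> e}} = (\<Union>A\<in>{A \<in> Pow E. Q A}. C A)"
    using C by (auto 0 3)
  then have "measure ?M {\<omega> \<in> space ?M. Q {e \<in> E. \<omega> e}} = measure ?M (\<Union>A\<in>{A \<in> Pow E. Q A}. C A)" by simp
  also have "\<dots> = (\<Sum>A\<in>{A \<in> Pow E. Q A}. measure ?M (C A))"
  proof (rule finite_measure.finite_measure_finite_Union)
    show "finite_measure ?M" unfolding M by unfold_locales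
    show "disjoint_family_on C {A \<in> Pow E. Q A}"
      using C by (auto simp: disjoint_family_on_def)
  qed (use E(1) meas in auto)
  also have "\<dots> = (\<Sum>A\<in>{A \<in> Pow E. Q A}. p ^ card A * (1 - p) ^ card (E - A))"
    using prob by (intro sum.cong) auto
  also have "\<dots> = bprob p E Q"
    unfolding bexp_def using E(1) by (intro sum.mono_neutral_cong_left) auto
  finally show ?thesis .
qed

definition arm :: "('d::finite) itself \<Rightarrow> real \<Rightarrow> nat \<Rightarrow> real" where
  "arm _ p R = ld.xit p (dbox R :: (int ^ 'd) set) 0"

lemma perc_prob_eq_arm:
  assumes "0 \<le> p" "p \<le> 1"
  shows "perc_prob p {0 :: int ^ 'd::finite} (box_boundary R) = arm TYPE('d) p R"
  unfolding perc_prob_def connects_iff_exits arm_def ld.xit_def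
  using assms by (intro measure_perc_finite ld.finite_edges_at ld.edges_at_subset) auto

lemma arm_decseq: "0 \<le> p \<Longrightarrow> p \<le> 1 \<Longrightarrow> decseq (arm D p)"
  unfolding arm_def by (intro monotoneI ld.xit_mono dbox_mono) auto

lemma arm_nonneg: "0 \<le> p \<Longrightarrow> p \<le> 1 \<Longrightarrow> 0 \<le> arm D p R"
  unfolding arm_def by (rule ld.xit_nonneg)

lemma arm_le_1: "0 \<le> p \<Longrightarrow> p \<le> 1 \<Longrightarrow> arm D p R \<le> 1"
  unfolding arm_def by (intro ld.xit_le_1) auto

lemma theta_LIMSEQ:
  fixes D :: "'a::finite itself"
  assumes "0 \<le> p" "p \<le> 1"
  shows "arm D p \<longlonglongrightarrow> perc_theta D p"
proof -
  have "bdd_below (range (arm D p))" using arm_nonneg[OF assms] by (intro bdd_belowI[of _ 0]) auto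
  then have "arm D p \<longlonglongrightarrow> (INF R. arm D p R)" using arm_decseq[OF assms] by (rule LIMSEQ_decseq_INF)
  then have "convergent (arm D p)" by (auto simp: convergent_def)
  moreover have "perc_theta D p = lim (arm D p)"
  proof -
    have "(\<lambda>R. perc_prob p {0 :: int ^ 'a} (box_boundary R)) = arm D p"
      using perc_prob_eq_arm[OF assms, where 'd = 'a] by (simp add: arm_def fun_eq_iff)
    then show ?thesis by (simp add: perc_theta_def)
  qed
  ultimately show ?thesis by (simp add: convergent_LIMSEQ_iff)
qed

lemma theta_le_arm: "0 \<le> p \<Longrightarrow> p \<le> 1 \<Longrightarrow> perc_theta D p \<le> arm D p R"
  by (rule decseq_ge[OF arm_decseq theta_LIMSEQ])

lemma bexp_zero: "finite E \<Longrightarrow> bexp 0 E f = f {}"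
  by (induction E rule: finite_induct) (simp_all add: bexp_insert)

lemma bexp_one: "finite E \<Longrightarrow> bexp 1 E f = f E"
  by (induction E arbitrary: f rule: finite_induct) (simp_all add: bexp_insert)

lemma theta_zero: "perc_theta (D :: 'd::finite itself) 0 = 0"
proof -
  have "\<not> exits (dbox 1) {} (0 :: int ^ 'd)"
    using conn_in_edge[of "{}" "0 :: int ^ 'd"] by (fastforce simp: exits_def dbox_def)
  then have "arm D 0 1 = 0"
    by (simp add: arm_def ld.xit_def bexp_zero ld.finite_edges_at)
  then have "perc_theta D 0 \<le> 0" using theta_le_arm[of 0 D 1] by simp
  moreover have "0 \<le> perc_theta D 0" using theta_LIMSEQ[of 0 D] arm_nonneg[of 0 D] by (intro LIMSEQ_le_const) auto
  ultimately show ?thesis by simp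
qed

lemma pc_bounds: "0 \<le> perc_pc D" "perc_pc D \<le> 1"
  and theta_above_pc: "perc_pc D < p \<Longrightarrow> p \<le> 1 \<Longrightarrow> 0 < perc_theta D p"
proof -
  let ?S = "{p \<in> {0..1}. perc_theta D p = 0}"
  have bdd: "bdd_above ?S" by (rule bdd_aboveI[of _ 1]) auto
  have "0 \<in> ?S" by (simp add: theta_zero)
  then show 0: "0 \<le> perc_pc D" unfolding perc_pc_def by (rule cSup_upper[OF _ bdd])
  show "perc_pc D \<le> 1" unfolding perc_pc_def
  proof (rule cSup_least)
    show "?S \<noteq> {}" using \<open>0 \<in> ?S\<close> by blast
  qed auto
  assume p: "perc_pc D < p" "p \<le> 1"
  have "p \<notin> ?S" using p(1) cSup_upper[OF _ bdd, of p] unfolding perc_pc_def by auto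
  then have "perc_theta D p \<noteq> 0" using p 0 by auto
  moreover have "0 \<le> perc_theta D p"
    using theta_LIMSEQ[of p D] arm_nonneg[of p D] p 0 by (intro LIMSEQ_le_const) auto
  ultimately show "0 < perc_theta D p" by simp
qed

subsection \<open>Decay of the one-arm probability in general dimension\<close>

text \<open>Iterating \<open>phi_recursion\<close> along the multiples of a fixed scale gives
  exponential decay.\<close>

lemma theta_zero_if_phi:
  fixes S :: "(int ^ 'd::finite) set"
  assumes p: "0 \<le> p" "p \<le> 1" and S: "finite S" "0 \<in> S" and phi: "ld.phi p S < 1"
  shows "perc_theta TYPE('d) p = 0"
proof -
  let ?X = "arm TYPE('d) p"
  \<comment> \<open>The outer endpoints of boundary edges are included, so that the box of radius
    \<open>R\<close> around each of them fits into \<open>dbox (R + L)\<close>.\<close>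
  define Y where "Y = S \<union> snd ` ld.bdry S"
  have "finite Y" using S(1) ld.finite_bdry[OF S(1)] by (simp only: Y_def finite_Un finite_imageI simp_thms)
  then have "bdd_above ((\<lambda>(y, i). \<bar>y $ i\<bar>) ` (Y \<times> UNIV))" by (intro bdd_above_finite) auto
  then obtain M where M: "\<And>y i. y \<in> Y \<Longrightarrow> \<bar>y $ i\<bar> \<le> M" by (force simp: bdd_above_def)
  define L where "L = nat M + 1"
  have L: "\<bar>y $ i\<bar> < int L" if "y \<in> Y" for y i using M[OF that, of i] unfolding L_def by linarith
  have phi0: "0 \<le> ld.phi p S"
    unfolding ld.phi_def using p by (intro sum_nonneg) (auto intro!: mult_nonneg_nonneg bprob_nonneg)
  have rec: "?X (R + L) \<le> ld.phi p S * ?X R" for R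
    unfolding arm_def
  proof (rule ld.phi_recursion[OF finite_dbox _ S(2) p])
    show "S \<subseteq> dbox (R + L)"
    proof
      fix v assume "v \<in> S"
      then have "\<bar>v $ i\<bar> < int L" for i by (intro L) (simp add: Y_def)
      then have "\<bar>v $ i\<bar> < int (R + L)" for i by (rule order.strict_trans2) simp
      then show "v \<in> dbox (R + L)" by (simp add: dbox_def)
    qed
    fix x y assume "(x, y) \<in> ld.bdry S"
    then have "y \<in> Y" by (force simp: Y_def)
    have "(+) y ` dbox R \<subseteq> dbox (R + L)"
    proof
      fix v assume "v \<in> (+) y ` dbox R"
      then obtain z where z: "v = y + z" "z \<in> dbox R" by blast
      have "\<bar>y $ i + z $ i\<bar> < int (R + L)" for i
        using L[OF \<open>y \<in> Y\<close>, of i] z(2) abs_triangle_ineq[of "y $ i" "z $ i"] by (auto simp: dbox_def dest: spec[of _ i])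
      then show "v \<in> dbox (R + L)" using z by (simp add: dbox_def)
    qed
    then have "ld.xit p (dbox (R + L)) y \<le> ld.xit p ((+) y ` dbox R) y"
      by (intro ld.xit_mono p) auto
    also have "\<dots> = ld.xit p (dbox R) (0 :: int ^ 'd)" using ld.xit_translate[of p y "dbox R" 0] by simp
    finally show "ld.xit p (dbox (R + L)) y \<le> ld.xit p (dbox R) (0 :: int ^ 'd)" .
  qed
  have pow: "?X (k * L) \<le> ld.phi p S ^ k" for k
  proof (induction k)
    case 0
    show ?case using arm_le_1[OF p] by simp
  next
    case (Suc k)
    have "?X (Suc k * L) = ?X (k * L + L)" by (simp add: add.commute)
    also have "\<dots> \<le> ld.phi p S * ?X (k * L)" by (rule rec)
    also have "\<dots> \<le> ld.phi p S * ld.phi p S ^ k" using Suc phi0 by (rule mult_left_mono)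
    finally show ?case by simp
  qed
  have "(\<lambda>k. ld.phi p S ^ k) \<longlonglongrightarrow> 0" using phi0 phi by (intro LIMSEQ_power_zero) simp
  moreover have "perc_theta TYPE('d) p \<le> ld.phi p S ^ k" for k
    using theta_le_arm[OF p, of "TYPE('d)" "k * L"] pow[of k] by simp
  ultimately have "perc_theta TYPE('d) p \<le> 0" by (intro LIMSEQ_le_const) auto
  moreover have "0 \<le> perc_theta TYPE('d) p"
    by (rule LIMSEQ_le_const[OF theta_LIMSEQ[OF p]]) (use arm_nonneg[OF p] in auto)
  ultimately show ?thesis by simp
qed

text \<open>\<open>phi p S\<close> is a polynomial in \<open>p\<close>. If it were below 1 at the
  critical parameter, it would stay so slightly above, where \<open>perc_theta\<close> is positive,
  against \<open>theta_zero_if_phi\<close>. The hypothesis leaves room above the critical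
  parameter.\<close>

lemma phi_at_pc:
  fixes S :: "(int ^ 'd::finite) set"
  assumes pc: "perc_pc TYPE('d) < 1" and S: "finite S" "0 \<in> S"
  shows "1 \<le> ld.phi (perc_pc TYPE('d)) S"
proof (rule ccontr)
  let ?pc = "perc_pc TYPE('d)"
  assume "\<not> 1 \<le> ld.phi ?pc S"
  moreover have "isCont (\<lambda>p. ld.phi p S) ?pc"
  proof -
    have "continuous_on UNIV (\<lambda>p. ld.phi p S)"
      unfolding ld.phi_def case_prod_unfold by (intro continuous_intros continuous_on_bexp)
    then show ?thesis by (simp add: continuous_on_eq_continuous_at)
  qed
  ultimately have "\<forall>\<^sub>F p in at ?pc. ld.phi p S < 1"
    by (intro order_tendstoD) (auto simp: isCont_def)
  then have "\<forall>\<^sub>F p in at_right ?pc. ld.phi p S < 1" by (rule filter_leD[OF at_le, rotated]) auto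
  moreover have "\<forall>\<^sub>F p in at_right ?pc. p \<in> {?pc<..<1}"
    using pc by (rule eventually_at_right_real)
  ultimately have "\<forall>\<^sub>F p in at_right ?pc. ld.phi p S < 1 \<and> p \<in> {?pc<..<1}" by (rule eventually_conj)
  then obtain p where p: "ld.phi p S < 1" "?pc < p" "p < 1"
    using eventually_happens'[OF trivial_limit_at_right_real] by fastforce
  then have "perc_theta TYPE('d) p = 0"
    using pc_bounds(1)[of "TYPE('d)"] S by (intro theta_zero_if_phi) auto
  then show False using theta_above_pc[of "TYPE('d)" p] p by simp
qed

text \<open>This excludes a critical parameter equal to 1 as soon as the arm probability is assumed
  to decay.\<close>

lemma arm_one: "arm (D :: 'd::finite itself) 1 R = 1"
proof -
  fix i :: 'd
  let ?E = "ld.edges_at (dbox R :: (int ^ 'd) set)"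
  have "conn ?E 0 (axis i (int k))" if "k \<le> R" for k
    using that
  proof (induction k)
    case 0
    have eq: "axis i (int 0) = (0 :: int ^ 'd)" by (simp add: vec_eq_iff axis_def)
    show ?case by (subst eq) (rule conn_refl)
  next
    case (Suc k)
    have "lattice_adj (axis i (int k)) (axis i (int (Suc k)))"
    proof -
      have "\<bar>axis i (int k) $ j - axis i (int (Suc k)) $ j\<bar> = (if j = i then 1 else 0)" for j
        by (simp add: axis_def)
      then show ?thesis by (simp add: lattice_adj_def)
    qed
    moreover have "axis i (int k) \<in> dbox R" using Suc.prems by (auto simp: dbox_def axis_def)
    ultimately have "{axis i (int k), axis i (int (Suc k))} \<in> ?E"
      by (simp add: ld.edges_at_def lattice_edge_iff)
    then show ?case using Suc by (intro conn_step[OF _ \<open>{axis i (int k), axis i (int (Suc k))} \<in> ?E\<close>]) simp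
  qed
  then have "conn ?E 0 (axis i (int R))" by simp
  moreover have "axis i (int R) \<notin> dbox R" by (auto simp: dbox_def axis_def)
  ultimately have "exits (dbox R) ?E 0" by (auto simp: exits_def)
  then show ?thesis by (simp add: arm_def ld.xit_def bexp_one ld.finite_edges_at)
qed

text \<open>The boxes around 0 and \<open>x\<close> are open, so at distance \<open>2 * m\<close> in
  one coordinate no edge meets both.\<close>

lemma two_point_arm:
  fixes x :: "int ^ 'd::finite"
  assumes p: "0 \<le> p" "p \<le> 1" and x: "2 * int m \<le> \<bar>x $ i\<bar>"
  shows "bprob p (ld.edges_at (dbox R)) (\<lambda>A. conn A 0 x) \<le> (arm TYPE('d) p m)\<^sup>2"
proof -
  have "bprob p (ld.edges_at (dbox R)) (\<lambda>A. conn A 0 x) \<le> ld.xit p (dbox m) (0 :: int ^ 'd) * ld.xit p ((+) x ` dbox m) x"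
  proof (intro ld.two_point_bound p)
    show "x \<notin> dbox m" using x by (auto simp: dbox_def intro!: exI[of _ i])
    show "0 \<notin> (+) x ` dbox m"
    proof
      assume "0 \<in> (+) x ` dbox m"
      then obtain z where z: "z \<in> dbox m" "0 = x + z" by blast
      then have "x $ i + z $ i = 0" by (metis vector_add_component zero_index)
      moreover have "\<bar>z $ i\<bar> < int m" using z by (simp add: dbox_def)
      ultimately show False using x by linarith
    qed
    show "ld.edges_at (dbox m) \<inter> ld.edges_at ((+) x ` dbox m) = {}"
    proof (rule ccontr)
      assume "ld.edges_at (dbox m) \<inter> ld.edges_at ((+) x ` dbox m) \<noteq> {}"
      then obtain e where "e \<in> lattice_edges" "e \<inter> dbox m \<noteq> {}" "e \<inter> (+) x ` dbox m \<noteq> {}"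
        unfolding ld.edges_at_def by blast
      then obtain a z where e: "e \<in> lattice_edges" "a \<in> e" "a \<in> dbox m" "x + z \<in> e" "z \<in> dbox m" by blast
      have az: "\<bar>a $ i - (x + z) $ i\<bar> \<le> 1"
      proof (cases "a = x + z")
        case False
        then have "e = {a, x + z}" using ld.edge[OF e(1)] e(2,4) by auto
        then have "lattice_adj a (x + z)" using e(1) by (simp add: lattice_edge_iff)
        then show ?thesis by (rule lattice_adj_diff)
      qed simp
      have "\<bar>a $ i\<bar> < int m" "\<bar>z $ i\<bar> < int m" using e by (simp_all add: dbox_def)
      then show False using az x by (simp add: abs_if split: if_splits)
    qed
  qed auto
  also have "ld.xit p ((+) x ` dbox m) x = ld.xit p (dbox m) (0 :: int ^ 'd)"
    using ld.xit_translate[of p x "dbox m" 0] by simp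
  finally show ?thesis by (simp add: arm_def power2_eq_square)
qed

text \<open>Comparison with an integral, by induction. The step is the weighted mean inequality for
  \<open>R\<close> and \<open>R + 1\<close> with weights \<open>1 - b\<close> and
  \<open>b\<close>.\<close>

lemma sum_powr_le:
  assumes b: "0 < b" "b < 1"
  shows "(\<Sum>k=1..R. real k powr - b) \<le> real R powr (1 - b) / (1 - b)"
proof (induction R)
  case (Suc R)
  have "real R powr (1 - b) + (1 - b) * real (Suc R) powr - b \<le> real (Suc R) powr (1 - b)"
  proof (cases "R = 0")
    case False
    have "real R powr (1 - b) * real (Suc R) powr b \<le> (1 - b) * real R + b * real (Suc R)"
      using False b by (intro Youngs_inequality_0) auto
    also have "\<dots> = real (Suc R) - (1 - b)" by (simp add: algebra_simps)
    finally have "(real R powr (1 - b) * real (Suc R) powr b) * real (Suc R) powr - b \<le>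
        (real (Suc R) - (1 - b)) * real (Suc R) powr - b"
      by (rule mult_right_mono) simp
    also have "(real R powr (1 - b) * real (Suc R) powr b) * real (Suc R) powr - b = real R powr (1 - b)"
      by (simp add: mult.assoc flip: powr_add)
    also have "(real (Suc R) - (1 - b)) * real (Suc R) powr - b = real (Suc R) powr (1 - b) - (1 - b) * real (Suc R) powr - b"
    proof -
      have "real (Suc R) * real (Suc R) powr - b = real (Suc R) powr 1 * real (Suc R) powr - b" by simp
      also have "\<dots> = real (Suc R) powr (1 - b)" by (simp only: powr_add[symmetric]) simp
      finally show ?thesis by (simp only: left_diff_distrib)
    qed
    finally show ?thesis by simp
  qed (use b in simp)
  then have "(real R powr (1 - b) + (1 - b) * real (Suc R) powr - b) / (1 - b) \<le> real (Suc R) powr (1 - b) / (1 - b)"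
    using b by (intro divide_right_mono) auto
  moreover have "(x + (1 - b) * y) / (1 - b) = x / (1 - b) + y" for x y
    using b by (simp add: add_divide_distrib)
  ultimately have "real R powr (1 - b) / (1 - b) + real (Suc R) powr - b \<le> real (Suc R) powr (1 - b) / (1 - b)"
    by simp
  then show ?case using Suc by simp
qed simp

lemma sum_powr_interval:
  "(\<Sum>k\<in>{- int R..int R}. max 1 (real_of_int \<bar>k\<bar>) powr - b) = 1 + 2 * (\<Sum>k=1..R. real k powr - b)"
proof (induction R)
  case (Suc R)
  have "{- int (Suc R)..int (Suc R)} = insert (- int (Suc R)) (insert (int (Suc R)) {- int R..int R})" by auto
  then show ?case using Suc by (simp add: algebra_simps)
qed simp

lemma sum_prod_vec_box:
  assumes "finite X"
  shows "(\<Sum>x\<in>{x :: int ^ 'd::finite. \<forall>i. x $ i \<in> X}. \<Prod>i\<in>UNIV. w (x $ i)) = (\<Sum>k\<in>X. w k :: real) ^ CARD('d)"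
proof -
  have inj: "inj_on (\<lambda>f. \<chi> i. f i) (\<Pi>\<^sub>E i\<in>(UNIV :: 'd set). X)"
    by (auto simp: inj_on_def vec_eq_iff)
  have "(\<Sum>x\<in>{x :: int ^ 'd. \<forall>i. x $ i \<in> X}. \<Prod>i\<in>UNIV. w (x $ i)) = (\<Sum>f\<in>(\<Pi>\<^sub>E i\<in>UNIV. X). \<Prod>i\<in>(UNIV :: 'd set). w (f i))"
    unfolding vec_box_eq by (subst sum.reindex[OF inj]) simp
  also have "\<dots> = (\<Prod>i\<in>(UNIV :: 'd set). \<Sum>k\<in>X. w k)"
    using assms by (intro prod_sum_PiE[symmetric]) auto
  finally show ?thesis by simp
qed

text \<open>Here the maximum norm in the two-point bound is split into a product over the coordinates.\<close>

lemma two_point_weight: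
  fixes x :: "int ^ 'd::finite"
  assumes p: "0 \<le> p" "p \<le> 1" and C: "C \<ge> 0" and \<eta>: "\<eta> \<ge> 0"
    and arm: "\<And>R. arm TYPE('d) p R \<le> C * max 1 (real R) powr - \<eta>"
  shows "bprob p (ld.edges_at (dbox R)) (\<lambda>A. conn A 0 x) \<le>
    C\<^sup>2 * 3 powr (2 * \<eta>) * (\<Prod>i\<in>UNIV. max 1 (real_of_int \<bar>x $ i\<bar>) powr - (2 * \<eta> / CARD('d)))"
proof -
  define s where "s = Max (range (\<lambda>i. \<bar>x $ i\<bar>))"
  have le_s: "\<bar>x $ i\<bar> \<le> s" for i unfolding s_def by (intro Max_ge) auto
  have "s \<in> range (\<lambda>i. \<bar>x $ i\<bar>)" unfolding s_def by (intro Max_in) auto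
  then obtain i where i: "\<bar>x $ i\<bar> = s" by auto
  have s0: "0 \<le> s" using i abs_ge_zero by metis
  define m where "m = nat (s div 2)"
  have m: "2 * int m \<le> s" "s \<le> 2 * int m + 1" using s0 by (auto simp: m_def)
  define t where "t = max 1 (real_of_int s)"
  have t: "t \<ge> 1" by (simp add: t_def)
  \<comment> \<open>Rounding in \<open>s div 2\<close> produces the constant 3, through
    \<open>s \<le> 2 * m + 1 \<le> 3 * max 1 m\<close>.\<close>
  have mt: "t / 3 \<le> max 1 (real m)"
  proof -
    have "s \<le> 3 * max 1 (int m)" using m by auto
    then have "real_of_int s \<le> 3 * max 1 (real m)" by (simp add: max_def split: if_splits)
    then show ?thesis by (auto simp: t_def)
  qed
  have "bprob p (ld.edges_at (dbox R)) (\<lambda>A. conn A 0 x) \<le> (arm TYPE('d) p m)\<^sup>2"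
    using m i by (intro two_point_arm[OF p, of m x i]) simp
  also have "\<dots> \<le> (C * max 1 (real m) powr - \<eta>)\<^sup>2"
    using arm_nonneg[OF p] arm by (intro power_mono) auto
  also have "\<dots> = C\<^sup>2 * max 1 (real m) powr - (2 * \<eta>)"
    by (simp add: power_mult_distrib power2_eq_square flip: powr_add)
  also have "\<dots> \<le> C\<^sup>2 * (t / 3) powr - (2 * \<eta>)"
    using mt t \<eta> by (intro mult_left_mono powr_mono2') auto
  also have "(t / 3) powr - (2 * \<eta>) = 3 powr (2 * \<eta>) * t powr - (2 * \<eta>)"
    using t by (simp add: powr_divide powr_minus field_simps)
  also have "t powr - (2 * \<eta>) = (\<Prod>i\<in>(UNIV :: 'd set). t powr - (2 * \<eta> / CARD('d)))"
    using t by (simp add: powr_realpow[symmetric] powr_powr powr_power)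
  also have "C\<^sup>2 * (3 powr (2 * \<eta>) * \<dots>) \<le>
      C\<^sup>2 * (3 powr (2 * \<eta>) * (\<Prod>i\<in>UNIV. max 1 (real_of_int \<bar>x $ i\<bar>) powr - (2 * \<eta> / CARD('d))))"
  proof (intro mult_left_mono prod_mono conjI)
    fix i
    have "max 1 (real_of_int \<bar>x $ i\<bar>) \<le> t" using le_s[of i] by (auto simp: t_def)
    then show "t powr - (2 * \<eta> / CARD('d)) \<le> max 1 (real_of_int \<bar>x $ i\<bar>) powr - (2 * \<eta> / CARD('d))"
      using \<eta> by (intro powr_mono2') auto
  qed auto
  finally show ?thesis by (simp add: mult.assoc)
qed

lemma edges_at_dbox_subset:
  assumes "e \<in> ld.edges_at (dbox R :: (int ^ 'd::finite) set)"
  shows "e \<subseteq> {x. \<forall>i. x $ i \<in> {- int R..int R}}"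
proof
  fix v assume v: "v \<in> e"
  obtain u where u: "u \<in> e" "u \<in> dbox R" "e \<in> lattice_edges" using assms by (auto simp: ld.edges_at_def)
  have "\<bar>u $ i - v $ i\<bar> \<le> 1" for i
  proof (cases "u = v")
    case False
    then have "e = {u, v}" using ld.edge[OF u(3)] u(1) v by auto
    then have "lattice_adj u v" using u(3) by (simp add: lattice_edge_iff)
    then show ?thesis by (rule lattice_adj_diff)
  qed simp
  note d = this
  have "\<bar>v $ i\<bar> \<le> int R" for i
  proof -
    have "\<bar>u $ i\<bar> < int R" using u(2) by (simp add: dbox_def)
    then show ?thesis using d[of i] by linarith
  qed
  then have "- int R \<le> v $ i \<and> v $ i \<le> int R" for i by (meson abs_le_iff minus_le_iff)
  then show "v \<in> {x. \<forall>i. x $ i \<in> {- int R..int R}}" by simp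
qed

text \<open>The upper bound on \<open>\<eta>\<close> keeps the exponent \<open>b\<close> of each
  coordinate below 1, so that each coordinate sum is of order \<open>R powr (1 - b)\<close> and
  their product has order \<open>R\<close> to the power \<open>d - 2 * \<eta>\<close>.\<close>

theorem no_fast_decay_general:
  assumes \<eta>: "real CARD('d::finite) / 3 < \<eta>" "\<eta> < real CARD('d) / 2" and C: "C \<ge> 0"
    and arm: "\<And>R. arm TYPE('d) (perc_pc TYPE('d)) R \<le> C * max 1 (real R) powr - \<eta>"
  shows False
proof -
  let ?pc = "perc_pc TYPE('d)" and ?d = "real CARD('d)"
  let ?X = "arm TYPE('d) ?pc"
  note pc = pc_bounds[of "TYPE('d)"]
  have d: "?d \<ge> 1" by (simp add: Suc_leI)
  have \<eta>0: "\<eta> > 0" using \<eta>(1) d by simp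
  have "((\<lambda>R. C * R powr - \<eta>) \<longlongrightarrow> 0) at_top"
    using \<eta>0 by real_asymp
  then have lim: "(\<lambda>R. C * real R powr - \<eta>) \<longlonglongrightarrow> 0"
    by (rule filterlim_compose[OF _ filterlim_real_sequentially])
  have up: "\<forall>\<^sub>F R in sequentially. ?X R \<le> C * real R powr - \<eta>"
    using eventually_ge_at_top[of "1 :: nat"]
  proof eventually_elim
    case (elim R)
    then have "max 1 (real R) = real R" by simp
    then show ?case using arm[of R] by simp
  qed
  have lo: "\<forall>\<^sub>F R in sequentially. 0 \<le> ?X R"
    by (rule always_eventually) (intro allI arm_nonneg pc)
  have X0: "?X \<longlonglongrightarrow> 0" by (rule tendsto_sandwich[OF lo up tendsto_const lim])
  have "?pc \<noteq> 1" 
  proof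
    assume "?pc = 1"
    then have "?X = (\<lambda>_. 1)" by (simp add: arm_one fun_eq_iff)
    then show False using X0 LIMSEQ_unique[OF tendsto_const, of "1 :: real" 0] by simp
  qed
  then have pc1: "?pc < 1" using pc by simp
  define b where "b = 2 * \<eta> / ?d"
  have b: "0 < b" "b < 1" using \<eta> \<eta>0 d by (auto simp: b_def field_simps)
  define K where "K = real (translation_graph.deg (lattice_edges :: (int ^ 'd) set set)) * (C\<^sup>2 * 3 powr (2 * \<eta>))"
  have K: "0 \<le> K" by (simp add: K_def)
  define B where "B = (1 + 2 / (1 - b)) ^ CARD('d)"
  have B: "0 \<le> B" using b by (simp add: B_def)
  have main: "(1 - ?X R)\<^sup>2 \<le> C * K * B * real R powr (?d - 3 * \<eta>)" if R: "R \<ge> 1" for R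
  proof -
    let ?V = "{x :: int ^ 'd. \<forall>i. x $ i \<in> {- int R..int R}}"
    have "(1 - ?X R)\<^sup>2 \<le> ?X R * (real (translation_graph.deg (lattice_edges :: (int ^ 'd) set set)) * (\<Sum>x\<in>?V. bprob ?pc (ld.edges_at (dbox R)) (\<lambda>A. conn A 0 x)))"
      unfolding arm_def
    proof (rule ld.exits_cluster_size[OF finite_dbox _ edges_at_dbox_subset pc])
      show "finite ?V" by (rule finite_vec_box) simp
      show "0 \<in> dbox R" using R by (simp add: dbox_def)
      fix S :: "(int ^ 'd) set" assume "S \<subseteq> dbox R" "0 \<in> S"
      then show "1 \<le> ld.phi ?pc S" using finite_subset[OF _ finite_dbox] by (intro phi_at_pc pc1) auto
    qed
    also have "\<dots> \<le> (C * real R powr - \<eta>) * (K * (B * (real R powr (1 - b)) ^ CARD('d)))"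
    proof (rule mult_mono)
      show "?X R \<le> C * real R powr - \<eta>" using arm[of R] R by (simp add: max_def)
      have "(\<Sum>x\<in>?V. bprob ?pc (ld.edges_at (dbox R)) (\<lambda>A. conn A 0 x)) \<le>
          (\<Sum>x\<in>?V. C\<^sup>2 * 3 powr (2 * \<eta>) * (\<Prod>i\<in>UNIV. max 1 (real_of_int \<bar>x $ i\<bar>) powr - b))"
        unfolding b_def using \<eta>0 by (intro sum_mono two_point_weight pc C arm) auto
      also have "\<dots> = C\<^sup>2 * 3 powr (2 * \<eta>) * (\<Sum>x\<in>?V. \<Prod>i\<in>UNIV. max 1 (real_of_int \<bar>x $ i\<bar>) powr - b)"
        by (rule sum_distrib_left[symmetric])
      also have "(\<Sum>x\<in>?V. \<Prod>i\<in>UNIV. max 1 (real_of_int \<bar>x $ i\<bar>) powr - b) =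
          (\<Sum>k\<in>{- int R..int R}. max 1 (real_of_int \<bar>k\<bar>) powr - b) ^ CARD('d)"
        by (rule sum_prod_vec_box) simp
      also have "C\<^sup>2 * 3 powr (2 * \<eta>) * \<dots> \<le>
          C\<^sup>2 * 3 powr (2 * \<eta>) * ((1 + 2 / (1 - b)) * real R powr (1 - b)) ^ CARD('d)"
      proof (intro mult_left_mono power_mono)
        let ?Q = "real R powr (1 - b)"
        have "1 \<le> ?Q" using R b by (simp add: ge_one_powr_ge_zero)
        moreover have "(\<Sum>k=1..R. real k powr - b) \<le> ?Q / (1 - b)" by (rule sum_powr_le[OF b])
        moreover have "(1 + 2 / (1 - b)) * ?Q = ?Q + 2 * (?Q / (1 - b))" by (simp add: distrib_right)
        ultimately show "(\<Sum>k\<in>{- int R..int R}. max 1 (real_of_int \<bar>k\<bar>) powr - b) \<le> (1 + 2 / (1 - b)) * ?Q"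
          unfolding sum_powr_interval by linarith
      qed (auto intro: sum_nonneg)
      finally have "(\<Sum>x\<in>?V. bprob ?pc (ld.edges_at (dbox R)) (\<lambda>A. conn A 0 x)) \<le>
          C\<^sup>2 * 3 powr (2 * \<eta>) * ((1 + 2 / (1 - b)) * real R powr (1 - b)) ^ CARD('d)" .
      then show "real (translation_graph.deg (lattice_edges :: (int ^ 'd) set set)) * (\<Sum>x\<in>?V. bprob ?pc (ld.edges_at (dbox R)) (\<lambda>A. conn A 0 x)) \<le>
          K * (B * (real R powr (1 - b)) ^ CARD('d))"
        unfolding K_def B_def by (simp add: power_mult_distrib mult_left_mono mult.assoc)
    qed (auto intro!: mult_nonneg_nonneg sum_nonneg bprob_nonneg pc C)
    also have "\<dots> = C * K * B * real R powr (?d - 3 * \<eta>)"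
    proof -
      have "(real R powr (1 - b)) ^ CARD('d) = real R powr (?d - 2 * \<eta>)"
      proof -
        have "(1 - b) * ?d = ?d - 2 * \<eta>" using d by (simp add: b_def left_diff_distrib)
        moreover have "(real R powr (1 - b)) ^ CARD('d) = real R powr ((1 - b) * ?d)"
          using R by (simp add: powr_realpow[symmetric] powr_powr)
        ultimately show ?thesis by simp
      qed
      moreover have "real R powr - \<eta> * real R powr (?d - 2 * \<eta>) = real R powr (?d - 3 * \<eta>)"
        by (simp flip: powr_add)
      ultimately show ?thesis by (simp add: mult_ac)
    qed
    finally show ?thesis .
  qed
  have neg: "?d - 3 * \<eta> < 0" using \<eta>(1) by simp
  have "((\<lambda>R. C * K * B * R powr e) \<longlongrightarrow> 0) at_top" if "e < 0" for e :: real
    using that by real_asymp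
  then have lim0: "(\<lambda>R. C * K * B * real R powr (?d - 3 * \<eta>)) \<longlonglongrightarrow> 0"
    using neg by (intro filterlim_compose[OF _ filterlim_real_sequentially]) blast
  have lim1: "(\<lambda>R. (1 - ?X R)\<^sup>2) \<longlonglongrightarrow> (1 - 0)\<^sup>2" by (intro tendsto_intros X0)
  have "(1 - 0)\<^sup>2 \<le> (0 :: real)"
    by (rule LIMSEQ_le[OF lim1 lim0]) (use main in blast)
  then show False by simp
qed

subsection \<open>Decay of the one-arm probability in the plane\<close>

lemma sq_edge_iff: "{(a, b), (c, d)} \<in> sq_edges \<longleftrightarrow> \<bar>a - c\<bar> + \<bar>b - d\<bar> = 1"
proof
  assume "{(a, b), (c, d)} \<in> sq_edges"
  then show "\<bar>a - c\<bar> + \<bar>b - d\<bar> = 1"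
    by (elim sq_edgesE) (auto simp: hor_def ver_def doubleton_eq_iff)
next
  assume "\<bar>a - c\<bar> + \<bar>b - d\<bar> = 1"
  then consider "c = a + 1" "d = b" | "a = c + 1" "d = b" | "c = a" "d = b + 1" | "c = a" "b = d + 1"
    by linarith
  then show "{(a, b), (c, d)} \<in> sq_edges"
  proof cases
    case 1
    then have "{(a, b), (c, d)} = hor a b" by (simp add: hor_def)
    then show ?thesis by simp
  next
    case 2
    then have "{(a, b), (c, d)} = hor c d" by (auto simp: hor_def)
    then show ?thesis by simp
  next
    case 3
    then have "{(a, b), (c, d)} = ver a b" by (simp add: ver_def)
    then show ?thesis by simp
  next
    case 4
    then have "{(a, b), (c, d)} = ver c d" by (auto simp: ver_def)
    then show ?thesis by simp
  qed
qed

lemma exits_image: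
  assumes "bij h"
  shows "exits (h ` S) ((`) h ` A) (h x) \<longleftrightarrow> exits S A x"
proof -
  have "exits (h ` S) ((`) h ` A) (h x) \<longleftrightarrow> (\<exists>v. h v \<notin> h ` S \<and> conn ((`) h ` A) (h x) (h v))"
    unfolding exits_def using bij_is_surj[OF assms] by (metis surjD)
  then show ?thesis
    unfolding exits_def using bij_is_inj[OF assms] by (simp add: conn_image_iff inj_image_mem_iff)
qed

text \<open>The two elements of the index type serve as first and second coordinate; the resulting
  bijection with pairs of integers carries edges to edges and boxes to boxes.\<close>

lemma arm_two_dim:
  assumes "CARD('d::finite) = 2"
  shows "arm TYPE('d) p R = sq.xit p (ibox R) 0"
proof -
  obtain i j :: 'd where ij: "UNIV = {i, j}" "i \<noteq> j" using assms by (auto simp: card_2_iff)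
  define h where "h = (\<lambda>x :: int ^ 'd. (x $ i, x $ j))"
  define g where "g = (\<lambda>v :: int \<times> int. (\<chi> k. if k = i then fst v else snd v) :: int ^ 'd)"
  have all: "(\<forall>k. P k) \<longleftrightarrow> P i \<and> P j" for P
  proof
    assume *: "P i \<and> P j"
    have "k = i \<or> k = j" for k using ij(1) by blast
    then show "\<forall>k. P k" using * by metis
  qed simp
  have gh: "g (h x) = x" for x using ij(2) by (simp add: g_def h_def vec_eq_iff all)
  have hg: "h (g v) = v" for v using ij(2) by (simp add: g_def h_def)
  have "inj h" by (rule inj_on_inverseI[of _ g]) (simp add: gh)
  moreover have "surj h" by (rule surjI[of h g]) (simp add: hg)
  ultimately have bij: "bij h" by (simp add: bij_def)
  have edge: "{x, y} \<in> lattice_edges \<longleftrightarrow> {h x, h y} \<in> sq_edges" for x y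
    using ij(2) by (simp add: lattice_edge_iff lattice_adj_def ij(1) h_def sq_edge_iff)
  have G: "(`) h ` lattice_edges = sq_edges"
  proof (intro set_eqI iffI)
    fix e assume "e \<in> (`) h ` lattice_edges"
    then obtain x y where "e = {h x, h y}" "{x, y} \<in> lattice_edges"
      by (auto simp: lattice_edges_def)
    then show "e \<in> sq_edges" using edge by simp
  next
    fix e assume e: "e \<in> sq_edges"
    then obtain a b where ab: "e = {a, b}" using sq.edge by blast
    then have "{g a, g b} \<in> lattice_edges" using e by (simp add: edge hg)
    moreover have "e = h ` {g a, g b}" using ab by (simp add: hg)
    ultimately show "e \<in> (`) h ` lattice_edges" by blast
  qed
  have B: "h ` dbox R = ibox R"
  proof (intro set_eqI iffI)
    fix v assume "v \<in> ibox R"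
    then have "g v \<in> dbox R" using ij(2) by (cases v) (simp add: dbox_def g_def all)
    then show "v \<in> h ` dbox R" using hg[of v] by (metis imageI)
  qed (auto simp: dbox_def h_def)
  have E: "(`) h ` ld.edges_at (dbox R) = sq.edges_at (ibox R)"
  proof -
    have "(`) h ` ld.edges_at (dbox R) = {e \<in> (`) h ` lattice_edges. e \<inter> h ` dbox R \<noteq> {}}"
      unfolding ld.edges_at_def using image_Int[OF bij_is_inj[OF bij]] by (auto intro!: imageI)
    then show ?thesis by (simp add: G B sq.edges_at_def)
  qed
  have h0: "h 0 = 0" by (simp add: h_def zero_prod_def)
  have "inj_on ((`) h) (ld.edges_at (dbox R))"
    using bij_is_inj[OF bij] by (intro inj_on_image) (auto intro: inj_on_subset)
  then have "bprob p ((`) h ` ld.edges_at (dbox R)) (\<lambda>A. exits (h ` dbox R) A (h 0)) =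
      ld.xit p (dbox R) (0 :: int ^ 'd)"
    by (simp only: bexp_image exits_image[OF bij] ld.xit_def)
  then show ?thesis unfolding E B h0 by (simp add: arm_def sq.xit_def)
qed

lemma pc_two_dim:
  assumes "CARD('d::finite) = 2"
  shows "1/2 \<le> perc_pc TYPE('d)"
proof (rule ccontr)
  assume "\<not> ?thesis"
  then have "0 < perc_theta TYPE('d) (1/2)" by (intro theta_above_pc) auto
  then obtain n where "sq.xit (1/2) (ibox n) 0 < perc_theta TYPE('d) (1/2)"
    using theta_half_zero by blast
  moreover have "perc_theta TYPE('d) (1/2) \<le> arm TYPE('d) (1/2) n" by (rule theta_le_arm) auto
  ultimately show False using arm_two_dim[OF assms] by simp
qed

text \<open>The bound \<open>\<eta> < 1\<close> puts the sum of \<open>y powr - \<eta>\<close> over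
  the heights \<open>y < 2 * m\<close> at order \<open>m powr (1 - \<eta>)\<close>, so the three-arm
  inequality would force \<open>m powr (1 - 3 * \<eta>)\<close> to stay away from 0.\<close>

theorem no_fast_decay_planar:
  assumes d: "CARD('d::finite) = 2" and \<eta>: "1/3 < \<eta>" "\<eta> < 1" and C: "C \<ge> 0"
    and arm: "\<And>R. arm TYPE('d) (perc_pc TYPE('d)) R \<le> C * max 1 (real R) powr - \<eta>"
  shows False
proof -
  let ?X = "arm TYPE('d) (perc_pc TYPE('d))"
  note pc = pc_bounds[of "TYPE('d)"]
  define K where "K = 2 * C\<^sup>2 * C * (1 + 2 / (1 - \<eta>))"
  have main: "1/2 \<le> K * real m powr (1 - 3 * \<eta>)" if m: "m \<ge> 1" for m
  proof -
    have "1/2 \<le> (\<Sum>y<2 * m. 2 * (?X m)\<^sup>2 * ?X y)"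
      using three_arm_inequality[OF m pc_two_dim[OF d] pc(2)] by (simp add: arm_two_dim[OF d])
    also have "\<dots> \<le> (\<Sum>y<2 * m. 2 * (C * real m powr - \<eta>)\<^sup>2 * (C * max 1 (real y) powr - \<eta>))"
      using arm arm[of m] m arm_nonneg[OF pc] C
      by (intro sum_mono mult_mono power_mono mult_nonneg_nonneg) (auto simp: max_def)
    also have "\<dots> = 2 * (C * real m powr - \<eta>)\<^sup>2 * C * (\<Sum>y<2 * m. max 1 (real y) powr - \<eta>)"
      by (simp add: sum_distrib_left mult_ac)
    also have "\<dots> \<le> 2 * (C * real m powr - \<eta>)\<^sup>2 * C * ((1 + 2 / (1 - \<eta>)) * real m powr (1 - \<eta>))"
    proof (rule mult_left_mono)
      have "{..<2 * m} = insert 0 {1..<2 * m}" using m by auto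
      then have "(\<Sum>y<2 * m. max 1 (real y) powr - \<eta>) = 1 + (\<Sum>y\<in>{1..<2 * m}. max 1 (real y) powr - \<eta>)" by simp
      also have "(\<Sum>y\<in>{1..<2 * m}. max 1 (real y) powr - \<eta>) = (\<Sum>y\<in>{1..<2 * m}. real y powr - \<eta>)"
        by (intro sum.cong) (auto simp: max_def)
      also have "\<dots> \<le> (\<Sum>y=1..2 * m. real y powr - \<eta>)" by (intro sum_mono2) auto
      also have "\<dots> \<le> real (2 * m) powr (1 - \<eta>) / (1 - \<eta>)" using \<eta> by (intro sum_powr_le) auto
      also have "real (2 * m) powr (1 - \<eta>) = 2 powr (1 - \<eta>) * real m powr (1 - \<eta>)"
        by (simp add: powr_mult)
      also have "2 powr (1 - \<eta>) * real m powr (1 - \<eta>) \<le> 2 * real m powr (1 - \<eta>)"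
        using \<eta> powr_mono[of "1 - \<eta>" 1 2] by (intro mult_right_mono) auto
      finally have "(\<Sum>y<2 * m. max 1 (real y) powr - \<eta>) \<le> 1 + 2 * real m powr (1 - \<eta>) / (1 - \<eta>)"
        using \<eta> by (simp add: divide_right_mono)
      moreover have "1 \<le> real m powr (1 - \<eta>)" using m \<eta> by (simp add: ge_one_powr_ge_zero)
      moreover have "(1 + 2 / (1 - \<eta>)) * real m powr (1 - \<eta>) =
          real m powr (1 - \<eta>) + 2 * real m powr (1 - \<eta>) / (1 - \<eta>)"
        by (simp add: distrib_right)
      ultimately show "(\<Sum>y<2 * m. max 1 (real y) powr - \<eta>) \<le> (1 + 2 / (1 - \<eta>)) * real m powr (1 - \<eta>)"
        by linarith
    qed (use C in auto)
    also have "\<dots> = K * (real m powr - \<eta> * real m powr - \<eta> * real m powr (1 - \<eta>))"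
      by (simp add: K_def power2_eq_square mult_ac)
    also have "real m powr - \<eta> * real m powr - \<eta> * real m powr (1 - \<eta>) = real m powr (1 - 3 * \<eta>)"
      by (simp flip: powr_add)
    finally show ?thesis .
  qed
  have "((\<lambda>R. K * R powr e) \<longlongrightarrow> 0) at_top" if "e < 0" for e :: real
    using that by real_asymp
  then have "(\<lambda>m. K * real m powr (1 - 3 * \<eta>)) \<longlonglongrightarrow> 0"
    using \<eta> by (intro filterlim_compose[OF _ filterlim_real_sequentially]) simp
  then have "1/2 \<le> (0 :: real)"
    by (rule LIMSEQ_le_const) (use main in auto)
  then show False by simp
qed

text \<open>A lower limit above \<open>c\<close> leaves room for some \<open>\<eta> > c\<close>
  valid at all large scales, and \<open>C\<close> absorbs the others. The form
  \<open>max 1 (real R)\<close> matters at \<open>R = 0\<close>, where \<open>powr\<close> would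
  give 0 against a probability equal to 1.\<close>

lemma fast_decay_of_exponent:
  assumes "ereal c < one_arm_exponent TYPE('d::finite)" "0 \<le> c"
  shows "\<exists>\<eta> C. c < \<eta> \<and> 0 \<le> C \<and>
    (\<forall>R. arm TYPE('d) (perc_pc TYPE('d)) R \<le> C * max 1 (real R) powr - \<eta>)"
proof -
  let ?X = "arm TYPE('d) (perc_pc TYPE('d))"
  note pc = pc_bounds[of "TYPE('d)"]
  obtain \<eta> where \<eta>: "ereal c < ereal \<eta>" "ereal \<eta> < one_arm_exponent TYPE('d)"
    using ereal_dense2[OF assms(1)] by blast
  then have c\<eta>: "c < \<eta>" by simp
  have "\<forall>\<^sub>F R in sequentially. ereal \<eta> < ereal (- ln (?X R) / ln (real R))"
    using less_LiminfD[OF \<eta>(2)[unfolded one_arm_exponent_def]] by (simp add: perc_prob_eq_arm[OF pc])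
  then obtain R0 where R0: "\<And>R. R \<ge> R0 \<Longrightarrow> \<eta> < - ln (?X R) / ln (real R)"
    by (auto simp: eventually_sequentially)
  \<comment> \<open>From 2 on the denominator \<open>ln (real R)\<close> is positive.\<close>
  define N where "N = max R0 2"
  have decay: "?X R \<le> real R powr - \<eta>" if R: "R \<ge> N" for R
  proof -
    have lnR: "ln (real R) > 0" using R by (simp add: N_def)
    have "\<eta> < - ln (?X R) / ln (real R)" using R by (intro R0) (simp add: N_def)
    then have lt: "\<eta> * ln (real R) < - ln (?X R)" using lnR by (simp only: pos_less_divide_eq)
    show ?thesis
    \<comment> \<open>At probability 0 the logarithm is only a default value, but the bound is
      trivial there.\<close>
    proof (cases "?X R = 0")
      case False
      then have "0 < ?X R" using arm_nonneg[OF pc, of "TYPE('d)" R] by simp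
      moreover have "ln (?X R) \<le> - \<eta> * ln (real R)" using lt by simp
      ultimately have "?X R \<le> exp (- \<eta> * ln (real R))" by (metis exp_le_cancel_iff exp_ln)
      then show ?thesis using R by (simp add: powr_def N_def)
    qed simp
  qed
  \<comment> \<open>Large enough to make the bound at least 1 at the finitely many scales below
    \<open>N\<close>.\<close>
  define C where "C = real N powr \<eta>"
  have N1: "real N \<ge> 1" by (simp add: N_def)
  have C1: "C \<ge> 1" unfolding C_def using N1 c\<eta> assms(2) by (intro ge_one_powr_ge_zero) auto
  have "?X R \<le> C * max 1 (real R) powr - \<eta>" for R
  proof (cases "R \<ge> N")
    case True
    have "real R powr - \<eta> = max 1 (real R) powr - \<eta>" using True N1 by (simp add: max_def)
    also have "\<dots> \<le> C * max 1 (real R) powr - \<eta>" using mult_right_mono[OF C1, of "max 1 (real R) powr - \<eta>"] by simp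
    finally show ?thesis using decay[OF True] by simp
  next
    case False
    then have "real N powr - \<eta> \<le> max 1 (real R) powr - \<eta>"
      using N1 c\<eta> assms(2) by (intro powr_mono2') auto
    then have "C * real N powr - \<eta> \<le> C * max 1 (real R) powr - \<eta>" using C1 by (intro mult_left_mono) auto
    moreover have "C * real N powr - \<eta> = 1" using N1 by (simp add: C_def flip: powr_add)
    ultimately show ?thesis using arm_le_1[OF pc, of "TYPE('d)" R] by simp
  qed
  then show ?thesis using c\<eta> C1 by (intro exI[of _ \<eta>] exI[of _ C]) auto
qed

theorem theorem1p1:
  assumes "CARD('d::finite) \<ge> 2"
  shows "one_arm_exponent TYPE('d) \<le>
           (if CARD('d) = 2 then ereal (1/3) else ereal (real CARD('d) / 3))"
proof (rule ccontr)
  let ?d = "real CARD('d)"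
  define c where "c = (if CARD('d) = 2 then 1/3 else ?d / 3)"
  assume "\<not> ?thesis"
  then have "ereal c < one_arm_exponent TYPE('d)" by (simp add: c_def split: if_splits)
  moreover have "0 \<le> c" by (simp add: c_def)
  ultimately obtain \<eta> C where \<eta>: "c < \<eta>" and C: "0 \<le> C"
    and arm: "\<And>R. arm TYPE('d) (perc_pc TYPE('d)) R \<le> C * max 1 (real R) powr - \<eta>"
    using fast_decay_of_exponent by blast
  \<comment> \<open>Lowering the exponent keeps the bound, so it can be moved into the range where
    the sums of powers are controlled. The caps 1/2 and \<open>5 * ?d / 12\<close> below lie
    strictly between 1/3 and 1, and between \<open>?d / 3\<close> and \<open>?d / 2\<close>.\<close>
  have weaken: "arm TYPE('d) (perc_pc TYPE('d)) R \<le> C * max 1 (real R) powr - \<eta>'" if "\<eta>' \<le> \<eta>" for \<eta>' R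
  proof -
    have "max 1 (real R) powr - \<eta> \<le> max 1 (real R) powr - \<eta>'" using that by (intro powr_mono) auto
    then show ?thesis using arm[of R] mult_left_mono[OF _ C] by (meson order.trans)
  qed
  show False
  proof (cases "CARD('d) = 2")
    case True
    show False
      using \<eta> by (intro no_fast_decay_planar[OF True, of "min \<eta> (1/2)" C] C weaken) (auto simp: c_def True)
  next
    case False
    show False
      using \<eta> assms False
      by (intro no_fast_decay_general[where 'd = 'd, of "min \<eta> (5 * ?d / 12)" C] C weaken) (auto simp: c_def)
  qed
qed

end
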